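(* Let $F:U\to\mathbb P^{r',s',t'}$ be a local orthogonal map, where $U\subset\mathbb P^{r,s}$ is a connected open set containing a null point. If $r'+s'\le 2\dim(\mathbb P^{r,s})-1=2(r+s)-3$, then $F$ is either null or quasi-linear. If in addition $F$ maps at least one positive point to a positive point, or at least one negative point to a negative point, then $F$ is quasi-standard.
   Context: Let $r,s,t\ge 0$ be integers with $n=r+s+t>0$. $\mathbb C^{r,s,t}$ denotes $\mathbb C^n$ equipped with the (possibly degenerate, indefinite) Hermitian form $\langle z,w\rangle_{r,s,t}=\sum_{j=1}^{r}z_j\bar w_j-\sum_{j=r+1}^{r+s}z_j\bar w_j$, and $\mathbb P^{r,s,t}$ is its projectivization; $\mathbb P^{r,s}=\mathbb P^{r,s,0}$. A point $[z]$ is positive, negative or null according as $\langle z,z\rangle_{r,s,t}>0$, $<0$ or $=0$; $[z]\perp[w]$ if $\langle z,w\rangle_{r,s,t}=0$. A complex linear subspace $H$ (or $\mathbb PH$) is a null space if the form vanishes identically on $H$. A holomorphic map $F:U\to\mathbb P^{r',s',t'}$ on a connected open set $U$ containing a null point is a local orthogonal map if $F(p)\perp F(q)$ for all $p,q\in U$ with $p\perp q$. $F$ is linear if it extends to a rational map induced by a linear map of the underlying vector spaces; standard if it is induced by a linear isometry $\mathbb C^{r,s,t}\to\mathbb C^{r',s',t'}$ (a linear map $L$ with $\langle Lu,Lv\rangle_{r',s',t'}=\langle u,v\rangle_{r,s,t}$); null if $F(U)$ is contained in a null space. $F$ is quasi-standard (resp. quasi-linear) if either $F$ is standard (resp. linear),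 or there is a decomposition $\mathbb C^{r',s',t'}=A\oplus B$ into nonzero subspaces with $\langle a,b\rangle_{r',s',t'}=0$ for all $a\in A,b\in B$ such that $\pi_A\circ F$ is standard (resp. linear) and $\pi_B\circ F$ is null, where $\pi_A:\mathbb P^{r',s',t'}\dashrightarrow\mathbb PA$, $\pi_B:\mathbb P^{r',s',t'}\dashrightarrow\mathbb PB$ are induced by the linear projections, and $\mathbb PA,\mathbb PB$ carry the restricted forms. *)

theory Defs
  imports "HOL-Analysis.Analysis"
begin

text \<open>Vectors of C^n are elements of complex ^ 'n for a finite index type 'n.
  A (possibly degenerate, indefinite) diagonal Hermitian form is given by a
  signature function sg :: 'n => real with values in {1,-1,0}; C^{r,s,t} is
  the case card{sg = 1} = r, card{sg = -1} = s, card{sg = 0} = t (this is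
  C^{r,s,t} up to a permutation of coordinates, i.e. up to a linear isometry).\<close>

definition is_signature :: "('n::finite \<Rightarrow> real) \<Rightarrow> nat \<Rightarrow> nat \<Rightarrow> nat \<Rightarrow> bool" where
  "is_signature sg r s t \<longleftrightarrow> (\<forall>i. sg i \<in> {1, -1, 0}) \<and>
     card {i. sg i = 1} = r \<and> card {i. sg i = -1} = s \<and> card {i. sg i = 0} = t"

definition hform :: "('n::finite \<Rightarrow> real) \<Rightarrow> complex ^ 'n \<Rightarrow> complex ^ 'n \<Rightarrow> complex" where
  "hform sg z w = (\<Sum>i\<in>UNIV. complex_of_real (sg i) * z $ i * cnj (w $ i))"

definition proj_eq :: "complex ^ 'n \<Rightarrow> complex ^ 'n \<Rightarrow> bool" where
  "proj_eq u v \<longleftrightarrow> u \<noteq> 0 \<and> v \<noteq> 0 \<and> (\<exists>c. c \<noteq> 0 \<and> u = c *s v)"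

definition csubspace :: "(complex ^ 'n) set \<Rightarrow> bool" where
  "csubspace H \<longleftrightarrow> 0 \<in> H \<and> (\<forall>x\<in>H. \<forall>y\<in>H. x + y \<in> H) \<and> (\<forall>c. \<forall>x\<in>H. c *s x \<in> H)"

definition null_space :: "('n::finite \<Rightarrow> real) \<Rightarrow> (complex ^ 'n) set \<Rightarrow> bool" where
  "null_space sg H \<longleftrightarrow> csubspace H \<and> (\<forall>x\<in>H. \<forall>y\<in>H. hform sg x y = 0)"

definition cholomorphic_on :: "(complex ^ 'n \<Rightarrow> complex ^ 'm) \<Rightarrow> (complex ^ 'n) set \<Rightarrow> bool" where
  "cholomorphic_on g W \<longleftrightarrow> open W \<and> (\<forall>x\<in>W. \<exists>D. (g has_derivative D) (at x) \<and>
      (\<forall>c v. D (c *s v) = c *s D v))"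

text \<open>An open subset U of the projective space P(C^n) is represented by its cone
  V = {z \<noteq> 0. [z] \<in> U}; U is open/connected iff V is (quotient topology, C^* connected).\<close>
definition proj_open_cone :: "(complex ^ 'n) set \<Rightarrow> bool" where
  "proj_open_cone V \<longleftrightarrow> open V \<and> 0 \<notin> V \<and> (\<forall>z\<in>V. \<forall>c. c \<noteq> 0 \<longrightarrow> c *s z \<in> V)"

text \<open>A holomorphic map F : U -> P(C^m), given by a representative F z (a nonzero
  vector) for each z in the cone V: F is constant on projective classes and locally
  it is the projectivisation of a holomorphic map into C^m - {0}.\<close>
definition proj_holomorphic :: "(complex ^ 'n \<Rightarrow> complex ^ 'm) \<Rightarrow> (complex ^ 'n) set \<Rightarrow> bool" where
  "proj_holomorphic F V \<longleftrightarrow>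
     (\<forall>z\<in>V. F z \<noteq> 0) \<and>
     (\<forall>z\<in>V. \<forall>c. c \<noteq> 0 \<longrightarrow> proj_eq (F (c *s z)) (F z)) \<and>
     (\<forall>z\<in>V. \<exists>W g. z \<in> W \<and> cholomorphic_on g W \<and>
         (\<forall>w\<in>W \<inter> V. g w \<noteq> 0 \<and> proj_eq (F w) (g w)))"

definition local_orthogonal ::
  "('n::finite \<Rightarrow> real) \<Rightarrow> ('m::finite \<Rightarrow> real) \<Rightarrow> (complex ^ 'n \<Rightarrow> complex ^ 'm) \<Rightarrow> (complex ^ 'n) set \<Rightarrow> bool" where
  "local_orthogonal sg sg' F V \<longleftrightarrow>
     proj_open_cone V \<and> connected V \<and> (\<exists>z\<in>V. hform sg z z = 0) \<and> proj_holomorphic F V \<and>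
     (\<forall>p\<in>V. \<forall>q\<in>V. hform sg p q = 0 \<longrightarrow> hform sg' (F p) (F q) = 0)"

text \<open>Linear maps are given by matrices A (acting as A *v z).  A map G (possibly a
  rational map, defined where G z \<noteq> 0) is induced by A if [G z] = [A z] wherever both
  sides are defined, and both are defined somewhere on V.\<close>
definition induced_by :: "(complex ^ 'n \<Rightarrow> complex ^ 'm) \<Rightarrow> (complex ^ 'n) set \<Rightarrow> complex ^ 'n ^ 'm \<Rightarrow> bool" where
  "induced_by G V A \<longleftrightarrow> (\<exists>z\<in>V. G z \<noteq> 0 \<and> A *v z \<noteq> 0) \<and>
     (\<forall>z\<in>V. G z \<noteq> 0 \<and> A *v z \<noteq> 0 \<longrightarrow> proj_eq (G z) (A *v z))"

definition isometry :: "('n::finite \<Rightarrow> real) \<Rightarrow> ('m::finite \<Rightarrow> real) \<Rightarrow> complex ^ 'n ^ 'm \<Rightarrow> bool" where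
  "isometry sg sg' A \<longleftrightarrow> (\<forall>u v. hform sg' (A *v u) (A *v v) = hform sg u v)"

definition linear_map :: "(complex ^ 'n \<Rightarrow> complex ^ 'm) \<Rightarrow> (complex ^ 'n) set \<Rightarrow> bool" where
  "linear_map F V \<longleftrightarrow> (\<exists>A. induced_by F V A)"

definition standard_map ::
  "('n::finite \<Rightarrow> real) \<Rightarrow> ('m::finite \<Rightarrow> real) \<Rightarrow> (complex ^ 'n \<Rightarrow> complex ^ 'm) \<Rightarrow> (complex ^ 'n) set \<Rightarrow> bool" where
  "standard_map sg sg' F V \<longleftrightarrow> (\<exists>A. isometry sg sg' A \<and> induced_by F V A)"

definition null_map :: "('m::finite \<Rightarrow> real) \<Rightarrow> (complex ^ 'n \<Rightarrow> complex ^ 'm) \<Rightarrow> (complex ^ 'n) set \<Rightarrow> bool" where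
  "null_map sg' F V \<longleftrightarrow> (\<exists>H. null_space sg' H \<and> (\<forall>z\<in>V. F z \<in> H))"

text \<open>Orthogonal decompositions C^m = A (+) B into nonzero subspaces are encoded by
  the projection matrix P onto A along B: A = range P, B = range (1 - P),
  pi_A = P, pi_B = 1 - P.\<close>
definition orth_decomp :: "('m::finite \<Rightarrow> real) \<Rightarrow> complex ^ 'm ^ 'm \<Rightarrow> bool" where
  "orth_decomp sg' P \<longleftrightarrow> P ** P = P \<and> P \<noteq> 0 \<and> P \<noteq> mat 1 \<and>
     (\<forall>x y. hform sg' (P *v x) ((mat 1 - P) *v y) = 0)"

definition quasi_linear ::
  "('m::finite \<Rightarrow> real) \<Rightarrow> (complex ^ 'n \<Rightarrow> complex ^ 'm) \<Rightarrow> (complex ^ 'n) set \<Rightarrow> bool" where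
  "quasi_linear sg' F V \<longleftrightarrow> linear_map F V \<or>
     (\<exists>P. orth_decomp sg' P \<and>
        (\<exists>L. (\<forall>u. P *v (L *v u) = L *v u) \<and> induced_by (\<lambda>z. P *v F z) V L) \<and>
        (\<exists>H. null_space sg' H \<and> H \<subseteq> range (\<lambda>y. (mat 1 - P) *v y) \<and>
             (\<forall>z\<in>V. (mat 1 - P) *v F z \<in> H)))"

definition quasi_standard ::
  "('n::finite \<Rightarrow> real) \<Rightarrow> ('m::finite \<Rightarrow> real) \<Rightarrow> (complex ^ 'n \<Rightarrow> complex ^ 'm) \<Rightarrow> (complex ^ 'n) set \<Rightarrow> bool" where
  "quasi_standard sg sg' F V \<longleftrightarrow> standard_map sg sg' F V \<or>
     (\<exists>P. orth_decomp sg' P \<and>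
        (\<exists>L. (\<forall>u. P *v (L *v u) = L *v u) \<and> isometry sg sg' L \<and> induced_by (\<lambda>z. P *v F z) V L) \<and>
        (\<exists>H. null_space sg' H \<and> H \<subseteq> range (\<lambda>y. (mat 1 - P) *v y) \<and>
             (\<forall>z\<in>V. (mat 1 - P) *v F z \<in> H)))"

end

theory Submission
  imports Defs "HOL-Complex_Analysis.Conformal_Mappings"
begin

text \<open>Represent \<open>F\<close> near a null point by a holomorphic \<open>f\<close> and put \<open>M(z, w) = \<langle>f z, f w\<rangle>\<close>, which is
  holomorphic in \<open>z\<close>, antiholomorphic in \<open>w\<close>, and vanishes whenever \<open>\<langle>z, w\<rangle> = 0\<close>. The bound on
  \<open>r' + s'\<close> says that \<open>M\<close> has rank at most \<open>2n - 3\<close>, where \<open>n = r + s\<close>. Fix an incident pair \<open>(z0, w0)\<close> and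
  biorthogonal vectors \<open>e i \<bottom> w0\<close>, \<open>c i \<bottom> z0\<close> with \<open>i < n - 2\<close>. On the lines \<open>z0 + t e i\<close> and
  \<open>w0 + s c i\<close> the matrix of \<open>M\<close> is block diagonal, and two further rows and columns add 2 to its
  rank. Hence the blocks cannot all have rank 2, and a genericity argument shows that \<open>M\<close> has rank at
  most one on \<open>(z0 + t a, w0 + s b)\<close> for all \<open>a \<bottom> w0\<close> and \<open>b \<bottom> z0\<close>. Differentiating at \<open>t = 0\<close> gives
  \<open>M(z, w) = \<phi>(z) \<psi>(w) \<langle>z, w\<rangle>\<close> locally, unless \<open>M = 0\<close>. By Hermitian symmetry
  \<open>f\<close> is, after rescaling, \<open>\<plusminus>\<close>-isometric modulo a null space, and the identity theorem spreads this
  over the whole connected cone.\<close>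

section \<open>Diagonal Hermitian forms\<close>

text \<open>The count is sharp: \<open>n - 2\<close> blocks of rank 2 and the two extra rows give
  rank \<open>2n - 2\<close>, one more than \<open>2n - 3\<close>. The extra rows exist only at base
  pairs where neither \<open>f z0\<close> nor \<open>f w0\<close> is orthogonal to all values of
  \<open>f\<close>. So the minors are shown to vanish at such good pairs, and the result is carried
  to all incident pairs because good pairs are dense and nonvanishing is open. The second obstacle
  is the division after differentiating: it needs an incident pair at which a derivative of
  \<open>f\<close> transverse to the incidence relation pairs nontrivially with \<open>f\<close>. If
  there were none, directional derivatives of \<open>f\<close> would satisfy the same orthogonality
  relation as \<open>f\<close>, and the same rank count would apply with one row of each block
  replaced by a derivative. For this reason the minors carry a second map \<open>f2\<close>.
  Several-variable arguments are reduced to complex lines meeting a convex \<open>B\<close>; the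
  second argument of the form runs with a conjugated parameter, so that everything is holomorphic in
  one variable.\<close>

lemma hform_add_left: "hform g (x + y) w = hform g x w + hform g y w"
  by (simp add: hform_def algebra_simps sum.distrib)

lemma hform_add_right: "hform g w (x + y) = hform g w x + hform g w y"
  by (simp add: hform_def algebra_simps sum.distrib)

lemma hform_diff_left: "hform g (x - y) w = hform g x w - hform g y w"
  by (simp add: hform_def algebra_simps sum_subtractf)

lemma hform_diff_right: "hform g w (x - y) = hform g w x - hform g w y"
  by (simp add: hform_def algebra_simps sum_subtractf)

lemma hform_scale_left: "hform g (c *s x) w = c * hform g x w"
  by (simp add: hform_def sum_distrib_left algebra_simps)

lemma hform_scale_right: "hform g w (c *s x) = cnj c * hform g w x"
  by (simp add: hform_def sum_distrib_left algebra_simps)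

lemma hform_zero_left [simp]: "hform g 0 w = 0"
  by (simp add: hform_def)

lemma hform_zero_right [simp]: "hform g w 0 = 0"
  by (simp add: hform_def)

lemma hform_sum_right: "hform g w (\<Sum>i\<in>I. x i) = (\<Sum>i\<in>I. hform g w (x i))"
  by (induction I rule: infinite_finite_induct) (auto simp: hform_add_right)

lemmas hform_simps = hform_add_left hform_add_right hform_diff_left hform_diff_right
  hform_scale_left hform_scale_right

lemma cnj_hform: "cnj (hform g x y) = hform g y x"
  by (simp add: hform_def algebra_simps)

lemma hform_commute_eq_0: "hform g x y = 0 \<longleftrightarrow> hform g y x = 0"
  by (metis cnj_hform complex_cnj_zero)

lemma continuous_on_hform [continuous_intros]:
  "continuous_on S u \<Longrightarrow> continuous_on S v \<Longrightarrow> continuous_on S (\<lambda>x. hform g (u x) (v x))"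
  unfolding hform_def by (intro continuous_intros)

lemma tendsto_hform [tendsto_intros]:
  "(u \<longlongrightarrow> x) G \<Longrightarrow> (v \<longlongrightarrow> y) G \<Longrightarrow> ((\<lambda>t. hform g (u t) (v t)) \<longlongrightarrow> hform g x y) G"
  unfolding hform_def by (intro tendsto_intros)

lemma continuous_on_smult [continuous_intros]:
  fixes u :: "'a::topological_space \<Rightarrow> complex ^ 'n"
  assumes "continuous_on S c" "continuous_on S u"
  shows "continuous_on S (\<lambda>x. c x *s u x)"
  unfolding vector_scalar_mult_def using assms by (intro continuous_intros) auto

lemma tendsto_smult [tendsto_intros]:
  fixes u :: "'a \<Rightarrow> complex ^ 'n"
  assumes "(c \<longlongrightarrow> d) G" "(u \<longlongrightarrow> x) G"
  shows "((\<lambda>t. c t *s u t) \<longlongrightarrow> d *s x) G"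
  unfolding vector_scalar_mult_def using assms by (intro tendsto_intros) auto

lemma tendsto_line:
  fixes p v :: "complex ^ 'n"
  shows "((\<lambda>t. p + complex_of_real t *s v) \<longlongrightarrow> p) (at_right 0)"
proof -
  have "((\<lambda>t. p + complex_of_real t *s v) \<longlongrightarrow> p + complex_of_real 0 *s v) (at_right 0)"
    by (intro tendsto_intros tendsto_smult)
  then show ?thesis by simp
qed

lemma norm_smult_complex: "norm (c *s (x :: complex ^ 'n)) = cmod c * norm x"
  by (simp add: norm_vec_def L2_set_def norm_mult power_mult_distrib sum_distrib_left[symmetric]
      real_sqrt_mult)

lemma hform_nondegenerate:
  assumes "\<And>i. g i \<noteq> 0" "\<And>y. hform g x y = 0"
  shows "x = 0"
proof -
  have "x $ i = 0" for i
  proof -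
    have "hform g x (axis i 1) = (\<Sum>j\<in>UNIV. if j = i then complex_of_real (g i) * x $ i else 0)"
      unfolding hform_def by (intro sum.cong) (auto simp: axis_def)
    then show ?thesis using assms(1)[of i] assms(2)[of "axis i 1"] by simp
  qed
  then show ?thesis by (simp add: vec_eq_iff)
qed

section \<open>Linear algebra: homogeneous systems, duality and biorthogonal vectors\<close>

lemma homogeneous_system:
  fixes a :: "'j \<Rightarrow> 'i \<Rightarrow> 'a::field"
  assumes "finite J" "finite I" "card J < card I"
  shows "\<exists>c. (\<exists>i\<in>I. c i \<noteq> 0) \<and> (\<forall>j\<in>J. (\<Sum>i\<in>I. c i * a j i) = 0)"
  using assms
proof (induction J arbitrary: I a rule: finite_induct)
  case empty
  then obtain i where "i \<in> I" by fastforce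
  then show ?case by (intro exI[of _ "\<lambda>_. 1"]) auto
next
  case (insert j J)
  show ?case
  proof (cases "\<forall>i\<in>I. a j i = 0")
    case True
    then show ?thesis using insert.IH[of I a] insert.prems insert.hyps by auto
  next
    case False
    then obtain i0 where i0: "i0 \<in> I" "a j i0 \<noteq> 0" by blast
    let ?I = "I - {i0}"
    have "card J < card ?I" using insert.prems insert.hyps i0 by simp
    then obtain c where c: "\<exists>i\<in>?I. c i \<noteq> 0"
      "\<forall>l\<in>J. (\<Sum>i\<in>?I. c i * (a l i - a l i0 * a j i / a j i0)) = 0"
      using insert.IH[of ?I "\<lambda>l i. a l i - a l i0 * a j i / a j i0"] insert.prems by auto
    \<comment> \<open>Back substitution: \<open>c\<close> solves the system with \<open>i0\<close>
      eliminated, and equation \<open>j\<close> forces the value at \<open>i0\<close>.\<close>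
    define d where "d = c(i0 := - (\<Sum>i\<in>?I. c i * a j i) / a j i0)"
    have split: "(\<Sum>i\<in>I. d i * a l i) = d i0 * a l i0 + (\<Sum>i\<in>?I. c i * a l i)" for l
    proof -
      have "(\<Sum>i\<in>I. d i * a l i) = d i0 * a l i0 + (\<Sum>i\<in>?I. d i * a l i)"
        using i0 insert.prems by (simp add: sum.remove)
      also have "(\<Sum>i\<in>?I. d i * a l i) = (\<Sum>i\<in>?I. c i * a l i)"
        by (intro sum.cong) (auto simp: d_def)
      finally show ?thesis .
    qed
    have "(\<Sum>i\<in>I. d i * a l i) = 0" if "l \<in> J" for l
    proof -
      have "0 = (\<Sum>i\<in>?I. c i * a l i) - (\<Sum>i\<in>?I. c i * a j i) * (a l i0 / a j i0)"
        using c(2) that by (simp add: algebra_simps sum_subtractf sum_distrib_left)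
      then show ?thesis unfolding split by (simp add: d_def field_simps)
    qed
    moreover have "(\<Sum>i\<in>I. d i * a j i) = 0"
      unfolding split using i0 by (simp add: d_def)
    moreover have "\<exists>i\<in>I. d i \<noteq> 0" using c(1) by (auto simp: d_def)
    ultimately show ?thesis by (intro exI[of _ d]) auto
  qed
qed

text \<open>The form sees only coordinates with \<open>g j \<noteq> 0\<close>. Cancelling these is a
  homogeneous system with as many equations as the rank, so more vectors than the rank have a
  nontrivial combination in the radical.\<close>

lemma hform_combination_in_radical:
  fixes g :: "'m::finite \<Rightarrow> real" and x :: "'i \<Rightarrow> complex ^ 'm"
  assumes "finite I" "card {j. g j \<noteq> 0} < card I"
  obtains c where "\<exists>i\<in>I. c i \<noteq> 0" "\<And>y. (\<Sum>i\<in>I. c i * hform g (x i) y) = 0"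
proof -
  obtain c where c: "\<exists>i\<in>I. c i \<noteq> 0"
    "\<forall>j\<in>{j. g j \<noteq> 0}. (\<Sum>i\<in>I. c i * (x i $ j)) = 0"
    using homogeneous_system[of "{j. g j \<noteq> 0}" I "\<lambda>j i. x i $ j"] assms by auto
  have "(\<Sum>i\<in>I. c i * hform g (x i) y) = 0" for y
  proof -
    have "(\<Sum>i\<in>I. c i * hform g (x i) y) =
       (\<Sum>i\<in>I. \<Sum>j\<in>UNIV. (complex_of_real (g j) * cnj (y $ j)) * (c i * (x i $ j)))"
      by (simp add: hform_def sum_distrib_left algebra_simps)
    also have "\<dots> = (\<Sum>j\<in>UNIV. \<Sum>i\<in>I. (complex_of_real (g j) * cnj (y $ j)) * (c i * (x i $ j)))"
      by (rule sum.swap)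
    also have "\<dots> = (\<Sum>j\<in>UNIV. (complex_of_real (g j) * cnj (y $ j)) * (\<Sum>i\<in>I. c i * (x i $ j)))"
      by (simp only: sum_distrib_left)
    also have "\<dots> = 0" using c(2) by (intro sum.neutral) auto
    finally show ?thesis .
  qed
  then show ?thesis using that c(1) by blast
qed

text \<open>Linear duality, by induction on \<open>S\<close>: if some \<open>u\<close> is killed by
  \<open>S\<close> but not by \<open>e\<close>, a multiple of \<open>e\<close> is subtracted from
  \<open>x\<close> so that the difference also vanishes at \<open>u\<close>; any test vector can
  then be corrected by a multiple of \<open>u\<close>.\<close>

lemma hform_annihilator_span:
  assumes "finite S" "\<And>y. \<forall>e\<in>S. hform g e y = 0 \<Longrightarrow> hform g x y = 0"
  shows "\<exists>c. \<forall>y. hform g x y = (\<Sum>e\<in>S. c e * hform g e y)"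
  using assms
proof (induction S arbitrary: x rule: finite_induct)
  case empty
  then show ?case by simp
next
  case (insert e S)
  show ?case
  proof (cases "\<exists>u. (\<forall>e\<in>S. hform g e u = 0) \<and> hform g e u \<noteq> 0")
    case True
    then obtain u where u: "\<forall>e\<in>S. hform g e u = 0" "hform g e u \<noteq> 0" by blast
    define k where "k = hform g x u / hform g e u"
    have "hform g (x - k *s e) y = 0" if y: "\<forall>e\<in>S. hform g e y = 0" for y
    proof -
      define y' where "y' = y - cnj (hform g e y / hform g e u) *s u"
      have "hform g x y' = 0"
        using u y by (intro insert.prems) (auto simp: y'_def hform_simps)
      then show ?thesis using u(2) by (simp add: y'_def hform_simps k_def field_simps)
    qed
    then obtain c where c: "\<forall>y. hform g (x - k *s e) y = (\<Sum>e\<in>S. c e * hform g e y)"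
      using insert.IH by meson
    have "hform g x y = (\<Sum>e'\<in>insert e S. (c(e := k)) e' * hform g e' y)" for y
    proof -
      have "(\<Sum>e'\<in>S. (c(e := k)) e' * hform g e' y) = (\<Sum>e\<in>S. c e * hform g e y)"
        using insert.hyps by (intro sum.cong) auto
      then show ?thesis using c[rule_format, of y] insert.hyps
        by (simp add: hform_simps algebra_simps)
    qed
    then show ?thesis by blast
  next
    case False
    have "hform g x y = 0" if "\<forall>e\<in>S. hform g e y = 0" for y
      using insert.prems False that by blast
    then obtain c where c: "\<forall>y. hform g x y = (\<Sum>e\<in>S. c e * hform g e y)"
      using insert.IH by meson
    have "hform g x y = (\<Sum>e'\<in>insert e S. (c(e := 0)) e' * hform g e' y)" for y
    proof -
      have "(\<Sum>e'\<in>S. (c(e := 0)) e' * hform g e' y) = (\<Sum>e\<in>S. c e * hform g e y)"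
        using insert.hyps by (intro sum.cong) auto
      then show ?thesis using c insert.hyps by simp
    qed
    then show ?thesis by blast
  qed
qed

text \<open>The vector \<open>x\<close>, which becomes \<open>p\<close>, satisfies at most
  \<open>j + 2\<close> equations in \<open>CARD('n)\<close> unknowns. If no admissible
  \<open>q\<close> paired with it nontrivially, duality would make \<open>x\<close> a combination of
  \<open>z0\<close> and the \<open>e i\<close>; pairing with \<open>c l\<close> and with
  \<open>zt\<close> would kill every coefficient.\<close>

lemma biorthogonal_extension:
  fixes g :: "'n::finite \<Rightarrow> real" and z0 w0 :: "complex ^ 'n" and e c :: "nat \<Rightarrow> complex ^ 'n"
  assumes g: "\<And>i. g i \<noteq> 0" and z0: "z0 \<noteq> 0" and zw: "hform g z0 w0 = 0"
    and j: "j + 2 < CARD('n)"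
    and ew: "\<And>i. i < j \<Longrightarrow> hform g (e i) w0 = 0" and zc: "\<And>i. i < j \<Longrightarrow> hform g z0 (c i) = 0"
    and off: "\<And>i l. i < j \<Longrightarrow> l < j \<Longrightarrow> i \<noteq> l \<Longrightarrow> hform g (e i) (c l) = 0"
    and diag: "\<And>i. i < j \<Longrightarrow> hform g (e i) (c i) \<noteq> 0"
  shows "\<exists>p q. hform g p w0 = 0 \<and> hform g z0 q = 0 \<and>
    (\<forall>i<j. hform g p (c i) = 0 \<and> hform g (e i) q = 0) \<and> hform g p q \<noteq> 0"
proof -
  \<comment> \<open>\<open>z0\<close> is itself orthogonal to \<open>w0\<close> and to all
    \<open>c i\<close>; orthogonality to \<open>zt\<close> keeps \<open>x\<close> from being a
    nonzero multiple of it.\<close>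
  obtain zt where zt: "hform g z0 zt \<noteq> 0"
    using hform_nondegenerate[of g z0] g z0 by blast
  let ?J = "insert w0 (insert zt (c ` {..<j}))"
  have "card ?J \<le> j + 2"
    using card_insert_le_m1 card_image_le[of "{..<j}" c]
    by (simp add: card_insert_if)
  then obtain a where a: "\<exists>i\<in>UNIV. a i \<noteq> 0"
    "\<forall>y\<in>?J. (\<Sum>i\<in>(UNIV::'n set). a i * (complex_of_real (g i) * cnj (y $ i))) = 0"
    using homogeneous_system[of ?J "UNIV::'n set" "\<lambda>y i. complex_of_real (g i) * cnj (y $ i)"] j
    by auto
  define x :: "complex ^ 'n" where "x = (\<chi> i. a i)"
  have x0: "x \<noteq> 0" using a(1) by (auto simp: x_def vec_eq_iff)
  have xJ: "hform g x y = 0" if "y \<in> ?J" for y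
    using a(2)[rule_format, OF that] by (simp add: hform_def x_def mult_ac)
  have "\<exists>q. (\<forall>e'\<in>insert z0 (e ` {..<j}). hform g e' q = 0) \<and> hform g x q \<noteq> 0"
  proof (rule ccontr)
    assume "\<not> ?thesis"
    then obtain k where k: "\<And>y. hform g x y = (\<Sum>e'\<in>insert z0 (e ` {..<j}). k e' * hform g e' y)"
      using hform_annihilator_span[of "insert z0 (e ` {..<j})" g x] by auto
    have ke: "k (e l) = 0" if l: "l < j" for l
    proof -
      have "0 = (\<Sum>e'\<in>insert z0 (e ` {..<j}). k e' * hform g e' (c l))"
        using k[of "c l"] xJ[of "c l"] l by simp
      also have "\<dots> = (\<Sum>e'\<in>insert z0 (e ` {..<j}). if e' = e l then k (e l) * hform g (e l) (c l) else 0)"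
        using l zc off by (intro sum.cong) auto
      also have "\<dots> = k (e l) * hform g (e l) (c l)" using l by (simp add: sum.delta')
      finally show ?thesis using diag[OF l] by simp
    qed
    have kk: "hform g x y = k z0 * hform g z0 y" for y
    proof -
      have "hform g x y = (\<Sum>e'\<in>insert z0 (e ` {..<j}). if e' = z0 then k z0 * hform g z0 y else 0)"
        unfolding k using ke by (intro sum.cong) auto
      then show ?thesis by (simp add: sum.delta')
    qed
    have "k z0 = 0" using kk[of zt] xJ[of zt] zt by simp
    then have "x = 0" using kk hform_nondegenerate[of g x] g by simp
    then show False using x0 by simp
  qed
  then obtain q where "\<forall>e'\<in>insert z0 (e ` {..<j}). hform g e' q = 0" "hform g x q \<noteq> 0" by blast
  then show ?thesis using xJ by (intro exI[of _ x] exI[of _ q]) auto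
qed

section \<open>Functions that are holomorphic along complex lines\<close>

text \<open>A slice-wise notion, fitted to one-variable theorems, which passes to directional
  derivatives as shown below.\<close>

definition line_holomorphic_on :: "(complex ^ 'n \<Rightarrow> complex ^ 'm) \<Rightarrow> (complex ^ 'n) set \<Rightarrow> bool"
  where "line_holomorphic_on f B \<longleftrightarrow> continuous_on B f \<and>
    (\<forall>j z u. (\<lambda>t. f (z + t *s u) $ j) holomorphic_on {t. z + t *s u \<in> B})"

definition dirderiv :: "(complex ^ 'n \<Rightarrow> complex ^ 'm) \<Rightarrow> complex ^ 'n \<Rightarrow> complex ^ 'n \<Rightarrow> complex ^ 'm"
  where "dirderiv f v z = (\<chi> j. deriv (\<lambda>t. f (z + t *s v) $ j) 0)"

section \<open>Slices along complex lines and the identity theorem\<close>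

lemma open_line:
  fixes B :: "(complex ^ 'n) set"
  shows "open B \<Longrightarrow> open {t. z + t *s u \<in> B}"
  using open_vimage[of B "\<lambda>t. z + t *s u", OF _ continuous_on_add[OF continuous_on_const
      continuous_on_smult[OF continuous_on_id continuous_on_const]]]
  by (simp add: vimage_def)

lemma open_cnj_line:
  fixes B :: "(complex ^ 'n) set"
  shows "open B \<Longrightarrow> open {t. z + cnj t *s u \<in> B}"
  using open_vimage[of B "\<lambda>t. z + cnj t *s u", OF _ continuous_on_add[OF continuous_on_const
      continuous_on_smult[OF continuous_on_cnj[OF continuous_on_id] continuous_on_const]]]
  by (simp add: vimage_def)

text \<open>Convex slices are connected, as the identity theorem requires, and contain the real
  segment from 0 to 1 once they contain its ends.\<close>

lemma convex_line:
  fixes B :: "(complex ^ 'n) set"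
  assumes "convex B" shows "convex {t. z + t *s u \<in> B}"
proof (rule convexI)
  fix x y :: complex and a b :: real
  assume *: "x \<in> {t. z + t *s u \<in> B}" "y \<in> {t. z + t *s u \<in> B}" "0 \<le> a" "0 \<le> b" "a + b = 1"
  have "a *\<^sub>R (z + x *s u) + b *\<^sub>R (z + y *s u) = z + (a *\<^sub>R x + b *\<^sub>R y) *s u"
  proof -
    have b: "b = 1 - a" using * by simp
    show ?thesis unfolding b
      by (simp add: vec_eq_iff scaleR_conv_of_real[where 'a=complex] algebra_simps)
  qed
  moreover have "a *\<^sub>R (z + x *s u) + b *\<^sub>R (z + y *s u) \<in> B"
    using assms * by (intro convexD) auto
  ultimately show "a *\<^sub>R x + b *\<^sub>R y \<in> {t. z + t *s u \<in> B}" by simp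
qed

lemma convex_cnj_line:
  fixes B :: "(complex ^ 'n) set"
  assumes "convex B" shows "convex {t. z + cnj t *s u \<in> B}"
proof -
  have "{t. z + cnj t *s u \<in> B} = cnj -` {t. z + t *s u \<in> B}" by auto
  moreover have "linear cnj" using bounded_linear_cnj by (rule bounded_linear.linear)
  ultimately show ?thesis using convex_linear_vimage[of cnj, OF _ convex_line[OF assms, of z u]] by simp
qed

lemma line_holomorphic_onD:
  assumes "line_holomorphic_on f B" "\<And>t. t \<in> S \<Longrightarrow> z + t *s u \<in> B"
  shows "(\<lambda>t. f (z + t *s u) $ j) holomorphic_on S"
proof -
  have "(\<lambda>t. f (z + t *s u) $ j) holomorphic_on {t. z + t *s u \<in> B}"
    using assms(1) unfolding line_holomorphic_on_def by blast
  then show ?thesis by (rule holomorphic_on_subset) (use assms(2) in blast)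
qed

lemma line_holomorphic_onI:
  assumes "continuous_on B f" "\<And>j z u. (\<lambda>t. f (z + t *s u) $ j) holomorphic_on {t. z + t *s u \<in> B}"
  shows "line_holomorphic_on f B"
  using assms unfolding line_holomorphic_on_def by blast

lemma line_has_derivative:
  fixes z u :: "complex ^ 'n"
  shows "((\<lambda>t. z + t *s u) has_derivative (\<lambda>h. h *s u)) (at t)"
proof -
  have "bounded_linear (\<lambda>h::complex. h *s u)"
    by (intro linear_conv_bounded_linear[THEN iffD1] linearI)
       (auto simp: vec_eq_iff algebra_simps)
  from has_derivative_add[OF has_derivative_const bounded_linear_imp_has_derivative[OF this]]
  show ?thesis by simp
qed

lemma cholomorphic_imp_line_holomorphic:
  fixes f :: "complex ^ 'n \<Rightarrow> complex ^ 'm"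
  assumes "cholomorphic_on f W"
  shows "line_holomorphic_on f W"
proof -
  have W: "open W" using assms unfolding cholomorphic_on_def by blast
  have ex: "\<exists>D. (f has_derivative D) (at x) \<and> (\<forall>c v. D (c *s v) = c *s D v)" if "x \<in> W" for x
    using assms that unfolding cholomorphic_on_def by blast
  have "continuous_on W f"
  proof (intro continuous_at_imp_continuous_on ballI)
    fix x assume "x \<in> W"
    then obtain D where "(f has_derivative D) (at x)" using ex by blast
    then show "isCont f x" by (rule has_derivative_continuous)
  qed
  moreover have "(\<lambda>t. f (z + t *s u) $ j) holomorphic_on {t. z + t *s u \<in> W}" for j z u
  proof (rule holomorphic_onI)
    fix t assume "t \<in> {t. z + t *s u \<in> W}"
    then have "z + t *s u \<in> W" by simp
    from ex[OF this] obtain D where D: "(f has_derivative D) (at (z + t *s u))"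
      and lin: "\<forall>c v. D (c *s v) = c *s D v" by (elim exE conjE)
    have "((\<lambda>t. f (z + t *s u)) has_derivative (\<lambda>h. D (h *s u))) (at t)"
      using has_derivative_compose[OF line_has_derivative D] .
    then have "((\<lambda>t. f (z + t *s u) $ j) has_derivative (\<lambda>h. D (h *s u) $ j)) (at t)"
      by (rule bounded_linear.has_derivative[OF bounded_linear_vec_nth])
    moreover have "(\<lambda>h. D (h *s u) $ j) = (*) (D u $ j)"
      by (simp add: lin fun_eq_iff)
    ultimately have "((\<lambda>t. f (z + t *s u) $ j) has_field_derivative (D u $ j)) (at t)"
      unfolding has_field_derivative_def by metis
    then have "(\<lambda>t. f (z + t *s u) $ j) field_differentiable (at t)"
      unfolding field_differentiable_def by blast
    then show "(\<lambda>t. f (z + t *s u) $ j) field_differentiable at t within {t. z + t *s u \<in> W}"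
      by (rule field_differentiable_at_within)
  qed
  ultimately show ?thesis by (rule line_holomorphic_onI)
qed

text \<open>This link makes \<open>dirderiv\<close> linear in the direction, which its definition by
  single slices does not give.\<close>

lemma cholomorphic_dirderiv:
  fixes f :: "complex ^ 'n \<Rightarrow> complex ^ 'm"
  assumes "(f has_derivative D) (at z)" "\<And>c v. D (c *s v) = c *s D v"
  shows "dirderiv f v z = D v"
proof -
  have 1: "((\<lambda>t. z + t *s v) has_derivative (\<lambda>h. h *s v)) (at 0)"
    by (rule line_has_derivative)
  have "(f has_derivative D) (at (z + 0 *s v))" using assms by simp
  from has_derivative_compose[OF 1 this]
  have *: "((\<lambda>t. f (z + t *s v)) has_derivative (\<lambda>h. D (h *s v))) (at 0)" .
  have "((\<lambda>t. f (z + t *s v) $ j) has_field_derivative (D v $ j)) (at 0)" for j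
    using bounded_linear.has_derivative[OF bounded_linear_vec_nth[of j] *]
    by (simp add: assms(2) has_field_derivative_def mult.commute[of _ "D v $ j"])
  then show ?thesis by (simp add: dirderiv_def vec_eq_iff DERIV_imp_deriv)
qed

text \<open>The second slot of the form is antilinear; feeding \<open>cnj t\<close> into it cancels
  the conjugation. Both arguments can thus move at once, holomorphically in
  \<open>t\<close>.\<close>

lemma hform_line_holomorphic:
  assumes "line_holomorphic_on f B" "line_holomorphic_on f2 B" "open B"
  shows "(\<lambda>t. hform g (f (z + t *s u)) (f2 (w + cnj t *s v))) holomorphic_on
           {t. z + t *s u \<in> B \<and> w + cnj t *s v \<in> B}" (is "_ holomorphic_on ?S")
proof -
  have 1: "(\<lambda>t. f (z + t *s u) $ j) holomorphic_on ?S" for j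
    using assms(1) by (rule line_holomorphic_onD) simp
  have 2: "(\<lambda>t. cnj (f2 (w + cnj t *s v) $ j)) holomorphic_on ?S" for j
  proof -
    let ?A = "{t. w + cnj t *s v \<in> B}"
    have "cnj ` ?A = {t. w + t *s v \<in> B}" by (auto simp: image_iff intro!: exI[of _ "cnj _"])
    then have "(\<lambda>t. f2 (w + t *s v) $ j) holomorphic_on cnj ` ?A"
      using assms(2) by (intro line_holomorphic_onD) auto
    from holomorphic_on_compose_cnj_cnj[OF this open_cnj_line[OF assms(3)]]
    have "(\<lambda>t. cnj (f2 (w + cnj t *s v) $ j)) holomorphic_on ?A" by (simp add: o_def)
    then show ?thesis by (rule holomorphic_on_subset) auto
  qed
  show ?thesis unfolding hform_def using 1 2 by (intro holomorphic_intros) auto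
qed

text \<open>The source of the density arguments: zeros at all small positive parameters would
  accumulate at 0 and force a zero at 1.\<close>

lemma holomorphic_nonzero_near_0:
  assumes "\<psi> holomorphic_on S" "open S" "convex S" "0 \<in> S" "1 \<in> S" "\<psi> 1 \<noteq> 0" "(\<delta>::real) > 0"
  shows "\<exists>\<theta>. 0 < \<theta> \<and> \<theta> < \<delta> \<and> \<theta> < 1 \<and> complex_of_real \<theta> \<in> S \<and> \<psi> (complex_of_real \<theta>) \<noteq> 0"
proof -
  have "\<exists>\<theta>. 0 < \<theta> \<and> \<theta> < min \<delta> 1 \<and> \<psi> (complex_of_real \<theta>) \<noteq> 0"
  proof (rule ccontr)
    assume *: "\<not> ?thesis"
    let ?U = "complex_of_real ` {0<..<min \<delta> 1}"
    have sub: "complex_of_real \<theta> \<in> S" if "0 \<le> \<theta>" "\<theta> \<le> 1" for \<theta>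
      using convexD[OF assms(3,4,5), of "1 - \<theta>" \<theta>] that by (simp add: scaleR_conv_of_real)
    have "0 islimpt ?U"
    proof (rule islimptI)
      fix T :: "complex set" assume T: "0 \<in> T" "open T"
      then obtain e where e: "e > 0" "ball 0 e \<subseteq> T" by (meson openE)
      let ?x = "min e (min \<delta> 1) / 2"
      have "complex_of_real ?x \<in> ball 0 e"
        using e(1) assms(7) by (simp only: mem_ball dist_norm norm_minus_commute norm_of_real) auto
      moreover have "?x \<in> {0<..<min \<delta> 1}" "?x \<noteq> 0" using e(1) assms(7) by auto
      ultimately show "\<exists>y\<in>?U. y \<in> T \<and> y \<noteq> 0" using e(2) by (metis imageI of_real_eq_0_iff subsetD)
    qed
    then have "\<psi> 1 = 0"
      using assms * sub
      by (intro analytic_continuation[OF assms(1,2) convex_connected[OF assms(3)], of ?U 0 1])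
         (auto simp: less_imp_le)
    then show False using assms by simp
  qed
  moreover have "complex_of_real \<theta> \<in> S" if "0 \<le> \<theta>" "\<theta> \<le> 1" for \<theta>
    using convexD[OF assms(3,4,5), of "1 - \<theta>" \<theta>] that by (simp add: scaleR_conv_of_real)
  ultimately show ?thesis by (meson less_imp_le min_less_iff_conj)
qed

text \<open>A point with nonzero value would lie on a slice through \<open>z1\<close> along which
  \<open>h\<close> vanishes for all small positive parameters.\<close>

lemma identity_theorem_convex:
  fixes h :: "complex ^ 'n \<Rightarrow> complex"
  assumes B: "open B" "convex B"
    and hol: "\<And>z u. (\<lambda>t. h (z + t *s u)) holomorphic_on {t. z + t *s u \<in> B}"
    and z1: "z1 \<in> B" "open T" "z1 \<in> T" "\<And>z. z \<in> T \<Longrightarrow> z \<in> B \<Longrightarrow> h z = 0" and z: "z \<in> B"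
  shows "h z = 0"
proof (rule ccontr)
  assume nz: "h z \<noteq> 0"
  have "\<forall>\<^sub>F t in at_right 0. z1 + complex_of_real t *s (z - z1) \<in> T"
    by (rule topological_tendstoD[OF tendsto_line]) (use z1 in auto)
  then obtain \<delta> :: real where \<delta>: "\<delta> > 0" "\<And>t. 0 < t \<Longrightarrow> t < \<delta> \<Longrightarrow> z1 + complex_of_real t *s (z - z1) \<in> T"
    unfolding eventually_at_right_field by blast
  have "0 \<in> {t. z1 + t *s (z - z1) \<in> B}" "1 \<in> {t. z1 + t *s (z - z1) \<in> B}" "h (z1 + 1 *s (z - z1)) \<noteq> 0"
    using z1 z nz by auto
  from holomorphic_nonzero_near_0[OF hol open_line[OF B(1)] convex_line[OF B(2)] this \<delta>(1)]
  obtain \<theta> :: real where "0 < \<theta>" "\<theta> < \<delta>" "z1 + complex_of_real \<theta> *s (z - z1) \<in> B"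
    "h (z1 + complex_of_real \<theta> *s (z - z1)) \<noteq> 0" by blast
  then show False using \<delta>(2) z1(4) by blast
qed

text \<open>Cauchy's inequality bounds the second derivatives of all nearby slices by one constant,
  so the quadratic Taylor remainder is uniform in the base point.\<close>

lemma uniform_difference_quotients:
  fixes f :: "complex ^ 'n \<Rightarrow> complex ^ 'm" and v z0 :: "complex ^ 'n"
  assumes f: "line_holomorphic_on f B" and B: "open B" and z0: "z0 \<in> B"
  obtains d where "d > 0" "cball z0 (2 * d) \<subseteq> B"
    "uniform_limit (cball z0 d)
       (\<lambda>n z. of_nat (Suc n) * (f (z + (1 / of_nat (Suc n)) *s v) $ j - f z $ j))
       (\<lambda>z. dirderiv f v z $ j) sequentially"
proof -
  obtain e where e: "e > 0" "cball z0 e \<subseteq> B" using B z0 open_contains_cball by blast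
  \<comment> \<open>One third for the base point, two thirds for the shift \<open>t *s v\<close>
    with \<open>cmod t \<le> 2 * r\<close>.\<close>
  define d where "d = e / 3"
  have d: "d > 0" "cball z0 (3 * d) \<subseteq> B" using e by (auto simp: d_def)
  have "continuous_on (cball z0 (3 * d)) (\<lambda>z. f z $ j)"
    using f d by (intro continuous_intros) (auto simp: line_holomorphic_on_def intro: continuous_on_subset)
  then have "bounded ((\<lambda>z. f z $ j) ` cball z0 (3 * d))"
    by (intro compact_imp_bounded compact_continuous_image) auto
  then obtain C where C: "\<And>z. z \<in> cball z0 (3 * d) \<Longrightarrow> cmod (f z $ j) \<le> C"
    unfolding bounded_iff by (metis imageI)
  \<comment> \<open>The summand 1 keeps the quotient meaningful for \<open>v = 0\<close>.\<close>
  define r where "r = d / (norm v + 1)"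
  have r: "r > 0" using d by (simp add: r_def add_nonneg_pos)
  have rv: "t * norm v \<le> k * d" if "t \<le> k * r" "0 \<le> t" "0 \<le> k" for t k
  proof -
    have "t * norm v \<le> t * (norm v + 1)" using that by (intro mult_left_mono) auto
    also have "\<dots> \<le> (k * r) * (norm v + 1)" using that by (intro mult_right_mono) auto
    also have "\<dots> = k * d" by (simp add: r_def add_nonneg_eq_0_iff)
    finally show ?thesis .
  qed
  \<comment> \<open>The Cauchy bound \<open>fact 2 * C / r ^ 2\<close> on circles of radius
    \<open>r\<close> centred in \<open>ball 0 r\<close>, which is why slices are followed up to
    parameter \<open>2 * r\<close>.\<close>
  define K where "K = (2 * C / r\<^sup>2)"
  have est: "cmod (f (z + t *s v) $ j - f z $ j - dirderiv f v z $ j * t) \<le> K * (cmod t)\<^sup>2"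
    if z: "z \<in> cball z0 d" and t: "cmod t < r" for z t
  proof -
    define \<phi> where "\<phi> = (\<lambda>t. f (z + t *s v) $ j)"
    have inB: "z + t *s v \<in> cball z0 (3 * d)" if "cmod t \<le> 2 * r" for t
    proof -
      have "dist z0 (z + t *s v) \<le> dist z0 z + dist z (z + t *s v)" by (rule dist_triangle)
      also have "\<dots> \<le> d + 2 * d"
        using z rv[of "cmod t" 2] that by (intro add_mono) (auto simp: dist_norm norm_smult_complex)
      finally show ?thesis by simp
    qed
    have hol: "\<phi> holomorphic_on ball 0 (2 * r)"
      unfolding \<phi>_def using f
    proof (rule line_holomorphic_onD)
      fix t assume "t \<in> ball (0::complex) (2 * r)"
      then show "z + t *s v \<in> B" using inB[of t] d by auto
    qed
    have hol': "\<phi> holomorphic_on cball 0 (2 * r)"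
      unfolding \<phi>_def using f
    proof (rule line_holomorphic_onD)
      fix t assume "t \<in> cball (0::complex) (2 * r)"
      then show "z + t *s v \<in> B" using inB[of t] d by auto
    qed
    have sub: "cball x r \<subseteq> cball 0 (2 * r)" if "x \<in> ball 0 r" for x :: complex
      using that by (intro subsetI) (smt (verit) dist_norm dist_triangle mem_ball mem_cball dist_commute)
    have bound: "cmod ((deriv ^^ Suc 1) \<phi> x) \<le> K" if x: "x \<in> ball 0 r" for x
    proof -
      have "cmod ((deriv ^^ 2) \<phi> x) \<le> fact 2 * C / r ^ 2"
      proof (rule Cauchy_inequality)
        show "\<phi> holomorphic_on ball x r"
          using hol' sub[OF x] ball_subset_cball by (meson holomorphic_on_subset order_trans)
        show "continuous_on (cball x r) \<phi>"
          using hol' sub[OF x] by (meson holomorphic_on_subset holomorphic_on_imp_continuous_on)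
        show "cmod (\<phi> y) \<le> C" if "cmod (x - y) = r" for y
        proof -
          have "y \<in> cball 0 (2 * r)" using sub[OF x] that by (auto simp: dist_norm)
          then show ?thesis unfolding \<phi>_def by (intro C inB) (simp add: dist_norm)
        qed
      qed (use r in auto)
      then show ?thesis by (simp add: K_def numeral_2_eq_2)
    qed
    have "cmod ((deriv ^^ 0) \<phi> t - (\<Sum>i\<le>1. (deriv ^^ i) \<phi> 0 * (t - 0) ^ i / fact i))
       \<le> K * cmod (t - 0) ^ Suc 1 / fact 1"
    proof (rule complex_Taylor[of "ball 0 r"])
      fix i x assume x: "x \<in> ball (0::complex) r"
      have "(deriv ^^ i) \<phi> holomorphic_on ball 0 (2 * r)"
        using hol by (rule holomorphic_higher_deriv) simp
      then show "((deriv ^^ i) \<phi> has_field_derivative (deriv ^^ Suc i) \<phi> x) (at x within ball 0 r)"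
        using x r by (auto intro!: holomorphic_derivI[of _ "ball 0 (2*r)"])
    qed (use bound r t in auto)
    then show ?thesis by (simp add: \<phi>_def dirderiv_def power2_eq_square algebra_simps)
  qed
  have "uniform_limit (cball z0 d)
       (\<lambda>n z. of_nat (Suc n) * (f (z + (1 / of_nat (Suc n)) *s v) $ j - f z $ j))
       (\<lambda>z. dirderiv f v z $ j) sequentially"
    unfolding uniform_limit_iff
  proof (intro allI impI)
    fix e :: real assume e: "e > 0"
    have "eventually (\<lambda>n. 1 / real (Suc n) < r) sequentially"
      using r by (intro order_tendstoD(2)[OF lim_1_over_n[THEN LIMSEQ_Suc]]) auto
    moreover have "(\<lambda>n. K * (1 / real (Suc n))) \<longlonglongrightarrow> K * 0"
      by (intro tendsto_intros lim_1_over_n[THEN LIMSEQ_Suc])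
    then have "eventually (\<lambda>n. K * (1 / real (Suc n)) < e) sequentially"
      using e by (auto dest: order_tendstoD(2)[of _ _ _ e])
    ultimately show "\<forall>\<^sub>F n in sequentially. \<forall>z\<in>cball z0 d.
       dist (of_nat (Suc n) * (f (z + (1 / of_nat (Suc n)) *s v) $ j - f z $ j)) (dirderiv f v z $ j) < e"
    proof eventually_elim
      case (elim n)
      show ?case
      proof
        fix z assume z: "z \<in> cball z0 d"
        define N :: complex where "N = of_nat (Suc n)"
        have N: "N \<noteq> 0" "cmod N = real (Suc n)" unfolding N_def by (simp_all only: norm_of_nat of_nat_eq_0_iff)
        let ?D = "f (z + (1 / N) *s v) $ j - f z $ j"
        have "cmod (1 / N) < r" using elim(1) N by (simp add: norm_divide)
        from est[OF z this]
        have *: "cmod (?D - dirderiv f v z $ j * (1 / N)) \<le> K * (1 / real (Suc n))\<^sup>2"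
          using N by (simp add: norm_divide)
        have "N * ?D - dirderiv f v z $ j = N * (?D - dirderiv f v z $ j * (1 / N))"
          using N by (simp add: field_simps)
        then have "dist (N * ?D) (dirderiv f v z $ j) = real (Suc n) * cmod (?D - dirderiv f v z $ j * (1 / N))"
          using N by (simp only: dist_norm norm_mult)
        also have "\<dots> \<le> real (Suc n) * (K * (1 / real (Suc n))\<^sup>2)" using * by (intro mult_left_mono) auto
        also have "\<dots> = K * (1 / real (Suc n))" by (simp add: power2_eq_square)
        finally show "dist (of_nat (Suc n) * (f (z + (1 / of_nat (Suc n)) *s v) $ j - f z $ j)) (dirderiv f v z $ j) < e"
          using elim(2) unfolding N_def by simp
      qed
    qed
  qed
  moreover have "cball z0 (2 * d) \<subseteq> B" using d by (auto intro: order_trans)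
  ultimately show ?thesis using that d by blast
qed

text \<open>Locally uniform limits of difference quotients inherit continuity and holomorphy on
  slices.\<close>

lemma line_holomorphic_dirderiv:
  fixes f :: "complex ^ 'n \<Rightarrow> complex ^ 'm"
  assumes f: "line_holomorphic_on f B" and B: "open B"
  shows "line_holomorphic_on (dirderiv f v) B"
proof -
  define q where "q = (\<lambda>j n z. of_nat (Suc n) * (f (z + (1 / of_nat (Suc n)) *s v) $ j - f z $ j))"
  have fc: "continuous_on B f" using f by (simp add: line_holomorphic_on_def)
  have local: "\<exists>d>0. cball z0 d \<subseteq> B \<and> uniform_limit (cball z0 d) (q j) (\<lambda>z. dirderiv f v z $ j) sequentially
     \<and> (\<forall>\<^sub>F n in sequentially. \<forall>z\<in>cball z0 d. z + (1 / of_nat (Suc n)) *s v \<in> B)"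
    if z0: "z0 \<in> B" for z0 j
  proof -
    obtain d where d: "d > 0" "cball z0 (2 * d) \<subseteq> B"
      "uniform_limit (cball z0 d) (q j) (\<lambda>z. dirderiv f v z $ j) sequentially"
      using uniform_difference_quotients[OF f B z0, of v j] unfolding q_def by blast
    have "(\<lambda>n. (1 / real (Suc n)) * norm v) \<longlonglongrightarrow> 0 * norm v"
      by (intro tendsto_intros lim_1_over_n[THEN LIMSEQ_Suc])
    then have "\<forall>\<^sub>F n in sequentially. (1 / real (Suc n)) * norm v < d"
      using d(1) by (auto dest: order_tendstoD(2)[of _ _ _ d])
    then have "\<forall>\<^sub>F n in sequentially. \<forall>z\<in>cball z0 d. z + (1 / of_nat (Suc n)) *s v \<in> B"
    proof eventually_elim
      case (elim n)
      have *: "norm ((1 / of_nat (Suc n)) *s v) < d"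
        using elim by (simp only: norm_smult_complex norm_divide norm_of_nat norm_one)
      show ?case
      proof
        fix z assume "z \<in> cball z0 d"
        then have "dist z0 (z + (1 / of_nat (Suc n)) *s v) \<le> 2 * d"
          using * dist_triangle[of z0 "z + (1 / of_nat (Suc n)) *s v" z] by (simp add: dist_norm)
        then show "z + (1 / of_nat (Suc n)) *s v \<in> B" using d by auto
      qed
    qed
    moreover have "cball z0 d \<subseteq> B" using d by auto
    ultimately show ?thesis using d by blast
  qed
  have "continuous_on B (\<lambda>z. dirderiv f v z $ j)" for j
    unfolding continuous_on_eq_continuous_at[OF B]
  proof
    fix z0 assume "z0 \<in> B"
    then obtain d where d: "d > 0" "cball z0 d \<subseteq> B"
      "uniform_limit (cball z0 d) (q j) (\<lambda>z. dirderiv f v z $ j) sequentially"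
      "\<forall>\<^sub>F n in sequentially. \<forall>z\<in>cball z0 d. z + (1 / of_nat (Suc n)) *s v \<in> B"
      using local by blast
    have "\<forall>\<^sub>F n in sequentially. continuous_on (cball z0 d) (q j n)"
      using d(4)
    proof eventually_elim
      case (elim n)
      show ?case unfolding q_def using elim d(2) fc
        by (intro continuous_intros continuous_on_compose2[OF fc]) auto
    qed
    then have "continuous_on (cball z0 d) (\<lambda>z. dirderiv f v z $ j)"
      using d(3) by (rule uniform_limit_theorem) simp
    then show "continuous (at z0) (\<lambda>z. dirderiv f v z $ j)"
      using d(1) by (auto intro: continuous_on_interior)
  qed
  then have "continuous_on B (\<lambda>z. \<chi> j. dirderiv f v z $ j)" by (rule continuous_on_vec_lambda)
  then have cont: "continuous_on B (dirderiv f v)" by simp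
  have "(\<lambda>t. dirderiv f v (z + t *s u) $ j) holomorphic_on {t. z + t *s u \<in> B}" for j z u
  proof (rule holomorphic_onI)
    fix t assume "t \<in> {t. z + t *s u \<in> B}"
    then obtain d where d: "d > 0" "cball (z + t *s u) d \<subseteq> B"
      "uniform_limit (cball (z + t *s u) d) (q j) (\<lambda>z. dirderiv f v z $ j) sequentially"
      "\<forall>\<^sub>F n in sequentially. \<forall>y\<in>cball (z + t *s u) d. y + (1 / of_nat (Suc n)) *s v \<in> B"
      using local[of "z + t *s u" j] by blast
    define \<rho> where "\<rho> = d / (norm u + 1)"
    have \<rho>: "\<rho> > 0" using d by (simp add: \<rho>_def add_nonneg_pos)
    have into: "z + s *s u \<in> cball (z + t *s u) d" if "s \<in> cball t \<rho>" for s
    proof -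
      have "dist (z + t *s u) (z + s *s u) = cmod (t - s) * norm u"
        by (simp add: dist_norm norm_smult_complex[symmetric] vector_sub_rdistrib)
      also have "\<dots> \<le> \<rho> * (norm u + 1)"
        using that by (intro mult_mono) (use \<rho> in \<open>auto simp: dist_norm\<close>)
      also have "\<dots> = d" by (simp add: \<rho>_def add_nonneg_eq_0_iff)
      finally show ?thesis by simp
    qed
    have "\<forall>\<^sub>F n in sequentially. (\<lambda>s. q j n (z + s *s u)) holomorphic_on cball t \<rho>"
      using d(4)
    proof eventually_elim
      case (elim n)
      let ?v = "(1 / of_nat (Suc n)) *s v"
      have 1: "(\<lambda>s. f ((z + ?v) + s *s u) $ j) holomorphic_on cball t \<rho>"
        using f
      proof (rule line_holomorphic_onD)
        fix s assume "s \<in> cball t \<rho>"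
        then have "(z + s *s u) + ?v \<in> B" using elim into by blast
        then show "(z + ?v) + s *s u \<in> B" by (simp add: algebra_simps)
      qed
      have 2: "(\<lambda>s. f (z + s *s u) $ j) holomorphic_on cball t \<rho>"
        using f by (rule line_holomorphic_onD) (use d(2) into in blast)
      have 3: "(z + ?v) + s *s u = (z + s *s u) + ?v" for s
        by (metis add.assoc add.commute)
      have "(\<lambda>s. f ((z + s *s u) + ?v) $ j) holomorphic_on cball t \<rho>"
        by (rule back_subst[of "\<lambda>h. h holomorphic_on cball t \<rho>", OF 1]) (rule ext, subst 3, rule refl)
      then show ?case unfolding q_def
        by (intro holomorphic_on_mult holomorphic_on_const holomorphic_on_diff 2)
    qed
    then have "\<forall>\<^sub>F n in sequentially. continuous_on (cball t \<rho>) (\<lambda>s. q j n (z + s *s u)) \<and>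
       (\<lambda>s. q j n (z + s *s u)) holomorphic_on ball t \<rho>"
      by eventually_elim
         (meson ball_subset_cball holomorphic_on_imp_continuous_on holomorphic_on_subset)
    moreover have "uniform_limit (cball t \<rho>) (\<lambda>n s. q j n (z + s *s u))
       (\<lambda>s. dirderiv f v (z + s *s u) $ j) sequentially"
      unfolding uniform_limit_iff
    proof (intro allI impI)
      fix e :: real assume "e > 0"
      then have "\<forall>\<^sub>F n in sequentially. \<forall>z\<in>cball (z + t *s u) d. dist (q j n z) (dirderiv f v z $ j) < e"
        using d(3) unfolding uniform_limit_iff by blast
      then show "\<forall>\<^sub>F n in sequentially. \<forall>s\<in>cball t \<rho>.
          dist (q j n (z + s *s u)) (dirderiv f v (z + s *s u) $ j) < e"
        by eventually_elim (use into in blast)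
    qed
    ultimately have "(\<lambda>s. dirderiv f v (z + s *s u) $ j) holomorphic_on ball t \<rho>"
      using holomorphic_uniform_limit[of t \<rho> "\<lambda>n s. q j n (z + s *s u)" sequentially] by auto
    then have "(\<lambda>t. dirderiv f v (z + t *s u) $ j) field_differentiable at t"
      by (rule holomorphic_on_imp_differentiable_at) (use \<rho> in auto)
    then show "(\<lambda>t. dirderiv f v (z + t *s u) $ j) field_differentiable at t within {t. z + t *s u \<in> B}"
      by (rule field_differentiable_at_within)
  qed
  with cont show ?thesis by (rule line_holomorphic_onI)
qed

text \<open>\<open>dirderiv\<close> differentiates at parameter 0 only; re-basing the slice at
  \<open>z + t *s v\<close> gives the derivative at every \<open>t\<close>.\<close>

lemma hform_has_dirderiv:
  assumes f: "line_holomorphic_on f B" and B: "open B" and z: "z + t *s v \<in> B"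
  shows "((\<lambda>t. hform g (f (z + t *s v)) y) has_field_derivative hform g (dirderiv f v (z + t *s v)) y) (at t)"
proof -
  let ?S = "{t. z + t *s v \<in> B}"
  have "((\<lambda>s. f (z + s *s v) $ j) has_field_derivative dirderiv f v (z + t *s v) $ j) (at t)" for j
  proof -
    have hol: "(\<lambda>s. f (z + s *s v) $ j) holomorphic_on ?S"
      using f by (rule line_holomorphic_onD) simp
    then have D: "((\<lambda>s. f (z + s *s v) $ j) has_field_derivative deriv (\<lambda>s. f (z + s *s v) $ j) t) (at t)"
      using open_line[OF B] z by (intro holomorphic_derivI[of _ ?S]) auto
    have "((\<lambda>s. f (z + (t + s) *s v) $ j) has_field_derivative deriv (\<lambda>s. f (z + s *s v) $ j) t) (at 0)"
      using D DERIV_shift[of "\<lambda>s. f (z + s *s v) $ j" _ 0 t] by (simp add: add.commute)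
    moreover have "(\<lambda>s. f (z + (t + s) *s v) $ j) = (\<lambda>s. f ((z + t *s v) + s *s v) $ j)"
      by (simp only: vec.scale_left_distrib add.assoc)
    ultimately have "((\<lambda>s. f ((z + t *s v) + s *s v) $ j) has_field_derivative deriv (\<lambda>s. f (z + s *s v) $ j) t) (at 0)"
      by (simp only:)
    then have "deriv (\<lambda>s. f ((z + t *s v) + s *s v) $ j) 0 = deriv (\<lambda>s. f (z + s *s v) $ j) t"
      by (rule DERIV_imp_deriv)
    then have "dirderiv f v (z + t *s v) $ j = deriv (\<lambda>s. f (z + s *s v) $ j) t"
      by (simp add: dirderiv_def)
    then show ?thesis using D by simp
  qed
  then show ?thesis unfolding hform_def
    by (auto intro!: derivative_eq_intros sum.cong)
qed

section \<open>The rank bound\<close>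

text \<open>A spare pair \<open>(x, y)\<close> in \<open>D\<close>, orthogonal to everything chosen
  so far, is carried through the induction: adding a small multiple of it moves a new pair into
  \<open>D\<close> without spoiling any orthogonality. \<open>D\<close> will be the set of
  nonsingular direction pairs, and \<open>dense\<close> asks for perturbations only along members of
  \<open>D\<close>.\<close>

lemma biorthogonal_family_in_open_set:
  fixes g :: "'n::finite \<Rightarrow> real" and z0 w0 x y :: "complex ^ 'n"
    and D :: "((complex ^ 'n) \<times> (complex ^ 'n)) set"
  assumes g: "\<And>i. g i \<noteq> 0" and z0: "z0 \<noteq> 0" and zw: "hform g z0 w0 = 0"
    and D: "open D"
    and dense: "\<And>x y p q \<epsilon>. (x, y) \<in> D \<Longrightarrow> (0::real) < \<epsilon> \<Longrightarrow>
       \<exists>\<tau>. 0 < \<tau> \<and> \<tau> < \<epsilon> \<and> (p + complex_of_real \<tau> *s x, q + complex_of_real \<tau> *s y) \<in> D"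
    and xy: "(x, y) \<in> D" "hform g x w0 = 0" "hform g z0 y = 0"
  shows "j + 2 \<le> CARD('n) \<Longrightarrow> \<exists>e c.
     ((\<forall>i<j. hform g (e i) w0 = 0 \<and> hform g z0 (c i) = 0 \<and> (e i, c i) \<in> D \<and> hform g (e i) (c i) \<noteq> 0) \<and>
      (\<forall>i<j. \<forall>l<j. i \<noteq> l \<longrightarrow> hform g (e i) (c l) = 0)) \<and>
     (j + 2 < CARD('n) \<longrightarrow> (\<exists>x y. (x, y) \<in> D \<and> hform g x w0 = 0 \<and> hform g z0 y = 0 \<and>
        (\<forall>i<j. hform g x (c i) = 0 \<and> hform g (e i) y = 0)))"
proof (induction j)
  case 0
  then show ?case using xy by auto
next
  case (Suc j)
  have pert: "\<exists>\<tau>. P \<tau> \<and> (p + complex_of_real \<tau> *s x, q + complex_of_real \<tau> *s y) \<in> D"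
    if xyD: "(x, y) \<in> D" and ev: "eventually P (at_right 0)" for x y p q and P :: "real \<Rightarrow> bool"
  proof -
    obtain b where "b > 0" "\<And>\<tau>. 0 < \<tau> \<Longrightarrow> \<tau> < b \<Longrightarrow> P \<tau>"
      using ev unfolding eventually_at_right_field by auto
    then show ?thesis using dense[OF xyD, of b] by blast
  qed
  note lim = tendsto_line
  from Suc have j: "j + 2 < CARD('n)" by simp
  with Suc.IH obtain e c x y where
    F: "\<forall>i<j. hform g (e i) w0 = 0 \<and> hform g z0 (c i) = 0 \<and> (e i, c i) \<in> D \<and> hform g (e i) (c i) \<noteq> 0"
      "\<forall>i<j. \<forall>l<j. i \<noteq> l \<longrightarrow> hform g (e i) (c l) = 0"
      "\<forall>i<j. hform g x (c i) = 0 \<and> hform g (e i) y = 0"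
    and xy0: "(x, y) \<in> D" "hform g x w0 = 0" "hform g z0 y = 0"
    by auto
  have fam: "\<And>i. i < j \<Longrightarrow> hform g (e i) w0 = 0" "\<And>i. i < j \<Longrightarrow> hform g z0 (c i) = 0"
      "\<And>i. i < j \<Longrightarrow> (e i, c i) \<in> D" "\<And>i. i < j \<Longrightarrow> hform g (e i) (c i) \<noteq> 0"
      "\<And>i l. i < j \<Longrightarrow> l < j \<Longrightarrow> i \<noteq> l \<Longrightarrow> hform g (e i) (c l) = 0"
    and xy: "(x, y) \<in> D" "hform g x w0 = 0" "hform g z0 y = 0"
      "\<And>i. i < j \<Longrightarrow> hform g x (c i) = 0" "\<And>i. i < j \<Longrightarrow> hform g (e i) y = 0"
    using F xy0 by simp_all
  have "\<exists>p q. hform g p w0 = 0 \<and> hform g z0 q = 0 \<and>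
    (\<forall>i<j. hform g p (c i) = 0 \<and> hform g (e i) q = 0) \<and> hform g p q \<noteq> 0"
    by (rule biorthogonal_extension[OF g z0 zw j]) (use fam in auto)
  then obtain p q where pq: "hform g p w0 = 0" "hform g z0 q = 0"
    "\<forall>i<j. hform g p (c i) = 0 \<and> hform g (e i) q = 0" "hform g p q \<noteq> 0" by blast
  have "eventually (\<lambda>\<tau>. hform g (p + complex_of_real \<tau> *s x) (q + complex_of_real \<tau> *s y) \<noteq> 0) (at_right 0)"
    using pq(4) by (intro tendsto_imp_eventually_ne[OF tendsto_hform[OF lim lim]])
  from pert[OF xy(1) this] obtain \<tau> where \<tau>:
    "hform g (p + complex_of_real \<tau> *s x) (q + complex_of_real \<tau> *s y) \<noteq> 0"
    "(p + complex_of_real \<tau> *s x, q + complex_of_real \<tau> *s y) \<in> D" by blast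
  \<comment> \<open>This pair completes the family if \<open>j\<close> is the last index; otherwise
    it becomes, after a correction, the next spare pair.\<close>
  define x1 y1 where "x1 = p + complex_of_real \<tau> *s x" and "y1 = q + complex_of_real \<tau> *s y"
  have xy1: "(x1, y1) \<in> D" "hform g x1 w0 = 0" "hform g z0 y1 = 0"
      "\<And>i. i < j \<Longrightarrow> hform g x1 (c i) = 0" "\<And>i. i < j \<Longrightarrow> hform g (e i) y1 = 0" "hform g x1 y1 \<noteq> 0"
    using \<tau> by (simp_all add: x1_def y1_def) (use xy pq in \<open>simp_all add: hform_simps\<close>)
  show ?case
  proof (cases "Suc j + 2 < CARD('n)")
    case False
    then show ?thesis using fam xy1
      by (intro exI[of _ "e(j := x1)"] exI[of _ "c(j := y1)"]) (auto simp: less_Suc_eq)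
  next
    case True
    have "\<exists>p q. hform g p w0 = 0 \<and> hform g z0 q = 0 \<and>
      (\<forall>i<Suc j. hform g p ((c(j := y1)) i) = 0 \<and> hform g ((e(j := x1)) i) q = 0) \<and> hform g p q \<noteq> 0"
      by (rule biorthogonal_extension[OF g z0 zw True]) (use fam xy1 in \<open>auto simp: less_Suc_eq\<close>)
    then obtain p q where pq: "hform g p w0 = 0" "hform g z0 q = 0"
      "\<forall>i<Suc j. hform g p ((c(j := y1)) i) = 0 \<and> hform g ((e(j := x1)) i) q = 0" "hform g p q \<noteq> 0"
      by blast
    have pq': "hform g p y1 = 0" "hform g x1 q = 0" "\<And>i. i < j \<Longrightarrow> hform g p (c i) = 0"
      "\<And>i. i < j \<Longrightarrow> hform g (e i) q = 0"
      using pq(3) by (auto simp: less_Suc_eq split: if_splits)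
    define P where "P = (\<lambda>\<tau>. p + complex_of_real \<tau> *s x1)"
    define Q where "Q = (\<lambda>\<tau>. q + complex_of_real \<tau> *s y1)"
    \<comment> \<open>\<open>P\<close> and \<open>Q\<close> become entry \<open>j\<close>, while
      \<open>X\<close> and \<open>Y\<close> are \<open>x1\<close> and \<open>y1\<close> made
      orthogonal to them. Since \<open>hform g x1 q = 0\<close> and \<open>hform g p y1 = 0\<close>,
      the corrections tend to 0 with the parameter, and openness keeps \<open>(X, Y)\<close> in
      \<open>D\<close>.\<close>
    define X where "X = (\<lambda>\<tau>. x1 - (hform g x1 (Q \<tau>) / hform g (P \<tau>) (Q \<tau>)) *s P \<tau>)"
    define Y where "Y = (\<lambda>\<tau>. y1 - cnj (hform g (P \<tau>) y1 / hform g (P \<tau>) (Q \<tau>)) *s Q \<tau>)"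
    have P: "(P \<longlongrightarrow> p) (at_right 0)" and Q: "(Q \<longlongrightarrow> q) (at_right 0)"
      unfolding P_def Q_def by (rule lim)+
    have "(X \<longlongrightarrow> x1 - (hform g x1 q / hform g p q) *s p) (at_right 0)"
      unfolding X_def using pq(4) by (intro tendsto_intros tendsto_smult P Q) auto
    moreover have "(Y \<longlongrightarrow> y1 - cnj (hform g p y1 / hform g p q) *s q) (at_right 0)"
      unfolding Y_def using pq(4) by (intro tendsto_intros tendsto_smult P Q) auto
    ultimately have "((\<lambda>\<tau>. (X \<tau>, Y \<tau>)) \<longlongrightarrow> (x1, y1)) (at_right 0)"
      using pq' by (intro tendsto_Pair) simp_all
    then have "eventually (\<lambda>\<tau>. (X \<tau>, Y \<tau>) \<in> D) (at_right 0)"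
      using D xy1(1) by (rule topological_tendstoD)
    moreover have "eventually (\<lambda>\<tau>. hform g (P \<tau>) (Q \<tau>) \<noteq> 0) (at_right 0)"
      using pq(4) by (intro tendsto_imp_eventually_ne[OF tendsto_hform[OF P Q]])
    ultimately have "eventually (\<lambda>\<tau>. (X \<tau>, Y \<tau>) \<in> D \<and> hform g (P \<tau>) (Q \<tau>) \<noteq> 0) (at_right 0)"
      by (rule eventually_conj)
    from pert[OF xy1(1) this, of p q] obtain \<tau> where t: "(X \<tau>, Y \<tau>) \<in> D"
      "hform g (P \<tau>) (Q \<tau>) \<noteq> 0" "(P \<tau>, Q \<tau>) \<in> D" unfolding P_def Q_def by blast
    have PQ: "hform g (P \<tau>) w0 = 0" "hform g z0 (Q \<tau>) = 0"
      "\<And>i. i < j \<Longrightarrow> hform g (P \<tau>) (c i) = 0" "\<And>i. i < j \<Longrightarrow> hform g (e i) (Q \<tau>) = 0"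
      unfolding P_def Q_def using pq pq' xy1 by (simp_all add: hform_simps)
    have "hform g (X \<tau>) w0 = 0" "hform g z0 (Y \<tau>) = 0"
      "\<And>i. i < j \<Longrightarrow> hform g (X \<tau>) (c i) = 0" "\<And>i. i < j \<Longrightarrow> hform g (e i) (Y \<tau>) = 0"
      "hform g (X \<tau>) (Q \<tau>) = 0" "hform g (P \<tau>) (Y \<tau>) = 0"
      unfolding X_def Y_def using PQ xy1 t(2) by (simp_all add: hform_simps)
    then show ?thesis using fam PQ t
      by (intro exI[of _ "e(j := P \<tau>)"] exI[of _ "c(j := Q \<tau>)"] conjI impI exI[of _ "X \<tau>"] exI[of _ "Y \<tau>"])
         (auto simp: less_Suc_eq)
  qed
qed

text \<open>The vectors \<open>X i\<close>, \<open>X' i\<close>, \<open>A\<close>, \<open>A'\<close>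
  are independent modulo the radical. The order of elimination matters: \<open>C\<close> sees only
  \<open>A'\<close>; after that \<open>Y l\<close> and \<open>Y' l\<close> see only the invertible
  block \<open>l\<close>; \<open>C'\<close> is left to detect \<open>A\<close>.\<close>

lemma hform_rank_lower_bound:
  fixes g :: "'m::finite \<Rightarrow> real" and A A' C C' :: "complex ^ 'm" and X X' Y Y' :: "nat \<Rightarrow> complex ^ 'm"
  assumes A: "hform g A C = 0" "hform g A' C \<noteq> 0" "hform g A C' \<noteq> 0"
    and XC: "\<And>i. i < m \<Longrightarrow> hform g (X i) C = 0" "\<And>i. i < m \<Longrightarrow> hform g (X' i) C = 0"
    and AY: "\<And>i. i < m \<Longrightarrow> hform g A (Y i) = 0" "\<And>i. i < m \<Longrightarrow> hform g A (Y' i) = 0"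
    and off: "\<And>i l. i < m \<Longrightarrow> l < m \<Longrightarrow> i \<noteq> l \<Longrightarrow> hform g (X i) (Y l) = 0"
      "\<And>i l. i < m \<Longrightarrow> l < m \<Longrightarrow> i \<noteq> l \<Longrightarrow> hform g (X i) (Y' l) = 0"
      "\<And>i l. i < m \<Longrightarrow> l < m \<Longrightarrow> i \<noteq> l \<Longrightarrow> hform g (X' i) (Y l) = 0"
      "\<And>i l. i < m \<Longrightarrow> l < m \<Longrightarrow> i \<noteq> l \<Longrightarrow> hform g (X' i) (Y' l) = 0"
    and det: "\<And>i. i < m \<Longrightarrow> hform g (X i) (Y i) * hform g (X' i) (Y' i) \<noteq>
        hform g (X i) (Y' i) * hform g (X' i) (Y i)"
  shows "2 * m + 2 \<le> card {j. g j \<noteq> 0}"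
proof (rule ccontr)
  assume less: "\<not> 2 * m + 2 \<le> card {j. g j \<noteq> 0}"
  \<comment> \<open>\<open>True\<close> marks the unprimed vectors;
    \<open>card I = 2 * m + 2\<close>.\<close>
  define I :: "(nat \<times> bool + bool) set" where "I = ({..<m} \<times> UNIV) <+> UNIV"
  have I: "finite I" "card {j. g j \<noteq> 0} < card I"
    using less by (simp_all add: I_def card_Plus)
  define v where "v = case_sum (\<lambda>(i, b). if b then X i else X' i) (\<lambda>b. if b then A else A')"
  obtain k where k: "\<exists>i\<in>I. k i \<noteq> 0" "\<And>y. (\<Sum>i\<in>I. k i * hform g (v i) y) = 0"
    using hform_combination_in_radical[OF I] by metis
  define a where "a = (\<lambda>i. k (Inl (i, True)))"
  define a' where "a' = (\<lambda>i. k (Inl (i, False)))"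
  define \<alpha> where "\<alpha> = k (Inr True)"
  define \<beta> where "\<beta> = k (Inr False)"
  have rel: "(\<Sum>i<m. a i * hform g (X i) y + a' i * hform g (X' i) y) + (\<alpha> * hform g A y + \<beta> * hform g A' y) = 0" for y
  proof -
    have "(\<Sum>i\<in>I. k i * hform g (v i) y) =
       (\<Sum>p\<in>{..<m} \<times> UNIV. k (Inl p) * hform g (v (Inl p)) y) + (\<Sum>b\<in>UNIV. k (Inr b) * hform g (v (Inr b)) y)"
      unfolding I_def by (subst sum.Plus) auto
    also have "(\<Sum>p\<in>{..<m} \<times> UNIV. k (Inl p) * hform g (v (Inl p)) y) =
       (\<Sum>i<m. \<Sum>b\<in>UNIV. k (Inl (i, b)) * hform g (v (Inl (i, b))) y)"
      by (simp add: sum.cartesian_product split_def)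
    finally show ?thesis using k(2)[of y]
      by (simp add: UNIV_bool v_def a_def a'_def \<alpha>_def \<beta>_def add_ac)
  qed
  have \<beta>: "\<beta> = 0" using rel[of C] XC A by simp
  have aa: "a l = 0 \<and> a' l = 0" if l: "l < m" for l
  proof -
    have "(\<Sum>i<m. a i * hform g (X i) y + a' i * hform g (X' i) y) =
        (\<Sum>i<m. if i = l then a l * hform g (X l) y + a' l * hform g (X' l) y else 0)"
      if "y = Y l \<or> y = Y' l" for y
      using that l off by (intro sum.cong) auto
    then have "a l * hform g (X l) y + a' l * hform g (X' l) y = 0" if "y = Y l \<or> y = Y' l" for y
      using that l rel[of y] AY[OF l] \<beta> by auto
    then have e: "a l * hform g (X l) (Y l) + a' l * hform g (X' l) (Y l) = 0"
      "a l * hform g (X l) (Y' l) + a' l * hform g (X' l) (Y' l) = 0" by auto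
    have "a l * (hform g (X l) (Y l) * hform g (X' l) (Y' l) - hform g (X l) (Y' l) * hform g (X' l) (Y l)) = 0"
      "a' l * (hform g (X l) (Y l) * hform g (X' l) (Y' l) - hform g (X l) (Y' l) * hform g (X' l) (Y l)) = 0"
      using e by algebra+
    then show ?thesis using det[OF l] by simp
  qed
  have \<alpha>0: "\<alpha> = 0" using rel[of C'] aa \<beta> A by simp
  have "k i = 0" if "i \<in> I" for i
  proof (cases i)
    case (Inl p)
    obtain l b where "p = (l, b)" by (cases p)
    with Inl that have "i = Inl (l, b)" "l < m" by (auto simp: I_def)
    then show ?thesis using aa[of l] by (cases b) (auto simp: a_def a'_def)
  next
    case (Inr b)
    then show ?thesis using \<beta> \<alpha>0 by (cases b) (auto simp: \<alpha>_def \<beta>_def)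
  qed
  then show False using k(1) by blast
qed

section \<open>Perturbing incident pairs\<close>

lemma dist_Pair_le: "dist (a, b) (c, d) \<le> dist a c + dist b d"
  unfolding dist_Pair_Pair by (rule sqrt_sum_squares_le_sum) auto

lemma open_nonzero:
  assumes "open A" "continuous_on A h" shows "open {p \<in> A. h p \<noteq> (0::complex)}"
proof -
  have "open (A \<inter> h -` (- {0}))"
    using assms by (intro continuous_open_preimage) auto
  moreover have "A \<inter> h -` (- {0}) = {p \<in> A. h p \<noteq> 0}" by auto
  ultimately show ?thesis by simp
qed

text \<open>Subtracting from \<open>z\<close> a multiple of a fixed \<open>y\<close> with
  \<open>hform g y w \<noteq> 0\<close> restores orthogonality, and the correction tends to 0 as
  \<open>w'\<close> tends to \<open>w\<close>.\<close>

lemma hform_perturb_left: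
  assumes g: "\<And>i. g i \<noteq> 0" and w: "w \<noteq> 0" and zw: "hform g z w = 0" and \<epsilon>: "\<epsilon> > 0"
  shows "\<exists>\<delta>>0. \<forall>w'. dist w' w < \<delta> \<longrightarrow> (\<exists>z'. dist z' z < \<epsilon> \<and> hform g z' w' = 0)"
proof -
  obtain y where "hform g w y \<noteq> 0" using hform_nondegenerate[of g w] g w by blast
  then have y: "hform g y w \<noteq> 0" using hform_commute_eq_0 by blast
  define h where "h = (\<lambda>w'. z - (hform g z w' / hform g y w') *s y)"
  have "(h \<longlongrightarrow> z - (hform g z w / hform g y w) *s y) (nhds w)"
    unfolding h_def using y by (intro tendsto_intros tendsto_smult filterlim_ident) auto
  then have "(h \<longlongrightarrow> z) (nhds w)" using zw by simp
  then have "\<forall>\<^sub>F w' in nhds w. dist (h w') z < \<epsilon>" using \<epsilon> by (rule tendstoD)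
  moreover have "((\<lambda>w'. hform g y w') \<longlongrightarrow> hform g y w) (nhds w)"
    by (intro tendsto_hform tendsto_const filterlim_ident)
  then have "\<forall>\<^sub>F w' in nhds w. hform g y w' \<noteq> 0"
    using y by (rule tendsto_imp_eventually_ne)
  ultimately have "\<forall>\<^sub>F w' in nhds w. dist (h w') z < \<epsilon> \<and> hform g y w' \<noteq> 0"
    by (rule eventually_conj)
  then obtain \<delta> where "\<delta> > 0" "\<And>w'. dist w' w < \<delta> \<Longrightarrow> dist (h w') z < \<epsilon> \<and> hform g y w' \<noteq> 0"
    unfolding eventually_nhds_metric by blast
  moreover have "hform g (h w') w' = 0" if "hform g y w' \<noteq> 0" for w'
    using that by (simp add: h_def hform_simps)
  ultimately show ?thesis by blast
qed

lemma hform_perturb_right: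
  assumes g: "\<And>i. g i \<noteq> 0" and z: "z \<noteq> 0" and zw: "hform g z w = 0" and \<epsilon>: "\<epsilon> > 0"
  shows "\<exists>\<delta>>0. \<forall>z'. dist z' z < \<delta> \<longrightarrow> (\<exists>w'. dist w' w < \<epsilon> \<and> hform g z' w' = 0)"
proof -
  have "hform g w z = 0" using zw hform_commute_eq_0 by blast
  from hform_perturb_left[OF g z this \<epsilon>] obtain \<delta> where \<delta>: "\<delta> > 0"
    "\<forall>z'. dist z' z < \<delta> \<longrightarrow> (\<exists>w'. dist w' w < \<epsilon> \<and> hform g w' z' = 0)" by blast
  have "\<exists>w'. dist w' w < \<epsilon> \<and> hform g z' w' = 0" if "dist z' z < \<delta>" for z'
    using \<delta>(2) that hform_commute_eq_0 by blast
  then show ?thesis using \<delta>(1) by blast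
qed

text \<open>\<open>card {j. g' j \<noteq> 0}\<close> is the rank \<open>r' + s'\<close> of the
  target form, and \<open>rank\<close> is its bound written without subtraction. \<open>B\<close>
  will be a ball around a null point.\<close>

locale local_orthogonal_rep =
  fixes g :: "'n::finite \<Rightarrow> real" and g' :: "'m::finite \<Rightarrow> real"
    and f :: "complex ^ 'n \<Rightarrow> complex ^ 'm" and B :: "(complex ^ 'n) set"
  assumes g: "\<And>i. g i \<noteq> 0" and openB: "open B" and convexB: "convex B" and B0: "0 \<notin> B"
    and f: "line_holomorphic_on f B"
    and orth: "\<And>z w. z \<in> B \<Longrightarrow> w \<in> B \<Longrightarrow> hform g z w = 0 \<Longrightarrow> hform g' (f z) (f w) = 0"
    and rank: "card {j. g' j \<noteq> 0} + 3 \<le> 2 * CARD('n)"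
begin

text \<open>A 2 by 2 minor of \<open>M\<close> whose second row may use another map:
  \<open>f2\<close> is \<open>f\<close> for the product form and a directional derivative of
  \<open>f\<close> when the transverse derivative is studied.\<close>

definition minor where
  "minor f2 z z' w w' = hform g' (f z) (f w) * hform g' (f2 z') (f w') -
     hform g' (f z) (f w') * hform g' (f2 z') (f w)"

text \<open>Orthogonality of \<open>a\<close> and \<open>b\<close> to the base is left out, so that
  the set is open in the whole product. It is invariant under nonzero rescaling of either
  direction.\<close>

definition nonsingular_pairs where
  "nonsingular_pairs f2 z0 w0 = {(a, b). \<exists>t t' s s'. z0 + t *s a \<in> B \<and> z0 + t' *s a \<in> B \<and>
     w0 + s *s b \<in> B \<and> w0 + s' *s b \<in> B \<and>
     minor f2 (z0 + t *s a) (z0 + t' *s a) (w0 + s *s b) (w0 + s' *s b) \<noteq> 0}"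

lemma continuous_f: "continuous_on B f"
  using f unfolding line_holomorphic_on_def by blast

lemma minor_line_holomorphic:
  assumes f2: "line_holomorphic_on f2 B"
  shows "(\<lambda>t. minor f2 (z + t *s a) (z' + t *s a') (w + cnj t *s b) (w' + cnj t *s b')) holomorphic_on
    {t. z + t *s a \<in> B \<and> z' + t *s a' \<in> B \<and> w + cnj t *s b \<in> B \<and> w' + cnj t *s b' \<in> B}"
  (is "_ holomorphic_on ?S")
proof -
  have "(\<lambda>t. hform g' (f (z + t *s a)) (f (w + cnj t *s b))) holomorphic_on ?S"
    by (rule holomorphic_on_subset[OF hform_line_holomorphic[OF f f openB]]) auto
  moreover have "(\<lambda>t. hform g' (f (z + t *s a)) (f (w' + cnj t *s b'))) holomorphic_on ?S"
    by (rule holomorphic_on_subset[OF hform_line_holomorphic[OF f f openB]]) auto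
  moreover have "(\<lambda>t. hform g' (f2 (z' + t *s a')) (f (w + cnj t *s b))) holomorphic_on ?S"
    by (rule holomorphic_on_subset[OF hform_line_holomorphic[OF f2 f openB]]) auto
  moreover have "(\<lambda>t. hform g' (f2 (z' + t *s a')) (f (w' + cnj t *s b'))) holomorphic_on ?S"
    by (rule holomorphic_on_subset[OF hform_line_holomorphic[OF f2 f openB]]) auto
  ultimately show ?thesis unfolding minor_def
    by (intro holomorphic_on_diff holomorphic_on_mult)
qed

lemma continuous_on_minor:
  assumes f2: "line_holomorphic_on f2 B"
    and "continuous_on S z" "continuous_on S z'" "continuous_on S w" "continuous_on S w'"
    and "\<And>x. x \<in> S \<Longrightarrow> z x \<in> B \<and> z' x \<in> B \<and> w x \<in> B \<and> w' x \<in> B"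
  shows "continuous_on S (\<lambda>x. minor f2 (z x) (z' x) (w x) (w' x))"
proof -
  have f2': "continuous_on B f2" using f2 unfolding line_holomorphic_on_def by blast
  have "continuous_on S (\<lambda>x. f (z x))" "continuous_on S (\<lambda>x. f (w x))" "continuous_on S (\<lambda>x. f (w' x))"
    "continuous_on S (\<lambda>x. f2 (z' x))"
    using assms by (auto intro: continuous_on_compose2[OF continuous_f] continuous_on_compose2[OF f2'])
  then show ?thesis unfolding minor_def by (intro continuous_intros)
qed

lemma open_minor_nonzero:
  fixes z z' w w' :: "'a::topological_space \<Rightarrow> complex ^ 'n"
  assumes f2: "line_holomorphic_on f2 B"
    and c: "continuous_on UNIV z" "continuous_on UNIV z'" "continuous_on UNIV w" "continuous_on UNIV w'"
  shows "open {x. z x \<in> B \<and> z' x \<in> B \<and> w x \<in> B \<and> w' x \<in> B \<and> minor f2 (z x) (z' x) (w x) (w' x) \<noteq> 0}"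
proof -
  let ?A = "z -` B \<inter> z' -` B \<inter> w -` B \<inter> w' -` B"
  have "open ?A" using c openB by (intro open_Int open_vimage)
  moreover have "continuous_on ?A (\<lambda>x. minor f2 (z x) (z' x) (w x) (w' x))"
    using c by (intro continuous_on_minor[OF f2]) (auto intro: continuous_on_subset)
  ultimately have "open {x \<in> ?A. minor f2 (z x) (z' x) (w x) (w' x) \<noteq> 0}" by (rule open_nonzero)
  moreover have "{x \<in> ?A. minor f2 (z x) (z' x) (w x) (w' x) \<noteq> 0} =
    {x. z x \<in> B \<and> z' x \<in> B \<and> w x \<in> B \<and> w' x \<in> B \<and> minor f2 (z x) (z' x) (w x) (w' x) \<noteq> 0}" by auto
  ultimately show ?thesis by simp
qed

lemma open_nonsingular_pairs:
  assumes f2: "line_holomorphic_on f2 B"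
  shows "open (nonsingular_pairs f2 z0 w0)"
proof -
  have "nonsingular_pairs f2 z0 w0 = (\<Union>t. \<Union>t'. \<Union>s. \<Union>s'.
     {p. z0 + t *s fst p \<in> B \<and> z0 + t' *s fst p \<in> B \<and> w0 + s *s snd p \<in> B \<and> w0 + s' *s snd p \<in> B \<and>
     minor f2 (z0 + t *s fst p) (z0 + t' *s fst p) (w0 + s *s snd p) (w0 + s' *s snd p) \<noteq> 0})"
    by (rule set_eqI, rename_tac p, case_tac p) (simp add: nonsingular_pairs_def)
  moreover have "open \<dots>"
    by (intro open_UN ballI open_minor_nonzero[OF f2] continuous_on_add continuous_on_const
        continuous_on_smult continuous_on_fst continuous_on_snd continuous_on_id)
  ultimately show ?thesis by simp
qed

text \<open>Up to scale, \<open>p + \<tau> x\<close> is a point of the segment from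
  \<open>\<sigma> p\<close> to \<open>x\<close>, and likewise for \<open>q\<close> and
  \<open>y\<close>. A small \<open>\<sigma>\<close> puts the starting configuration inside
  \<open>B\<close>; the minor is nonzero at the far end, hence at arbitrarily small real
  parameters.\<close>

lemma dense_nonsingular_pairs:
  assumes f2: "line_holomorphic_on f2 B" and z0: "z0 \<in> B" and w0: "w0 \<in> B"
    and xy: "(x, y) \<in> nonsingular_pairs f2 z0 w0" and \<epsilon>: "(0::real) < \<epsilon>"
  shows "\<exists>\<tau>. 0 < \<tau> \<and> \<tau> < \<epsilon> \<and>
    (p + complex_of_real \<tau> *s x, q + complex_of_real \<tau> *s y) \<in> nonsingular_pairs f2 z0 w0"
proof -
  obtain t t' s s' where ts: "z0 + t *s x \<in> B" "z0 + t' *s x \<in> B" "w0 + s *s y \<in> B" "w0 + s' *s y \<in> B"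
    "minor f2 (z0 + t *s x) (z0 + t' *s x) (w0 + s *s y) (w0 + s' *s y) \<noteq> 0"
    using xy unfolding nonsingular_pairs_def by blast
  have ev: "\<forall>\<^sub>F \<sigma> in at_right 0. v0 + (r * complex_of_real \<sigma>) *s v \<in> B"
    if "v0 \<in> B" for v0 v :: "complex ^ 'n" and r :: complex
  proof -
    have "((\<lambda>\<sigma>. v0 + (r * complex_of_real \<sigma>) *s v) \<longlongrightarrow> v0 + (r * complex_of_real 0) *s v) (at_right 0)"
      by (intro tendsto_intros tendsto_smult)
    then show ?thesis using openB that by (auto dest: topological_tendstoD)
  qed
  have "\<forall>\<^sub>F \<sigma> in at_right 0. (z0 + (t * complex_of_real \<sigma>) *s p \<in> B \<and> z0 + (t' * complex_of_real \<sigma>) *s p \<in> B) \<and>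
     (w0 + (s * complex_of_real \<sigma>) *s q \<in> B \<and> w0 + (s' * complex_of_real \<sigma>) *s q \<in> B)"
    using ev z0 w0 by (intro eventually_conj) auto
  then obtain b :: real where "b > 0" and b: "\<And>\<sigma>. 0 < \<sigma> \<Longrightarrow> \<sigma> < b \<Longrightarrow>
     (z0 + (t * complex_of_real \<sigma>) *s p \<in> B \<and> z0 + (t' * complex_of_real \<sigma>) *s p \<in> B) \<and>
     (w0 + (s * complex_of_real \<sigma>) *s q \<in> B \<and> w0 + (s' * complex_of_real \<sigma>) *s q \<in> B)"
    unfolding eventually_at_right_field by blast
  define \<sigma> where "\<sigma> = b / 2"
  have \<sigma>: "\<sigma> > 0" "z0 + (t * complex_of_real \<sigma>) *s p \<in> B" "z0 + (t' * complex_of_real \<sigma>) *s p \<in> B"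
     "w0 + (s * complex_of_real \<sigma>) *s q \<in> B" "w0 + (s' * complex_of_real \<sigma>) *s q \<in> B"
    using \<open>b > 0\<close> b[of \<sigma>] by (simp_all add: \<sigma>_def)
  define Z where "Z = (\<lambda>r \<theta>. (z0 + (r * complex_of_real \<sigma>) *s p) + \<theta> *s (r *s x - (r * complex_of_real \<sigma>) *s p))"
  \<comment> \<open>The conjugate makes the minor holomorphic in \<open>\<theta>\<close>; it has no
    effect at the real \<open>\<theta>\<close> chosen below.\<close>
  define W where "W = (\<lambda>r \<theta>. (w0 + (r * complex_of_real \<sigma>) *s q) + cnj \<theta> *s (r *s y - (r * complex_of_real \<sigma>) *s q))"
  let ?S = "{\<theta>. Z t \<theta> \<in> B \<and> Z t' \<theta> \<in> B \<and> W s \<theta> \<in> B \<and> W s' \<theta> \<in> B}"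
  have S: "?S = {\<theta>. Z t \<theta> \<in> B} \<inter> {\<theta>. Z t' \<theta> \<in> B} \<inter> {\<theta>. W s \<theta> \<in> B} \<inter> {\<theta>. W s' \<theta> \<in> B}" by auto
  have openS: "open ?S" unfolding S unfolding Z_def W_def
    by (intro open_Int open_line open_cnj_line openB)
  have convexS: "convex ?S" unfolding S unfolding Z_def W_def
    by (intro convex_Int convex_line convex_cnj_line convexB)
  have hol: "(\<lambda>\<theta>. minor f2 (Z t \<theta>) (Z t' \<theta>) (W s \<theta>) (W s' \<theta>)) holomorphic_on ?S"
    unfolding Z_def W_def by (rule minor_line_holomorphic[OF f2])
  have 0: "0 \<in> ?S" using \<sigma> by (simp add: Z_def W_def)
  have ZW1: "Z r 1 = z0 + r *s x" "W r 1 = w0 + r *s y" for r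
    by (simp_all add: Z_def W_def)
  have 1: "1 \<in> ?S" using ts by (simp add: ZW1)
  \<comment> \<open>These two bounds on \<open>\<theta>\<close> are exactly what gives
    \<open>\<tau> < \<epsilon>\<close>.\<close>
  have "min (1/2) (\<epsilon> * \<sigma> / 2) > 0" using \<epsilon> \<sigma> by simp
  moreover have "minor f2 (Z t 1) (Z t' 1) (W s 1) (W s' 1) \<noteq> 0" using ts ZW1 by simp
  ultimately obtain \<theta> :: real where \<theta>: "0 < \<theta>" "\<theta> < min (1/2) (\<epsilon> * \<sigma> / 2)" "\<theta> < 1"
    "complex_of_real \<theta> \<in> ?S"
    "minor f2 (Z t (complex_of_real \<theta>)) (Z t' (complex_of_real \<theta>)) (W s (complex_of_real \<theta>)) (W s' (complex_of_real \<theta>)) \<noteq> 0"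
    using holomorphic_nonzero_near_0[OF hol openS convexS 0 1] by blast
  \<comment> \<open>Read off from
    \<open>(1 - \<theta>) \<sigma> p + \<theta> x = c (p + \<tau> x)\<close> with
    \<open>c = (1 - \<theta>) \<sigma>\<close>; the factor \<open>c\<close> is moved into the line
    parameters.\<close>
  define \<tau> where "\<tau> = \<theta> / ((1 - \<theta>) * \<sigma>)"
  have "\<tau> > 0" using \<theta> \<sigma> by (simp add: \<tau>_def)
  have "\<tau> < \<epsilon>"
  proof -
    have "\<theta> < \<epsilon> * \<sigma> / 2" "1 - \<theta> > 1/2" using \<theta> by auto
    moreover have "\<epsilon> * \<sigma> / 2 \<le> \<epsilon> * ((1 - \<theta>) * \<sigma>)"
      using \<epsilon> \<sigma> \<theta> by (auto simp: field_simps)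
    ultimately have "\<theta> < \<epsilon> * ((1 - \<theta>) * \<sigma>)" by linarith
    then show ?thesis using \<theta> \<sigma> unfolding \<tau>_def by (subst pos_divide_less_eq) auto
  qed
  define c where "c = complex_of_real ((1 - \<theta>) * \<sigma>)"
  have c\<tau>: "c * complex_of_real \<tau> = complex_of_real \<theta>"
  proof -
    have "((1 - \<theta>) * \<sigma>) * \<tau> = \<theta>" using \<theta> \<sigma> by (simp add: \<tau>_def)
    then show ?thesis unfolding c_def by (metis of_real_mult)
  qed
  have c': "c = complex_of_real \<sigma> - complex_of_real \<theta> * complex_of_real \<sigma>"
    by (simp add: c_def algebra_simps)
  have comb: "v0 + (r * c) *s (u + complex_of_real \<tau> *s v) =
     v0 + (r * complex_of_real \<sigma>) *s u + complex_of_real \<theta> *s (r *s v - (r * complex_of_real \<sigma>) *s u)"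
    for v0 u v :: "complex ^ 'n" and r
  proof -
    have "(r * c) *s (u + complex_of_real \<tau> *s v) = (r * c) *s u + (r * (c * complex_of_real \<tau>)) *s v"
      by (simp add: vec_eq_iff algebra_simps)
    then show ?thesis unfolding c\<tau> unfolding c' by (simp add: vec_eq_iff algebra_simps)
  qed
  have "Z r (complex_of_real \<theta>) = z0 + (r * c) *s (p + complex_of_real \<tau> *s x)"
    "W r (complex_of_real \<theta>) = w0 + (r * c) *s (q + complex_of_real \<tau> *s y)" for r
    unfolding comb by (simp_all add: Z_def W_def)
  then have "(p + complex_of_real \<tau> *s x, q + complex_of_real \<tau> *s y) \<in> nonsingular_pairs f2 z0 w0"
    using \<theta>(4,5) unfolding nonsingular_pairs_def by auto
  then show ?thesis using \<open>\<tau> > 0\<close> \<open>\<tau> < \<epsilon>\<close> by blast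
qed

lemma dimension_ge_2: "2 \<le> CARD('n)"
  using rank by linarith

text \<open>Without any block the two extra rows already give rank 2, while the bound leaves at most
  1.\<close>

lemma no_good_base_dim_2:
  assumes "CARD('n) \<le> 2" "z0 \<in> B" "w0 \<in> B" "hform g z0 w0 = 0"
    "hform g' (f z1) (f w0) \<noteq> 0" "hform g' (f z0) (f w1) \<noteq> 0"
  shows False
proof -
  have "2 * 0 + 2 \<le> card {j. g' j \<noteq> 0}"
    by (rule hform_rank_lower_bound[of g' "f z0" "f w0" "f z1" "f w1" 0 "\<lambda>_. 0" "\<lambda>_. 0" "\<lambda>_. 0" "\<lambda>_. 0"])
       (use assms in \<open>auto intro: orth\<close>)
  then show False using rank assms(1) by linarith
qed

text \<open>Openness and density turn one nonsingular orthogonal pair of directions into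
  \<open>m = CARD('n) - 2\<close> biorthogonal ones. With \<open>z0\<close>, \<open>z1\<close> and
  \<open>w0\<close>, \<open>w1\<close> as extra rows and columns the rank would be at least
  \<open>2 * CARD('n) - 2\<close>.\<close>

lemma nonsingular_pairs_good_base:
  assumes f2: "line_holomorphic_on f2 B"
    and orth2: "\<And>z w. z \<in> B \<Longrightarrow> w \<in> B \<Longrightarrow> hform g z w = 0 \<Longrightarrow> hform g' (f2 z) (f w) = 0"
    and z0: "z0 \<in> B" and w0: "w0 \<in> B" and zw: "hform g z0 w0 = 0"
    and good: "hform g' (f z1) (f w0) \<noteq> 0" "hform g' (f z0) (f w1) \<noteq> 0"
    and x: "hform g x w0 = 0" and y: "hform g z0 y = 0"
  shows "(x, y) \<notin> nonsingular_pairs f2 z0 w0"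
proof
  assume xy: "(x, y) \<in> nonsingular_pairs f2 z0 w0"
  define m where "m = CARD('n) - 2"
  have m: "m + 2 \<le> CARD('n)" using dimension_ge_2 by (simp add: m_def)
  have z00: "z0 \<noteq> 0" using z0 B0 by auto
  have "\<exists>e c. ((\<forall>i<m. hform g (e i) w0 = 0 \<and> hform g z0 (c i) = 0 \<and>
         (e i, c i) \<in> nonsingular_pairs f2 z0 w0 \<and> hform g (e i) (c i) \<noteq> 0) \<and>
      (\<forall>i<m. \<forall>l<m. i \<noteq> l \<longrightarrow> hform g (e i) (c l) = 0)) \<and>
     (m + 2 < CARD('n) \<longrightarrow> (\<exists>x y. (x, y) \<in> nonsingular_pairs f2 z0 w0 \<and> hform g x w0 = 0 \<and>
        hform g z0 y = 0 \<and> (\<forall>i<m. hform g x (c i) = 0 \<and> hform g (e i) y = 0)))"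
    by (rule biorthogonal_family_in_open_set[OF g z00 zw open_nonsingular_pairs[OF f2] _ xy x y m])
       (rule dense_nonsingular_pairs[OF f2 z0 w0])
  then obtain e c where
    ec: "\<forall>i<m. hform g (e i) w0 = 0 \<and> hform g z0 (c i) = 0 \<and> (e i, c i) \<in> nonsingular_pairs f2 z0 w0 \<and>
      hform g (e i) (c i) \<noteq> 0"
    and off: "\<forall>i<m. \<forall>l<m. i \<noteq> l \<longrightarrow> hform g (e i) (c l) = 0"
    by (elim exE conjE)
  have "\<forall>i. \<exists>r. i < m \<longrightarrow> z0 + fst r *s e i \<in> B \<and> z0 + fst (snd r) *s e i \<in> B \<and>
     w0 + fst (snd (snd r)) *s c i \<in> B \<and> w0 + snd (snd (snd r)) *s c i \<in> B \<and>
     minor f2 (z0 + fst r *s e i) (z0 + fst (snd r) *s e i) (w0 + fst (snd (snd r)) *s c i)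
       (w0 + snd (snd (snd r)) *s c i) \<noteq> 0"
  proof (intro allI)
    fix i
    show "\<exists>r. i < m \<longrightarrow> z0 + fst r *s e i \<in> B \<and> z0 + fst (snd r) *s e i \<in> B \<and>
     w0 + fst (snd (snd r)) *s c i \<in> B \<and> w0 + snd (snd (snd r)) *s c i \<in> B \<and>
     minor f2 (z0 + fst r *s e i) (z0 + fst (snd r) *s e i) (w0 + fst (snd (snd r)) *s c i)
       (w0 + snd (snd (snd r)) *s c i) \<noteq> 0"
    proof (cases "i < m")
      case True
      then obtain t t' s s' where "z0 + t *s e i \<in> B" "z0 + t' *s e i \<in> B"
        "w0 + s *s c i \<in> B" "w0 + s' *s c i \<in> B"
        "minor f2 (z0 + t *s e i) (z0 + t' *s e i) (w0 + s *s c i) (w0 + s' *s c i) \<noteq> 0"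
        using ec unfolding nonsingular_pairs_def by blast
      then show ?thesis by (intro exI[of _ "(t, t', s, s')"]) simp
    qed simp
  qed
  then obtain r where r: "\<And>i. i < m \<Longrightarrow> z0 + fst (r i) *s e i \<in> B \<and> z0 + fst (snd (r i)) *s e i \<in> B \<and>
     w0 + fst (snd (snd (r i))) *s c i \<in> B \<and> w0 + snd (snd (snd (r i))) *s c i \<in> B \<and>
     minor f2 (z0 + fst (r i) *s e i) (z0 + fst (snd (r i)) *s e i) (w0 + fst (snd (snd (r i))) *s c i)
       (w0 + snd (snd (snd (r i))) *s c i) \<noteq> 0"
    unfolding choice_iff by blast
  \<comment> \<open>\<open>Z i\<close> is a row through \<open>f\<close> and \<open>Z' i\<close> a
    row through \<open>f2\<close>. Points of different blocks are orthogonal, since all cross terms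
    among \<open>z0\<close>, \<open>e i\<close>, \<open>w0\<close>, \<open>c l\<close> vanish for
    \<open>i \<noteq> l\<close>.\<close>
  define Z Z' W W' where "Z i = z0 + fst (r i) *s e i" and "Z' i = z0 + fst (snd (r i)) *s e i"
    and "W i = w0 + fst (snd (snd (r i))) *s c i" and "W' i = w0 + snd (snd (snd (r i))) *s c i" for i
  have inB: "Z i \<in> B" "Z' i \<in> B" "W i \<in> B" "W' i \<in> B" if "i < m" for i
    using r[OF that] by (auto simp: Z_def Z'_def W_def W'_def)
  have Zw0: "hform g (Z i) w0 = 0" "hform g (Z' i) w0 = 0" "hform g z0 (W i) = 0" "hform g z0 (W' i) = 0"
    if "i < m" for i
    using that ec zw by (auto simp: Z_def Z'_def W_def W'_def hform_simps)
  have ZW: "hform g (Z i) (W l) = 0" "hform g (Z i) (W' l) = 0" "hform g (Z' i) (W l) = 0" "hform g (Z' i) (W' l) = 0"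
    if "i < m" "l < m" "i \<noteq> l" for i l
    using that ec zw off by (auto simp: Z_def Z'_def W_def W'_def hform_simps)
  have "2 * m + 2 \<le> card {j. g' j \<noteq> 0}"
  proof (rule hform_rank_lower_bound[of g' "f z0" "f w0" "f z1" "f w1" m "\<lambda>i. f (Z i)" "\<lambda>i. f2 (Z' i)"
        "\<lambda>i. f (W i)" "\<lambda>i. f (W' i)"])
    fix i assume i: "i < m"
    show "hform g' (f (Z i)) (f (W i)) * hform g' (f2 (Z' i)) (f (W' i)) \<noteq>
       hform g' (f (Z i)) (f (W' i)) * hform g' (f2 (Z' i)) (f (W i))"
      using r[OF i] unfolding minor_def Z_def Z'_def W_def W'_def by auto
  qed (use inB Zw0 ZW z0 w0 zw good in \<open>auto intro: orth orth2\<close>)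
  then show False using rank m by (simp add: m_def)
qed

section \<open>Density of good base pairs and vanishing of the minors\<close>

lemma nonzero_dense_right:
  assumes "zz \<in> B" "ww \<in> B" "hform g' (f zz) (f ww) \<noteq> 0" "w \<in> B" "\<epsilon> > 0"
  obtains w' where "w' \<in> B" "dist w' w < \<epsilon>" "hform g' (f zz) (f w') \<noteq> 0"
proof -
  let ?S = "{t. zz + t *s 0 \<in> B \<and> w + cnj t *s (ww - w) \<in> B}"
  have S: "?S = {t. zz + t *s 0 \<in> B} \<inter> {t. w + cnj t *s (ww - w) \<in> B}" by auto
  have hol: "(\<lambda>t. hform g' (f (zz + t *s 0)) (f (w + cnj t *s (ww - w)))) holomorphic_on ?S"
    by (rule hform_line_holomorphic[OF f f openB])
  have pos: "\<epsilon> / (norm (ww - w) + 1) > 0" using assms by (simp add: add_nonneg_pos)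
  have "open ?S" unfolding S by (intro open_Int open_line open_cnj_line openB)
  moreover have "convex ?S" unfolding S by (intro convex_Int convex_line convex_cnj_line convexB)
  moreover have "0 \<in> ?S" "1 \<in> ?S" using assms by simp_all
  moreover have "hform g' (f (zz + 1 *s 0)) (f (w + cnj 1 *s (ww - w))) \<noteq> 0" using assms by simp
  ultimately obtain \<theta> :: real where \<theta>: "0 < \<theta>" "\<theta> < \<epsilon> / (norm (ww - w) + 1)"
    "complex_of_real \<theta> \<in> ?S"
    "hform g' (f (zz + complex_of_real \<theta> *s 0)) (f (w + cnj (complex_of_real \<theta>) *s (ww - w))) \<noteq> 0"
    using holomorphic_nonzero_near_0[OF hol _ _ _ _ _ pos] by blast
  show ?thesis
  proof (rule that)
    show "w + complex_of_real \<theta> *s (ww - w) \<in> B" using \<theta> by simp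
    show "hform g' (f zz) (f (w + complex_of_real \<theta> *s (ww - w))) \<noteq> 0" using \<theta> by simp
    have "dist (w + complex_of_real \<theta> *s (ww - w)) w = \<theta> * norm (ww - w)"
      using \<theta> by (simp only: dist_norm add_diff_cancel_left' norm_smult_complex norm_of_real abs_of_pos)
    also have "\<dots> \<le> \<theta> * (norm (ww - w) + 1)" using \<theta> by (intro mult_left_mono) auto
    also have "\<dots> < \<epsilon>" using \<theta> by (simp add: pos_less_divide_eq add_nonneg_pos)
    finally show "dist (w + complex_of_real \<theta> *s (ww - w)) w < \<epsilon>" .
  qed
qed

lemma nonzero_dense_left:
  assumes "zz \<in> B" "ww \<in> B" "hform g' (f zz) (f ww) \<noteq> 0" "z \<in> B" "\<epsilon> > 0"
  obtains z' where "z' \<in> B" "dist z' z < \<epsilon>" "hform g' (f z') (f ww) \<noteq> 0"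
proof -
  have "hform g' (f ww) (f zz) \<noteq> 0" using assms hform_commute_eq_0 by blast
  from nonzero_dense_right[OF assms(2,1) this assms(4,5)]
  obtain z' where "z' \<in> B" "dist z' z < \<epsilon>" "hform g' (f ww) (f z') \<noteq> 0" by blast
  then show ?thesis using that[of z'] hform_commute_eq_0 by blast
qed

text \<open>Incidence must survive while two conditions are met. First \<open>w0\<close> moves to
  satisfy its condition and \<open>z0\<close> is corrected; then \<open>z1\<close> moves to satisfy
  the other condition, and \<open>w1\<close> is corrected so little that its open condition
  persists. The directions are adjusted last.\<close>

lemma perturb_to_good_base:
  assumes nz: "zz \<in> B" "ww \<in> B" "hform g' (f zz) (f ww) \<noteq> 0"
    and z0: "z0 \<in> B" and w0: "w0 \<in> B" and zw: "hform g z0 w0 = 0"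
    and a: "hform g a w0 = 0" and b: "hform g z0 b = 0" and \<epsilon>: "\<epsilon> > 0"
  obtains z w a' b' where "dist z z0 < \<epsilon>" "dist w w0 < \<epsilon>" "dist a' a < \<epsilon>" "dist b' b < \<epsilon>"
    "z \<in> B" "w \<in> B" "hform g z w = 0" "hform g a' w = 0" "hform g z b' = 0"
    "hform g' (f zz) (f w) \<noteq> 0" "hform g' (f z) (f ww) \<noteq> 0"
proof -
  have nz0: "z0 \<noteq> 0" "w0 \<noteq> 0" using z0 w0 B0 by auto
  obtain \<rho> where \<rho>: "\<rho> > 0" "ball z0 \<rho> \<subseteq> B" using openB z0 openE by blast
  obtain \<delta>a where \<delta>a: "\<delta>a > 0" "\<forall>w'. dist w' w0 < \<delta>a \<longrightarrow> (\<exists>z'. dist z' a < \<epsilon> \<and> hform g z' w' = 0)"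
    using hform_perturb_left[OF g nz0(2) a \<epsilon>] by blast
  obtain \<delta>b where \<delta>b: "\<delta>b > 0" "\<forall>z'. dist z' z0 < \<delta>b \<longrightarrow> (\<exists>w'. dist w' b < \<epsilon> \<and> hform g z' w' = 0)"
    using hform_perturb_right[OF g nz0(1) b \<epsilon>] by blast
  \<comment> \<open>\<open>\<epsilon>1\<close> bounds the total motion of \<open>w\<close> and
    \<open>\<epsilon>2\<close> that of \<open>z\<close>, each spent in two halves. The entries
    \<open>\<delta>a\<close> and \<open>\<delta>b\<close> keep the later corrections of
    \<open>a\<close> and \<open>b\<close> small, and \<open>\<rho>\<close> keeps \<open>z1\<close>
    in \<open>B\<close>.\<close>
  define \<epsilon>1 where "\<epsilon>1 = min \<epsilon> \<delta>a"
  define \<epsilon>2 where "\<epsilon>2 = min \<epsilon> (min \<delta>b \<rho>)"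
  have pos: "\<epsilon>1 / 2 > 0" "\<epsilon>2 / 2 > 0" using \<epsilon> \<delta>a \<delta>b \<rho> by (auto simp: \<epsilon>1_def \<epsilon>2_def)
  obtain \<delta>1 where \<delta>1: "\<delta>1 > 0"
    "\<forall>w'. dist w' w0 < \<delta>1 \<longrightarrow> (\<exists>z'. dist z' z0 < \<epsilon>2 / 2 \<and> hform g z' w' = 0)"
    using hform_perturb_left[OF g nz0(2) zw pos(2)] by blast
  obtain w1 where w1: "w1 \<in> B" "dist w1 w0 < min \<delta>1 (\<epsilon>1 / 2)" "hform g' (f zz) (f w1) \<noteq> 0"
    using nonzero_dense_right[OF nz w0, of "min \<delta>1 (\<epsilon>1 / 2)"] \<delta>1(1) pos(1) by auto
  obtain z1 where z1: "dist z1 z0 < \<epsilon>2 / 2" "hform g z1 w1 = 0"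
    using \<delta>1(2) w1(2) by auto
  have "z1 \<in> ball z0 \<rho>" using z1(1) pos(2) by (auto simp: \<epsilon>2_def dist_commute)
  then have z1B: "z1 \<in> B" using \<rho>(2) by blast
  then have z10: "z1 \<noteq> 0" using B0 by auto
  have "open {w \<in> B. hform g' (f zz) (f w) \<noteq> 0}"
    by (intro open_nonzero openB continuous_intros continuous_f)
  moreover have "w1 \<in> {w \<in> B. hform g' (f zz) (f w) \<noteq> 0}" using w1 by simp
  ultimately obtain \<eta> where \<eta>: "\<eta> > 0" "ball w1 \<eta> \<subseteq> {w \<in> B. hform g' (f zz) (f w) \<noteq> 0}"
    using openE by blast
  have "min \<eta> (\<epsilon>1 / 2) > 0" using \<eta> pos by simp
  then obtain \<delta>2 where \<delta>2: "\<delta>2 > 0"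
    "\<forall>z'. dist z' z1 < \<delta>2 \<longrightarrow> (\<exists>w'. dist w' w1 < min \<eta> (\<epsilon>1 / 2) \<and> hform g z' w' = 0)"
    using hform_perturb_right[OF g z10 z1(2)] by blast
  obtain z where z: "z \<in> B" "dist z z1 < min \<delta>2 (\<epsilon>2 / 2)" "hform g' (f z) (f ww) \<noteq> 0"
    using nonzero_dense_left[OF nz z1B, of "min \<delta>2 (\<epsilon>2 / 2)"] \<delta>2(1) pos(2) by auto
  obtain w where w: "dist w w1 < min \<eta> (\<epsilon>1 / 2)" "hform g z w = 0" using \<delta>2(2) z(2) by auto
  have "w \<in> ball w1 \<eta>" using w(1) by (simp add: dist_commute)
  then have wB: "w \<in> B" "hform g' (f zz) (f w) \<noteq> 0" using \<eta>(2) by auto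
  have dz: "dist z z0 < \<epsilon>2" using dist_triangle[of z z0 z1] z(2) z1(1) by simp
  have dw: "dist w w0 < \<epsilon>1" using dist_triangle[of w w0 w1] w(1) w1(2) by simp
  obtain a' where a': "dist a' a < \<epsilon>" "hform g a' w = 0" using \<delta>a(2) dw by (auto simp: \<epsilon>1_def)
  obtain b' where b': "dist b' b < \<epsilon>" "hform g z b' = 0" using \<delta>b(2) dz by (auto simp: \<epsilon>2_def)
  show ?thesis
    by (rule that[of z w a' b']) (use dz dw a' b' wB z w in \<open>auto simp: \<epsilon>1_def \<epsilon>2_def\<close>)
qed

text \<open>For fixed line parameters a nonzero minor is an open condition on
  \<open>(z0, w0, a, b)\<close>. It would survive the move to a nearby good base with adjusted
  directions, where the rank count excludes it.\<close>

lemma minor_eq_0: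
  assumes f2: "line_holomorphic_on f2 B"
    and orth2: "\<And>z w. z \<in> B \<Longrightarrow> w \<in> B \<Longrightarrow> hform g z w = 0 \<Longrightarrow> hform g' (f2 z) (f w) = 0"
    and z0: "z0 \<in> B" and w0: "w0 \<in> B" and zw: "hform g z0 w0 = 0"
    and a: "hform g a w0 = 0" and b: "hform g z0 b = 0"
    and inB: "z0 + t *s a \<in> B" "z0 + t' *s a \<in> B" "w0 + s *s b \<in> B" "w0 + s' *s b \<in> B"
  shows "minor f2 (z0 + t *s a) (z0 + t' *s a) (w0 + s *s b) (w0 + s' *s b) = 0"
proof (rule ccontr)
  assume nz: "minor f2 (z0 + t *s a) (z0 + t' *s a) (w0 + s *s b) (w0 + s' *s b) \<noteq> 0"
  \<comment> \<open>The first row of the minor consists of values of \<open>M\<close>, so a nonzero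
    minor already provides a nonzero value of \<open>M\<close> on \<open>B\<close>.\<close>
  obtain zz ww where zzww: "zz \<in> B" "ww \<in> B" "hform g' (f zz) (f ww) \<noteq> 0"
  proof (cases "\<exists>zz\<in>B. \<exists>ww\<in>B. hform g' (f zz) (f ww) \<noteq> 0")
    case False
    then show ?thesis using nz inB by (auto simp: minor_def)
  qed (use that in blast)
  define Op where "Op = {p. fst p + t *s fst (snd (snd p)) \<in> B \<and> fst p + t' *s fst (snd (snd p)) \<in> B \<and>
     fst (snd p) + s *s snd (snd (snd p)) \<in> B \<and> fst (snd p) + s' *s snd (snd (snd p)) \<in> B \<and>
     minor f2 (fst p + t *s fst (snd (snd p))) (fst p + t' *s fst (snd (snd p)))
      (fst (snd p) + s *s snd (snd (snd p))) (fst (snd p) + s' *s snd (snd (snd p))) \<noteq> 0}"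
  have "open Op" unfolding Op_def
    by (intro open_minor_nonzero[OF f2] continuous_on_add continuous_on_const
        continuous_on_smult continuous_on_fst continuous_on_snd continuous_on_id)
  moreover have "(z0, w0, a, b) \<in> Op" using nz inB by (simp add: Op_def)
  ultimately obtain e where e: "e > 0" "ball (z0, w0, a, b) e \<subseteq> Op" using openE by blast
  have "e / 4 > 0" using e by simp
  from perturb_to_good_base[OF zzww z0 w0 zw a b this]
  obtain z w a' b' where p: "dist z z0 < e / 4" "dist w w0 < e / 4" "dist a' a < e / 4" "dist b' b < e / 4"
    "z \<in> B" "w \<in> B" "hform g z w = 0" "hform g a' w = 0" "hform g z b' = 0"
    "hform g' (f zz) (f w) \<noteq> 0" "hform g' (f z) (f ww) \<noteq> 0" by blast
  have "dist (z, w, a', b') (z0, w0, a, b) \<le> dist z z0 + (dist w w0 + (dist a' a + dist b' b))"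
    by (intro order_trans[OF dist_Pair_le] add_mono order_refl)
  also have "\<dots> < e" using p by simp
  finally have "(z, w, a', b') \<in> Op" using e(2) by (auto simp: dist_commute)
  then have "(a', b') \<in> nonsingular_pairs f2 z w"
    unfolding Op_def nonsingular_pairs_def by auto
  then show False
    using nonsingular_pairs_good_base[OF f2 orth2 p(5,6,7,10,11,8,9)] by blast
qed

end

lemma exists_nonnull:
  fixes g :: "'n::finite \<Rightarrow> real" and U :: "(complex ^ 'n) set"
  assumes g: "\<And>i. g i \<noteq> 0" and U: "open U" "w0 \<in> U" "0 \<notin> U"
  obtains w where "w \<in> U" "hform g w w \<noteq> 0"
proof (cases "hform g w0 w0 = 0")
  case True
  have "w0 \<noteq> 0" using U by auto
  then obtain y0 where "hform g w0 y0 \<noteq> 0" using hform_nondegenerate[of g w0] g by blast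
  \<comment> \<open>The factor makes \<open>hform g w0 y\<close> real and positive, so the two cross
    terms of the square add instead of possibly cancelling.\<close>
  define y where "y = hform g w0 y0 *s y0"
  have y: "hform g w0 y = complex_of_real ((cmod (hform g w0 y0))\<^sup>2)"
    unfolding y_def hform_scale_right by (subst complex_norm_square) (rule mult.commute)
  have y': "hform g y w0 = complex_of_real ((cmod (hform g w0 y0))\<^sup>2)"
    using y cnj_hform[of g w0 y] by (metis complex_cnj_complex_of_real)
  note lim = tendsto_line
  have "\<forall>\<^sub>F t in at_right 0. w0 + complex_of_real t *s y \<in> U"
    using lim U(1,2) by (rule topological_tendstoD)
  moreover have "((\<lambda>t. 2 * complex_of_real ((cmod (hform g w0 y0))\<^sup>2) + complex_of_real t * hform g y y)
      \<longlongrightarrow> 2 * complex_of_real ((cmod (hform g w0 y0))\<^sup>2) + complex_of_real 0 * hform g y y) (at_right 0)"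
    by (intro tendsto_intros)
  then have "\<forall>\<^sub>F t in at_right 0. 2 * complex_of_real ((cmod (hform g w0 y0))\<^sup>2) + complex_of_real t * hform g y y \<noteq> 0"
    by (rule tendsto_imp_eventually_ne) (use \<open>hform g w0 y0 \<noteq> 0\<close> in simp)
  moreover have "\<forall>\<^sub>F t in at_right 0. (0::real) < t" by (simp add: eventually_at_right_less)
  ultimately have "\<forall>\<^sub>F t in at_right 0. w0 + complex_of_real t *s y \<in> U \<and>
     2 * complex_of_real ((cmod (hform g w0 y0))\<^sup>2) + complex_of_real t * hform g y y \<noteq> 0 \<and> (0::real) < t"
    by eventually_elim auto
  then obtain t :: real where t: "w0 + complex_of_real t *s y \<in> U"
     "2 * complex_of_real ((cmod (hform g w0 y0))\<^sup>2) + complex_of_real t * hform g y y \<noteq> 0" "0 < t"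
    using eventually_happens'[OF trivial_limit_at_right_real] by blast
  have "hform g (w0 + complex_of_real t *s y) (w0 + complex_of_real t *s y) =
     complex_of_real t * (2 * complex_of_real ((cmod (hform g w0 y0))\<^sup>2) + complex_of_real t * hform g y y)"
    using True y y' by (simp add: hform_simps algebra_simps)
  then show ?thesis using t that[of "w0 + complex_of_real t *s y"] by simp
qed (use that U in blast)

text \<open>Additivity in the direction compares different slices and is not part of
  \<open>line_holomorphic_on\<close>; it will come from the Frechet derivative of the local
  representative.\<close>

locale local_orthogonal_diff = local_orthogonal_rep g g' f B
  for g :: "'n::finite \<Rightarrow> real" and g' :: "'m::finite \<Rightarrow> real"
    and f :: "complex ^ 'n \<Rightarrow> complex ^ 'm" and B :: "(complex ^ 'n) set" +
  assumes dirderiv_add: "\<And>z u v. z \<in> B \<Longrightarrow> dirderiv f (u + v) z = dirderiv f u z + dirderiv f v z"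
    and dirderiv_scale: "\<And>z c v. z \<in> B \<Longrightarrow> dirderiv f (c *s v) z = c *s dirderiv f v z"
begin

text \<open>Moving along \<open>v\<close> keeps the point orthogonal to \<open>w\<close>, so the
  differentiated function is constantly 0.\<close>

lemma dirderiv_tangent:
  assumes "z \<in> B" "w \<in> B" "hform g z w = 0" "hform g v w = 0"
  shows "hform g' (dirderiv f v z) (f w) = 0"
proof -
  have D: "((\<lambda>t. hform g' (f (z + t *s v)) (f w)) has_field_derivative
      hform g' (dirderiv f v (z + 0 *s v)) (f w)) (at 0)"
    by (rule hform_has_dirderiv[OF f openB]) (use assms in simp)
  have "((\<lambda>t. hform g' (f (z + t *s v)) (f w)) has_field_derivative 0) (at 0)"
  proof (rule has_field_derivative_transform_within_open[of "\<lambda>_. 0" _ _ "{t. z + t *s v \<in> B}"])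
    fix t assume "t \<in> {t. z + t *s v \<in> B}"
    then show "0 = hform g' (f (z + t *s v)) (f w)"
      using assms orth[of "z + t *s v" w] by (simp add: hform_simps)
  qed (use assms open_line[OF openB] in auto)
  then show ?thesis using DERIV_unique[OF D] by simp
qed

text \<open>The derivative functional vanishes on all directions orthogonal to \<open>w\<close>,
  hence is a multiple of \<open>hform g a w\<close>; cross-multiplication covers the case of zero
  pairings.\<close>

lemma dirderiv_proportional:
  assumes "z \<in> B" "w \<in> B" "hform g z w = 0"
  shows "hform g' (dirderiv f a z) (f w) * hform g y w = hform g' (dirderiv f y z) (f w) * hform g a w"
proof -
  have "hform g' (dirderiv f (hform g y w *s a + (- hform g a w) *s y) z) (f w) = 0"
    using assms by (intro dirderiv_tangent) (simp_all add: hform_simps)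
  then show ?thesis
    unfolding dirderiv_add[OF assms(1)] dirderiv_scale[OF assms(1)] hform_simps
    by (simp add: algebra_simps)
qed

lemma nonzero_on_open:
  assumes "zz \<in> B" "ww \<in> B" "hform g' (f zz) (f ww) \<noteq> 0"
    and "open B1" "B1 \<noteq> {}" "B1 \<subseteq> B" "open B2" "B2 \<noteq> {}" "B2 \<subseteq> B"
  obtains z w where "z \<in> B1" "w \<in> B2" "hform g' (f z) (f w) \<noteq> 0"
proof -
  obtain z1 w1 where zw1: "z1 \<in> B1" "w1 \<in> B2" using assms by blast
  obtain e1 where e1: "e1 > 0" "ball z1 e1 \<subseteq> B1" using assms zw1 openE by blast
  obtain e2 where e2: "e2 > 0" "ball w1 e2 \<subseteq> B2" using assms zw1 openE by blast
  have "w1 \<in> B" "z1 \<in> B" using zw1 assms by auto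
  obtain w where w: "w \<in> B" "dist w w1 < e2" "hform g' (f zz) (f w) \<noteq> 0"
    using nonzero_dense_right[OF assms(1-3) \<open>w1 \<in> B\<close> e2(1)] by blast
  obtain z where z: "z \<in> B" "dist z z1 < e1" "hform g' (f z) (f w) \<noteq> 0"
    using nonzero_dense_left[OF assms(1) w(1,3) \<open>z1 \<in> B\<close> e1(1)] by blast
  have "z \<in> B1" "w \<in> B2" using z w e1 e2 by (auto simp: dist_commute)
  then show ?thesis using that z by blast
qed

text \<open>Supplies bases for \<open>minor_eq_0\<close> with columns \<open>w\<close> and
  \<open>wc\<close>: \<open>\<zeta> w\<close> is orthogonal to the whole line through
  \<open>wc\<close> and \<open>w\<close>, and its partner is the point of that line orthogonal to
  \<open>z\<close>. \<open>Oz\<close> and \<open>Ow\<close> pass on open conditions of the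
  caller.\<close>

lemma incident_configurations:
  assumes n: "2 < CARD('n)" and zc: "zc \<in> B" and wc: "wc \<in> B" and zw: "hform g zc wc = 0"
    and Oz: "open Oz" "zc \<in> Oz" and Ow: "open Ow" "wc \<in> Ow"
  shows "\<exists>B1 B2 \<zeta>. open B1 \<and> B1 \<noteq> {} \<and> B1 \<subseteq> B \<and> open B2 \<and> B2 \<noteq> {} \<and> B2 \<subseteq> B \<and> B2 \<subseteq> Ow \<and>
    (\<forall>w\<in>B2. \<zeta> w \<in> B \<and> \<zeta> w \<in> Oz \<and> hform g (\<zeta> w) w = 0 \<and> hform g (\<zeta> w) wc = 0) \<and>
    (\<forall>z\<in>B1. hform g z wc \<noteq> 0) \<and>
    (\<forall>z\<in>B1. \<forall>w\<in>B2. \<exists>\<sigma>. wc + \<sigma> *s (w - wc) \<in> B \<and> hform g z (wc + \<sigma> *s (w - wc)) = 0)"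
proof -
  have nz: "zc \<noteq> 0" "wc \<noteq> 0" using zc wc B0 by auto
  \<comment> \<open>Available because \<open>2 < CARD('n)\<close>. They give the sample pair
    \<open>z1\<close>, \<open>w1\<close> with \<open>\<zeta> w1 = zc\<close> and partner
    \<open>wc\<close>, from which openness yields \<open>B1\<close> and \<open>B2\<close>.\<close>
  obtain d e where de: "hform g d wc = 0" "hform g zc e = 0" "hform g d e \<noteq> 0"
    using biorthogonal_extension[OF g nz(1) zw, of 0 "\<lambda>_. 0" "\<lambda>_. 0"] n by auto
  note lim = tendsto_line
  have "\<forall>\<^sub>F t in at_right 0. zc + complex_of_real t *s d \<in> B"
    using lim openB zc by (rule topological_tendstoD)
  moreover have "\<forall>\<^sub>F t in at_right 0. wc + complex_of_real t *s e \<in> B \<inter> Ow"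
    using lim by (rule topological_tendstoD) (use openB wc Ow in auto)
  moreover have "\<forall>\<^sub>F t in at_right 0. (0::real) < t" by (simp add: eventually_at_right_less)
  ultimately have "\<forall>\<^sub>F t in at_right 0. zc + complex_of_real t *s d \<in> B \<and>
     wc + complex_of_real t *s e \<in> B \<inter> Ow \<and> (0::real) < t"
    by eventually_elim auto
  then obtain t :: real where t: "zc + complex_of_real t *s d \<in> B" "wc + complex_of_real t *s e \<in> B"
    "wc + complex_of_real t *s e \<in> Ow" "0 < t"
    using eventually_happens'[OF trivial_limit_at_right_real] by blast
  define z1 where "z1 = zc + complex_of_real t *s d"
  define w1 where "w1 = wc + complex_of_real t *s e"
  have z1: "hform g z1 wc = 0" "hform g z1 (w1 - wc) \<noteq> 0"
    using t de zw by (simp_all add: z1_def w1_def hform_add_left hform_scale_left hform_scale_right)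
  have w1: "hform g zc w1 = 0" "hform g d w1 \<noteq> 0"
    using t de zw by (simp_all add: w1_def hform_add_right hform_scale_right)
  define \<zeta> where "\<zeta> = (\<lambda>w. zc - (hform g zc w / hform g d w) *s d)"
  define A where "A = {w \<in> B \<inter> Ow. hform g d w \<noteq> 0}"
  have openA: "open A" unfolding A_def
    by (intro open_nonzero open_Int openB Ow continuous_intros)
  have "continuous_on A \<zeta>" unfolding \<zeta>_def A_def
    by (intro continuous_intros continuous_on_smult) auto
  then have openA': "open (A \<inter> \<zeta> -` (B \<inter> Oz))"
    using openA openB Oz by (intro continuous_open_preimage) auto
  have w1A: "w1 \<in> A \<inter> \<zeta> -` (B \<inter> Oz)"
    using t w1 zc Oz by (simp add: A_def \<zeta>_def w1_def)
  define \<Omega> where "\<Omega> = {p. hform g (fst p) (snd p - wc) \<noteq> 0}"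
  \<comment> \<open>The coefficient solves \<open>hform g z (wc + \<sigma> *s (w - wc)) = 0\<close>;
    it is conjugated because the form is antilinear on the right.\<close>
  define h where "h = (\<lambda>p. wc + cnj (- hform g (fst p) wc / hform g (fst p) (snd p - wc)) *s (snd p - wc))"
  have open\<Omega>: "open \<Omega>"
  proof -
    have "open {p \<in> (UNIV :: ((complex ^ 'n) \<times> (complex ^ 'n)) set). hform g (fst p) (snd p - wc) \<noteq> 0}"
      by (intro open_nonzero continuous_intros) auto
    then show ?thesis by (simp add: \<Omega>_def)
  qed
  have "continuous_on \<Omega> h" unfolding h_def \<Omega>_def
    by (intro continuous_intros continuous_on_smult) auto
  then have "open (\<Omega> \<inter> h -` B)"
    using open\<Omega> openB by (intro continuous_open_preimage) auto
  moreover have "(z1, w1) \<in> \<Omega> \<inter> h -` B" using z1 wc by (simp add: \<Omega>_def h_def)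
  ultimately obtain A1 A2 where A12': "open A1" "open A2" "(z1, w1) \<in> A1 \<times> A2"
    "A1 \<times> A2 \<subseteq> \<Omega> \<inter> h -` B"
    by (rule open_prod_elim)
  then have A12: "open A1" "open A2" "z1 \<in> A1" "w1 \<in> A2" "A1 \<times> A2 \<subseteq> \<Omega> \<inter> h -` B" by simp_all
  \<comment> \<open>\<open>z1\<close> is orthogonal to \<open>wc\<close>, which \<open>B1\<close>
    forbids; a nudge along \<open>y\<close> produces a point of \<open>B1\<close>.\<close>
  obtain y where "hform g wc y \<noteq> 0" using hform_nondegenerate[of g wc] g nz by blast
  then have y: "hform g y wc \<noteq> 0" using hform_commute_eq_0 by blast
  have "\<forall>\<^sub>F t in at_right 0. z1 + complex_of_real t *s y \<in> A1 \<inter> B"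
    using lim by (rule topological_tendstoD) (use A12 openB t in \<open>auto simp: z1_def\<close>)
  moreover have "\<forall>\<^sub>F t in at_right 0. (0::real) < t" by (simp add: eventually_at_right_less)
  ultimately have "\<forall>\<^sub>F t in at_right 0. z1 + complex_of_real t *s y \<in> A1 \<inter> B \<and> (0::real) < t"
    by eventually_elim auto
  then obtain r :: real where r: "z1 + complex_of_real r *s y \<in> A1 \<inter> B" "0 < r"
    using eventually_happens'[OF trivial_limit_at_right_real] by blast
  define B1 where "B1 = {z \<in> A1 \<inter> B. hform g z wc \<noteq> 0}"
  define B2 where "B2 = A2 \<inter> (A \<inter> \<zeta> -` (B \<inter> Oz))"
  have "open B1" unfolding B1_def by (intro open_nonzero open_Int A12 openB continuous_intros)
  moreover have "open B2" unfolding B2_def using A12(2) openA' by (rule open_Int)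
  moreover have "z1 + complex_of_real r *s y \<in> B1"
    using r y z1 by (simp add: B1_def hform_add_left hform_scale_left)
  then have "B1 \<noteq> {}" by blast
  moreover have "w1 \<in> B2" using A12 w1A by (simp add: B2_def)
  then have "B2 \<noteq> {}" by blast
  moreover have "B1 \<subseteq> B" "B2 \<subseteq> B" "B2 \<subseteq> Ow" by (auto simp: B1_def B2_def A_def)
  moreover have "\<zeta> w \<in> B \<and> \<zeta> w \<in> Oz \<and> hform g (\<zeta> w) w = 0 \<and> hform g (\<zeta> w) wc = 0" if "w \<in> B2" for w
    using that zw de by (auto simp: B2_def A_def \<zeta>_def hform_diff_left hform_scale_left)
  moreover have "hform g z wc \<noteq> 0" if "z \<in> B1" for z using that by (simp add: B1_def)
  moreover have "\<exists>\<sigma>. wc + \<sigma> *s (w - wc) \<in> B \<and> hform g z (wc + \<sigma> *s (w - wc)) = 0"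
      if "z \<in> B1" "w \<in> B2" for z w
    proof -
      have p: "(z, w) \<in> \<Omega> \<inter> h -` B" using that A12(5) by (auto simp: B1_def B2_def)
      let ?s = "cnj (- hform g z wc / hform g z (w - wc))"
      have "wc + ?s *s (w - wc) \<in> B" using p by (simp add: h_def)
      moreover have "hform g z (wc + ?s *s (w - wc)) = 0"
      proof -
        have "hform g z (w - wc) \<noteq> 0" using p by (simp add: \<Omega>_def)
        then show ?thesis unfolding hform_add_right hform_scale_right by simp
      qed
      ultimately show ?thesis by blast
    qed
  ultimately show ?thesis by (intro exI[of _ B1] exI[of _ B2] exI[of _ \<zeta>] conjI ballI) auto
qed

end

section \<open>The local product form\<close>

context local_orthogonal_diff
begin

lemma f_nonzero_open:
  "open {p. fst p + fst (snd (snd p)) \<in> B \<and> fst (snd p) + snd (snd (snd p)) \<in> B \<and>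
     hform g' (f (fst p + fst (snd (snd p)))) (f (fst (snd p) + snd (snd (snd p)))) \<noteq> 0}" (is "open ?\<Omega>")
proof -
  let ?A = "(\<lambda>p. fst p + fst (snd (snd p))) -` B \<inter> (\<lambda>p. fst (snd p) + snd (snd (snd p))) -` B"
  have "open ?A" by (intro open_Int open_vimage openB continuous_intros)
  then have "open {p \<in> ?A. hform g' (f (fst p + fst (snd (snd p)))) (f (fst (snd p) + snd (snd (snd p)))) \<noteq> 0}"
    by (intro open_nonzero continuous_on_hform continuous_on_compose2[OF continuous_f] continuous_intros) auto
  moreover have "{p \<in> ?A. hform g' (f (fst p + fst (snd (snd p)))) (f (fst (snd p) + snd (snd (snd p)))) \<noteq> 0} = ?\<Omega>"
    by auto
  ultimately show ?thesis by simp
qed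

text \<open>The null point enters as the incident pair \<open>(zn, zn)\<close>, from which the
  configurations are built. A final small perturbation adds the condition on
  \<open>w0\<close>.\<close>

lemma nonzero_incident_configuration:
  assumes n: "2 < CARD('n)" and nz: "zz \<in> B" "ww \<in> B" "hform g' (f zz) (f ww) \<noteq> 0"
    and zn: "zn \<in> B" "hform g zn zn = 0"
  obtains z0 w0 a b where "z0 \<in> B" "w0 \<in> B" "hform g z0 w0 = 0" "hform g a w0 = 0" "hform g z0 b = 0"
    "hform g' (f zz) (f w0) \<noteq> 0" "z0 + a \<in> B" "w0 + b \<in> B" "hform g' (f (z0 + a)) (f (w0 + b)) \<noteq> 0"
proof -
  obtain B1 B2 \<zeta> where sel: "open B1" "B1 \<noteq> {}" "B1 \<subseteq> B" "open B2" "B2 \<noteq> {}" "B2 \<subseteq> B"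
    "\<forall>w\<in>B2. \<zeta> w \<in> B \<and> \<zeta> w \<in> UNIV \<and> hform g (\<zeta> w) w = 0 \<and> hform g (\<zeta> w) zn = 0"
    "\<forall>z\<in>B1. \<forall>w\<in>B2. \<exists>\<sigma>. zn + \<sigma> *s (w - zn) \<in> B \<and> hform g z (zn + \<sigma> *s (w - zn)) = 0"
    using incident_configurations[OF n zn(1) zn(1) zn(2) open_UNIV UNIV_I open_UNIV UNIV_I]
    by (elim exE conjE)
  obtain z w where zw: "z \<in> B1" "w \<in> B2" "hform g' (f z) (f w) \<noteq> 0"
    using nonzero_on_open[OF nz sel(1-6)] by blast
  obtain \<sigma> where \<sigma>: "zn + \<sigma> *s (w - zn) \<in> B" "hform g z (zn + \<sigma> *s (w - zn)) = 0"
    using sel(8) zw(1,2) by blast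
  define w0 where "w0 = zn + \<sigma> *s (w - zn)"
  have z0: "\<zeta> w \<in> B" "hform g (\<zeta> w) w = 0" "hform g (\<zeta> w) zn = 0" using sel(7) zw(2) by auto
  have w0: "w0 \<in> B" "hform g z w0 = 0" using \<sigma> by (simp_all add: w0_def)
  have w0': "hform g (\<zeta> w) w0 = 0"
    using z0 by (simp add: w0_def hform_add_right hform_scale_right hform_diff_right)
  define \<Omega> where "\<Omega> = {p. fst p + fst (snd (snd p)) \<in> B \<and> fst (snd p) + snd (snd (snd p)) \<in> B \<and>
     hform g' (f (fst p + fst (snd (snd p)))) (f (fst (snd p) + snd (snd (snd p)))) \<noteq> 0}"
  have "open \<Omega>" unfolding \<Omega>_def by (rule f_nonzero_open)
  moreover have "(\<zeta> w, w0, z - \<zeta> w, w - w0) \<in> \<Omega>"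
    using zw sel(3,6) by (auto simp: \<Omega>_def)
  ultimately obtain e where e: "e > 0" "ball (\<zeta> w, w0, z - \<zeta> w, w - w0) e \<subseteq> \<Omega>" using openE by blast
  have orths: "hform g (z - \<zeta> w) w0 = 0" "hform g (\<zeta> w) (w - w0) = 0"
    using w0 w0' z0 by (simp_all add: hform_diff_left hform_diff_right)
  have "e / 4 > 0" using e by simp
  from perturb_to_good_base[OF nz z0(1) w0(1) w0' orths this]
  obtain z0 w0' a b where p: "dist z0 (\<zeta> w) < e / 4" "dist w0' w0 < e / 4" "dist a (z - \<zeta> w) < e / 4"
    "dist b (w - w0) < e / 4" "z0 \<in> B" "w0' \<in> B" "hform g z0 w0' = 0" "hform g a w0' = 0" "hform g z0 b = 0"
    "hform g' (f zz) (f w0') \<noteq> 0" "hform g' (f z0) (f ww) \<noteq> 0" by blast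
  have "dist (z0, w0', a, b) (\<zeta> w, w0, z - \<zeta> w, w - w0) \<le>
     dist z0 (\<zeta> w) + (dist w0' w0 + (dist a (z - \<zeta> w) + dist b (w - w0)))"
    by (intro order_trans[OF dist_Pair_le] add_mono order_refl)
  also have "\<dots> < e" using p by simp
  finally have "(z0, w0', a, b) \<in> \<Omega>" using e(2) by (auto simp: dist_commute)
  then have "z0 + a \<in> B" "w0' + b \<in> B" "hform g' (f (z0 + a)) (f (w0' + b)) \<noteq> 0"
    by (auto simp: \<Omega>_def)
  then show ?thesis using that p by blast
qed

text \<open>If every derivative vanished on the incidence variety, then for a suitable direction \<open>v\<close> the
  Wronskian of \<open>A\<close> and \<open>C\<close> below would vanish by \<open>minor_eq_0\<close>, although only \<open>A\<close> vanishes at \<open>0\<close>.\<close>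
lemma exists_nonzero_normal_derivative:
  assumes n: "2 < CARD('n)" and nz: "zz \<in> B" "ww \<in> B" "hform g' (f zz) (f ww) \<noteq> 0"
    and zn: "zn \<in> B" "hform g zn zn = 0"
  shows "\<exists>zc\<in>B. \<exists>wc\<in>B. \<exists>v. hform g zc wc = 0 \<and> hform g' (dirderiv f v zc) (f wc) \<noteq> 0"
proof (rule ccontr)
  assume "\<not> ?thesis"
  then have orth2: "\<And>v z w. z \<in> B \<Longrightarrow> w \<in> B \<Longrightarrow> hform g z w = 0 \<Longrightarrow> hform g' (dirderiv f v z) (f w) = 0"
    by blast
  obtain z0 w0 a b where p: "z0 \<in> B" "w0 \<in> B" "hform g z0 w0 = 0" "hform g a w0 = 0" "hform g z0 b = 0"
    "hform g' (f zz) (f w0) \<noteq> 0"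
    and ab: "z0 + a \<in> B" "w0 + b \<in> B" "hform g' (f (z0 + a)) (f (w0 + b)) \<noteq> 0"
    using nonzero_incident_configuration[OF n nz zn] by blast
  have aw0: "hform g (z0 + a) w0 = 0" using p by (simp add: hform_add_left)
  have "hform g (z0 + a) (w0 + b) \<noteq> 0" using ab orth by blast
  then have nab: "hform g (z0 + a) b \<noteq> 0" using aw0 by (simp add: hform_add_right)
  \<comment> \<open>Aimed at \<open>zz\<close>, so that \<open>A 1 = hform g' (f zz) (f w0)\<close>
    is nonzero.\<close>
  define v where "v = zz - (z0 + a)"
  define Z where "Z = (\<lambda>t. (z0 + a) + t *s v)"
  define A where "A = (\<lambda>t. hform g' (f (Z t)) (f w0))"
  define C where "C = (\<lambda>t. hform g' (f (Z t)) (f (w0 + b)))"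
  \<comment> \<open>Chosen so that \<open>w0 + s t *s b\<close> is orthogonal to \<open>Z t\<close>;
    here \<open>hform g (Z t) w0 = t * hform g v w0\<close>.\<close>
  define s where "s = (\<lambda>t. cnj (- (t * hform g v w0) / hform g (Z t) b))"
  have Z0: "Z 0 = z0 + a" by (simp add: Z_def)
  have lim: "(Z \<longlongrightarrow> z0 + a) (nhds 0)"
  proof -
    have "((\<lambda>t. (z0 + a) + t *s v) \<longlongrightarrow> (z0 + a) + 0 *s v) (nhds 0)"
      by (intro tendsto_add tendsto_const tendsto_smult filterlim_ident)
    then show ?thesis by (simp add: Z_def)
  qed
  have ev1: "\<forall>\<^sub>F t in nhds 0. Z t \<in> B" using lim openB ab(1) by (rule topological_tendstoD)
  have ev2: "\<forall>\<^sub>F t in nhds 0. hform g (Z t) b \<noteq> 0"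
    using nab by (intro tendsto_imp_eventually_ne[OF tendsto_hform[OF lim tendsto_const]])
  have "((\<lambda>t. w0 + s t *s b) \<longlongrightarrow> w0 + cnj (- (0 * hform g v w0) / hform g (z0 + a) b) *s b) (nhds 0)"
    unfolding s_def using nab by (intro tendsto_intros tendsto_smult lim filterlim_ident)
  then have "((\<lambda>t. w0 + s t *s b) \<longlongrightarrow> w0) (nhds 0)" by simp
  then have ev3: "\<forall>\<^sub>F t in nhds 0. w0 + s t *s b \<in> B" using openB p(2) by (rule topological_tendstoD)
  have DZ: "((\<lambda>t. hform g' (f (Z t)) y) has_field_derivative hform g' (dirderiv f v (Z t)) y) (at t)"
    if "Z t \<in> B" for t y
    using hform_has_dirderiv[OF f openB, of "z0 + a" t v g' y] that unfolding Z_def by blast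
  have "isCont C 0" unfolding C_def using DZ[of 0] ab(1) DERIV_isCont unfolding Z0 by blast
  then have "(C \<longlongrightarrow> C 0) (nhds 0)" by (simp add: isCont_def tendsto_nhds_iff)
  then have ev4: "\<forall>\<^sub>F t in nhds 0. C t \<noteq> 0"
    by (rule tendsto_imp_eventually_ne) (use ab in \<open>simp add: C_def Z0\<close>)
  have "\<forall>\<^sub>F t in nhds 0. (Z t \<in> B \<and> hform g (Z t) b \<noteq> 0) \<and> (w0 + s t *s b \<in> B \<and> C t \<noteq> 0)"
    by (intro eventually_conj ev1 ev2 ev3 ev4)
  then obtain r where r: "r > 0" and rr: "\<And>t. dist t 0 < r \<Longrightarrow> Z t \<in> B \<and>
     hform g (Z t) b \<noteq> 0 \<and> w0 + s t *s b \<in> B \<and> C t \<noteq> 0"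
    unfolding eventually_nhds_metric by blast
  have "((\<lambda>t. A t / C t) has_field_derivative 0) (at t within ball 0 r)" if t: "t \<in> ball 0 r" for t
  proof -
    have R: "Z t \<in> B" "hform g (Z t) b \<noteq> 0" "w0 + s t *s b \<in> B" "C t \<noteq> 0"
      using rr[of t] t by (auto simp: dist_commute)
    have DA: "(A has_field_derivative hform g' (dirderiv f v (Z t)) (f w0)) (at t)"
      unfolding A_def by (rule DZ[OF R(1)])
    have DC: "(C has_field_derivative hform g' (dirderiv f v (Z t)) (f (w0 + b))) (at t)"
      unfolding C_def by (rule DZ[OF R(1)])
    have zw: "hform g (Z t) (w0 + s t *s b) = 0"
    proof -
      have "hform g (Z t) w0 = t * hform g v w0"
        unfolding Z_def hform_add_left hform_scale_left using p by simp
      moreover have "cnj (s t) * hform g (Z t) b = - (t * hform g v w0)" using R(2) by (simp add: s_def)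
      ultimately show ?thesis unfolding hform_add_right hform_scale_right by simp
    qed
    have z0w: "hform g z0 (w0 + s t *s b) = 0" using p by (simp add: hform_add_right hform_scale_right)
    have 1: "z0 + 1 *s (Z t - z0) = Z t" by simp
    have 2: "w0 + s t *s b + (- s t) *s b = w0" by (simp add: vec_eq_iff)
    have 3: "w0 + s t *s b + (1 - s t) *s b = w0 + b" by (simp add: vec_eq_iff algebra_simps)
    \<comment> \<open>Both rows sit at \<open>Z t\<close>, one as value and one as derivative, and
      the columns are \<open>w0\<close> and \<open>w0 + b\<close> seen from the moving base. Up to
      sign this minor is the numerator of the derivative of \<open>A / C\<close>.\<close>
    have "minor (dirderiv f v) (z0 + 1 *s (Z t - z0)) (z0 + 1 *s (Z t - z0))
       (w0 + s t *s b + (- s t) *s b) (w0 + s t *s b + (1 - s t) *s b) = 0"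
    proof (rule minor_eq_0[OF line_holomorphic_dirderiv[OF f openB] orth2 p(1) R(3) z0w _ p(5)])
      show "hform g (Z t - z0) (w0 + s t *s b) = 0" using zw z0w by (simp add: hform_diff_left)
    qed (unfold 1 2 3, use R p ab in auto)
    then have "A t * hform g' (dirderiv f v (Z t)) (f (w0 + b)) = C t * hform g' (dirderiv f v (Z t)) (f w0)"
      unfolding 1 2 3 minor_def A_def C_def by simp
    then have "(hform g' (dirderiv f v (Z t)) (f w0) * C t - A t * hform g' (dirderiv f v (Z t)) (f (w0 + b))) / (C t * C t) = 0"
      by (simp add: mult.commute)
    then have "((\<lambda>t. A t / C t) has_field_derivative 0) (at t)"
      using DERIV_divide[OF DA DC R(4)] by (simp only:)
    then show ?thesis by (rule has_field_derivative_at_within)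
  qed
  then obtain k where k: "\<And>t. t \<in> ball 0 r \<Longrightarrow> A t / C t = k"
    using has_field_derivative_zero_constant[OF convex_ball, of 0 r "\<lambda>t. A t / C t"] by blast
  have "A 0 = 0" using orth[OF ab(1) p(2) aw0] by (simp add: A_def Z0)
  then have "k = 0" using k[of 0] r by simp
  then have A0: "A t = 0" if "t \<in> ball 0 r" for t using k[OF that] rr[of t] that by (auto simp: dist_commute)
  have hol: "A holomorphic_on {t. Z t \<in> B}"
  proof (rule holomorphic_onI)
    fix t assume "t \<in> {t. Z t \<in> B}"
    then have "A field_differentiable at t"
      unfolding A_def field_differentiable_def using DZ[of t] by blast
    then show "A field_differentiable at t within {t. Z t \<in> B}" by (rule field_differentiable_at_within)
  qed
  have "0 \<in> {t. Z t \<in> B}" "1 \<in> {t. Z t \<in> B}" "A 1 \<noteq> 0"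
    using ab nz p by (simp_all add: v_def A_def Z_def)
  moreover have "open {t. Z t \<in> B}" "convex {t. Z t \<in> B}"
    unfolding Z_def by (rule open_line[OF openB], rule convex_line[OF convexB])
  ultimately obtain \<theta> :: real where "0 < \<theta>" "\<theta> < r" "A (complex_of_real \<theta>) \<noteq> 0"
    using holomorphic_nonzero_near_0[OF hol _ _ _ _ _ r] by blast
  then show False using A0[of "complex_of_real \<theta>"] by simp
qed

end

context local_orthogonal_diff
begin

text \<open>With columns \<open>w\<close>, \<open>wc\<close> and rows \<open>z\<close>,
  \<open>z0 + t a\<close>, rank one is an identity whose two sides vanish at \<open>t = 0\<close>,
  as \<open>z0\<close> is orthogonal to \<open>w\<close> and \<open>wc\<close>; its derivative
  carries the information. Derivatives along \<open>a\<close> are then traded for those along the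
  fixed \<open>y\<close>, which produces the factor \<open>hform g z w\<close>.\<close>

lemma incident_product_form:
  assumes n: "2 < CARD('n)" and zc: "zc \<in> B" and wc: "wc \<in> B" and zw: "hform g zc wc = 0"
    and y: "hform g' (dirderiv f y zc) (f wc) \<noteq> 0"
  shows "\<exists>B1 B2 \<phi> \<psi>. open B1 \<and> B1 \<noteq> {} \<and> B1 \<subseteq> B \<and> open B2 \<and> B2 \<noteq> {} \<and> B2 \<subseteq> B \<and>
    (\<forall>z\<in>B1. \<forall>w\<in>B2. hform g' (f z) (f w) = \<phi> z * \<psi> w * hform g z w)"
proof -
  have ywc: "hform g y wc \<noteq> 0"
    using dirderiv_tangent[OF zc wc zw] y by blast
  define Oz where "Oz = {z \<in> B. hform g' (dirderiv f y z) (f wc) \<noteq> 0}"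
  define Ow where "Ow = {w \<in> UNIV. hform g y w \<noteq> 0}"
  have "continuous_on B (dirderiv f y)"
    using line_holomorphic_dirderiv[OF f openB] unfolding line_holomorphic_on_def by blast
  then have openOz: "open Oz" unfolding Oz_def
    by (intro open_nonzero openB continuous_on_hform continuous_on_const)
  have openOw: "open Ow" unfolding Ow_def
    by (intro open_nonzero open_UNIV continuous_intros)
  have zcO: "zc \<in> Oz" using zc y by (simp add: Oz_def)
  have wcO: "wc \<in> Ow" using ywc by (simp add: Ow_def)
  obtain B1 B2 \<zeta> where sel: "open B1" "B1 \<noteq> {}" "B1 \<subseteq> B" "open B2" "B2 \<noteq> {}" "B2 \<subseteq> B" "B2 \<subseteq> Ow"
    "\<forall>w\<in>B2. \<zeta> w \<in> B \<and> \<zeta> w \<in> Oz \<and> hform g (\<zeta> w) w = 0 \<and> hform g (\<zeta> w) wc = 0"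
    "\<forall>z\<in>B1. hform g z wc \<noteq> 0"
    "\<forall>z\<in>B1. \<forall>w\<in>B2. \<exists>\<sigma>. wc + \<sigma> *s (w - wc) \<in> B \<and> hform g z (wc + \<sigma> *s (w - wc)) = 0"
    using incident_configurations[OF n zc wc zw openOz zcO openOw wcO] by (elim exE conjE)
  define \<phi> where "\<phi> = (\<lambda>z. hform g' (f z) (f wc) / hform g z wc)"
  \<comment> \<open>A function of \<open>w\<close> alone, because the base \<open>\<zeta> w\<close>
    does not depend on \<open>z\<close>.\<close>
  define \<psi> where "\<psi> = (\<lambda>w. hform g' (dirderiv f y (\<zeta> w)) (f w) * hform g y wc /
     (hform g' (dirderiv f y (\<zeta> w)) (f wc) * hform g y w))"
  have "hform g' (f z) (f w) = \<phi> z * \<psi> w * hform g z w" if z: "z \<in> B1" and w: "w \<in> B2" for z w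
  proof -
    define z0 where "z0 = \<zeta> w"
    obtain \<sigma> where \<sigma>: "wc + \<sigma> *s (w - wc) \<in> B" "hform g z (wc + \<sigma> *s (w - wc)) = 0"
      using sel(10) z w by blast
    define w0 where "w0 = wc + \<sigma> *s (w - wc)"
    have zB: "z \<in> B" "w \<in> B" "hform g z wc \<noteq> 0" "hform g y w \<noteq> 0" using sel z w by (auto simp: Ow_def)
    have z0: "z0 \<in> B" "hform g z0 w = 0" "hform g z0 wc = 0" "hform g' (dirderiv f y z0) (f wc) \<noteq> 0"
      using sel(8) w by (auto simp: z0_def Oz_def)
    have w0: "w0 \<in> B" "hform g z w0 = 0" using \<sigma> by (simp_all add: w0_def)
    have z0w0: "hform g z0 w0 = 0"
      using z0 by (simp add: w0_def hform_add_right hform_scale_right hform_diff_right)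
    define a where "a = z - z0"
    have a: "hform g a w0 = 0" using w0 z0w0 by (simp add: a_def hform_diff_left)
    have b: "hform g z0 (w - wc) = 0" using z0 by (simp add: hform_diff_right)
    have e1: "z0 + 1 *s a = z" by (simp add: a_def)
    have e2: "w0 + (1 - \<sigma>) *s (w - wc) = w" by (simp add: w0_def vec_eq_iff algebra_simps)
    have e3: "w0 + (- \<sigma>) *s (w - wc) = wc" by (simp add: w0_def vec_eq_iff)
    define h where "h = (\<lambda>t. hform g' (f z) (f w) * hform g' (f (z0 + t *s a)) (f wc) -
       hform g' (f z) (f wc) * hform g' (f (z0 + t *s a)) (f w))"
    have h0: "0 = h t" if "t \<in> {t. z0 + t *s a \<in> B}" for t
    proof -
      have "minor f (z0 + 1 *s a) (z0 + t *s a) (w0 + (1 - \<sigma>) *s (w - wc)) (w0 + (- \<sigma>) *s (w - wc)) = 0"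
        by (rule minor_eq_0[OF f orth z0(1) w0(1) z0w0 a b]) (unfold e1 e2 e3, use that zB wc in auto)
      then show ?thesis unfolding e1 e2 e3 minor_def h_def by simp
    qed
    have z00: "z0 + 0 *s a \<in> B" using z0 by simp
    have "(h has_field_derivative
        hform g' (f z) (f w) * hform g' (dirderiv f a (z0 + 0 *s a)) (f wc) -
        hform g' (f z) (f wc) * hform g' (dirderiv f a (z0 + 0 *s a)) (f w)) (at 0)"
      unfolding h_def
      by (intro DERIV_diff DERIV_cmult hform_has_dirderiv[OF f openB z00])
    moreover have "(h has_field_derivative 0) (at 0)"
      by (rule has_field_derivative_transform_within_open[OF DERIV_const open_line[OF openB] _ h0])
         (use z0 in auto)
    ultimately have E: "hform g' (f z) (f w) * hform g' (dirderiv f a z0) (f wc) =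
        hform g' (f z) (f wc) * hform g' (dirderiv f a z0) (f w)"
      using DERIV_unique by fastforce
    have aw: "hform g a w = hform g z w" "hform g a wc = hform g z wc"
      using z0 by (simp_all add: a_def hform_diff_left)
    have P1: "hform g' (dirderiv f a z0) (f w) = hform g' (dirderiv f y z0) (f w) * hform g z w / hform g y w"
      using dirderiv_proportional[OF z0(1) zB(2) z0(2), of a y] zB(4) aw by (simp add: field_simps)
    have P2: "hform g' (dirderiv f a z0) (f wc) = hform g' (dirderiv f y z0) (f wc) * hform g z wc / hform g y wc"
      using dirderiv_proportional[OF z0(1) wc z0(3), of a y] ywc aw by (simp add: field_simps)
    show ?thesis
      using E zB(3,4) z0(4) ywc unfolding P1 P2 \<phi>_def \<psi>_def z0_def[symmetric]
      by (simp add: field_simps)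
  qed
  then show ?thesis using sel by (intro exI[of _ B1] exI[of _ B2] exI[of _ \<phi>] exI[of _ \<psi>]) auto
qed

lemma hform_line_holomorphic_left:
  assumes "line_holomorphic_on f2 B"
  shows "(\<lambda>t. hform k (f2 (z + t *s u)) y) holomorphic_on {t. z + t *s u \<in> B}"
  unfolding hform_def by (intro holomorphic_intros line_holomorphic_onD[OF assms]) auto

text \<open>The product form holds on \<open>B1\<close> times \<open>B2\<close>; continuation in
  \<open>z\<close> brings both arguments into one set \<open>U\<close>. There Hermitian symmetry
  makes \<open>\<phi>2\<close> a real multiple of \<open>cnj \<eta>\<close>: its sign becomes
  \<open>c\<close>, its modulus is absorbed into \<open>\<psi>\<close>.\<close>

lemma local_form:
  assumes nz: "zz \<in> B" "ww \<in> B" "hform g' (f zz) (f ww) \<noteq> 0"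
    and zn: "zn \<in> B" "hform g zn zn = 0"
  shows "\<exists>U \<psi> c. open U \<and> U \<noteq> {} \<and> U \<subseteq> B \<and> (c = 1 \<or> c = - 1) \<and> (\<forall>z\<in>U. \<psi> z \<noteq> 0) \<and>
    (\<forall>z\<in>U. \<forall>w\<in>U. hform g' (f z) (f w) = complex_of_real c * \<psi> z * cnj (\<psi> w) * hform g z w)"
proof -
  have n: "2 < CARD('n)"
  proof (rule ccontr)
    assume "\<not> 2 < CARD('n)"
    then have small: "CARD('n) \<le> 2" by simp
    have z00: "hform g 0 zn = 0" "hform g zn 0 = 0" by simp_all
    obtain z w where "z \<in> B" "w \<in> B" "hform g z w = 0" "hform g' (f zz) (f w) \<noteq> 0" "hform g' (f z) (f ww) \<noteq> 0"
      using perturb_to_good_base[OF nz zn(1) zn(1) zn(2) z00 zero_less_one] by blast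
    then show False using no_good_base_dim_2[OF small] by blast
  qed
  obtain zc wc v where c: "zc \<in> B" "wc \<in> B" "hform g zc wc = 0" "hform g' (dirderiv f v zc) (f wc) \<noteq> 0"
    using exists_nonzero_normal_derivative[OF n nz zn] by blast
  obtain B1 B2 \<phi> \<eta> where B12: "open B1" "B1 \<noteq> {}" "B1 \<subseteq> B" "open B2" "B2 \<noteq> {}" "B2 \<subseteq> B"
    and form: "\<forall>z\<in>B1. \<forall>w\<in>B2. hform g' (f z) (f w) = \<phi> z * \<eta> w * hform g z w"
    using incident_product_form[OF n c] by (elim exE conjE)
  obtain z1 w1 where zw1: "z1 \<in> B1" "w1 \<in> B2" "hform g' (f z1) (f w1) \<noteq> 0"
    using nonzero_on_open[OF nz B12] by blast
  define B3 where "B3 = {w \<in> B2. hform g' (f z1) (f w) \<noteq> 0}"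
  have "continuous_on B2 f" using continuous_f B12 continuous_on_subset by blast
  then have openB3: "open B3" unfolding B3_def
    by (intro open_nonzero B12 continuous_on_hform continuous_on_const)
  have \<eta>: "\<eta> w \<noteq> 0" if "w \<in> B3" for w using that form zw1 by (auto simp: B3_def)
  have w1: "w1 \<in> B3" using zw1 by (simp add: B3_def)
  have B3: "B3 \<subseteq> B2" "B3 \<subseteq> B" using B12 by (auto simp: B3_def)
  have "0 \<notin> B3" using B3(2) B0 by blast
  \<comment> \<open>Near \<open>(w2, w2)\<close> the pairing \<open>hform g z w\<close> has no
    zeros, which permits the divisions below.\<close>
  then obtain w2 where w2: "w2 \<in> B3" "hform g w2 w2 \<noteq> 0"
    by (rule exists_nonnull[OF g openB3 w1])
  have "open {p \<in> UNIV. hform g (fst p) (snd p) \<noteq> 0}"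
    by (intro open_nonzero open_UNIV continuous_intros)
  moreover have "(w2, w2) \<in> {p \<in> UNIV. hform g (fst p) (snd p) \<noteq> 0}" using w2 by simp
  ultimately obtain A1 A2 where A: "open A1" "open A2" "(w2, w2) \<in> A1 \<times> A2"
    "A1 \<times> A2 \<subseteq> {p \<in> UNIV. hform g (fst p) (snd p) \<noteq> 0}"
    by (rule open_prod_elim)
  define U where "U = A1 \<inter> A2 \<inter> B3"
  have U: "open U" "w2 \<in> U" "U \<subseteq> B3" using A w2 openB3 by (auto simp: U_def)
  have UB: "U \<subseteq> B" "U \<subseteq> B2" using U B3 by auto
  have nn: "hform g z w \<noteq> 0" if "z \<in> U" "w \<in> U" for z w
    using that A(4) by (auto simp: U_def)
  \<comment> \<open>Cross-multiplied, the relation is holomorphic in \<open>z\<close> and extends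
    from \<open>B1\<close> to all of \<open>B\<close>.\<close>
  have id: "hform g' (f z) (f w) * (\<eta> w' * hform g z w') - hform g' (f z) (f w') * (\<eta> w * hform g z w) = 0"
    if z: "z \<in> B" and w: "w \<in> B2" "w' \<in> B2" for z w w'
  proof (rule identity_theorem_convex[OF openB convexB _ _ B12(1) zw1(1) _ z])
    have lin: "line_holomorphic_on (\<lambda>z. z) B"
      unfolding line_holomorphic_on_def by (auto intro!: holomorphic_intros)
    show "(\<lambda>t. hform g' (f (z + t *s u)) (f w) * (\<eta> w' * hform g (z + t *s u) w') -
      hform g' (f (z + t *s u)) (f w') * (\<eta> w * hform g (z + t *s u) w))
      holomorphic_on {t. z + t *s u \<in> B}" for z u
      by (intro holomorphic_on_diff holomorphic_on_mult holomorphic_on_const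
          hform_line_holomorphic_left[OF f] hform_line_holomorphic_left[OF lin])
    show "hform g' (f z) (f w) * (\<eta> w' * hform g z w') - hform g' (f z) (f w') * (\<eta> w * hform g z w) = 0"
      if "z \<in> B1" for z
      unfolding form[rule_format, OF that w(1)] form[rule_format, OF that w(2)]
      by (simp only: mult_ac diff_self)
    show "z1 \<in> B" using zw1(1) B12(3) by blast
  qed
  define \<phi>2 where "\<phi>2 = (\<lambda>z. hform g' (f z) (f w2) / (\<eta> w2 * hform g z w2))"
  have M: "hform g' (f z) (f w) = \<phi>2 z * \<eta> w * hform g z w" if "z \<in> U" "w \<in> U" for z w
  proof -
    have d: "\<eta> w2 * hform g z w2 \<noteq> 0" using \<eta>[OF w2(1)] nn[OF that(1) U(2)] by simp
    have "z \<in> B" "w \<in> B2" "w2 \<in> B2" using that UB U by auto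
    from id[OF this]
    have "hform g' (f z) (f w) * (\<eta> w2 * hform g z w2) = hform g' (f z) (f w2) * (\<eta> w * hform g z w)"
      by (rule eq_iff_diff_eq_0[THEN iffD2])
    then have "hform g' (f z) (f w) = hform g' (f z) (f w2) * (\<eta> w * hform g z w) / (\<eta> w2 * hform g z w2)"
      unfolding nonzero_eq_divide_eq[OF d] .
    then show ?thesis unfolding \<phi>2_def by (simp only: times_divide_eq_left mult.assoc)
  qed
  have sym: "\<phi>2 w * \<eta> z = cnj (\<phi>2 z * \<eta> w)" if "z \<in> U" "w \<in> U" for z w
  proof -
    have "\<phi>2 w * \<eta> z * hform g w z = cnj (\<phi>2 z * \<eta> w * hform g z w)"
      unfolding M[OF that, symmetric] M[OF that(2,1), symmetric] by (rule cnj_hform[symmetric])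
    then have "\<phi>2 w * \<eta> z * hform g w z = cnj (\<phi>2 z * \<eta> w) * hform g w z"
      unfolding complex_cnj_mult cnj_hform .
    then show ?thesis using nn[OF that(2,1)] by simp
  qed
  \<comment> \<open>By \<open>sym\<close>, \<open>\<phi>2 w / cnj (\<eta> w)\<close> is the
    conjugate of the same quotient at any \<open>z\<close> in \<open>U\<close>; hence it is constant
    and real.\<close>
  define \<kappa> where "\<kappa> = \<phi>2 w2 / cnj (\<eta> w2)"
  have \<eta>U: "\<eta> w \<noteq> 0" if "w \<in> U" for w using \<eta> U that by auto
  have "\<phi>2 w / cnj (\<eta> w) = cnj (\<phi>2 z / cnj (\<eta> z))" if "z \<in> U" "w \<in> U" for z w
    using sym[OF that] \<eta>U[OF that(1)] \<eta>U[OF that(2)] by (simp add: frac_eq_eq)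
  then have \<kappa>1: "\<phi>2 w / cnj (\<eta> w) = cnj \<kappa>" if "w \<in> U" for w using that U unfolding \<kappa>_def by blast
  have \<kappa>real: "\<kappa> = cnj \<kappa>" using \<kappa>1[OF U(2)] unfolding \<kappa>_def .
  then have \<phi>2: "\<phi>2 w = \<kappa> * cnj (\<eta> w)" if "w \<in> U" for w
    using \<kappa>1[OF that] \<eta>U[OF that] by (simp add: field_simps)
  obtain x :: real where x: "\<kappa> = complex_of_real x"
    using \<kappa>real by (metis Reals_cases Reals_cnj_iff)
  have "x \<noteq> 0"
  proof
    assume "x = 0"
    then have "hform g' (f z) (f w) = 0" if "z \<in> U" "w \<in> U" for z w
      using M[OF that] \<phi>2[OF that(1)] x by simp
    moreover have "U \<noteq> {}" using U by blast
    ultimately show False using nonzero_on_open[OF nz U(1) _ UB(1) U(1) _ UB(1)] by blast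
  qed
  define \<psi> where "\<psi> = (\<lambda>z. complex_of_real (sqrt \<bar>x\<bar>) * cnj (\<eta> z))"
  have "hform g' (f z) (f w) = complex_of_real (sgn x) * \<psi> z * cnj (\<psi> w) * hform g z w"
    if "z \<in> U" "w \<in> U" for z w
  proof -
    have "complex_of_real x = complex_of_real (sgn x) * (complex_of_real (sqrt \<bar>x\<bar>) * complex_of_real (sqrt \<bar>x\<bar>))"
      unfolding of_real_mult[symmetric] by (simp add: sgn_mult_abs)
    then show ?thesis
      using M[OF that] \<phi>2[OF that(1)] x by (simp add: \<psi>_def algebra_simps)
  qed
  moreover have "sgn x = 1 \<or> sgn x = - 1" using \<open>x \<noteq> 0\<close> by (simp add: sgn_if)
  moreover have "\<forall>z\<in>U. \<psi> z \<noteq> 0" using \<eta>U \<open>x \<noteq> 0\<close> by (simp add: \<psi>_def)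
  ultimately show ?thesis using U UB
    by (intro exI[of _ U] exI[of _ \<psi>] exI[of _ "sgn x"]) auto
qed

end

section \<open>From the local form to the global map\<close>

lemma cholomorphic_on_subset:
  assumes "cholomorphic_on h W" "open B" "B \<subseteq> W" shows "cholomorphic_on h B"
  using assms unfolding cholomorphic_on_def by blast

lemma proj_open_coneD:
  assumes "proj_open_cone V"
  shows "open V" "0 \<notin> V"
  using assms unfolding proj_open_cone_def by blast+

lemma local_representative:
  assumes V: "proj_open_cone V" and F: "proj_holomorphic F V" and z: "z \<in> V"
  shows "\<exists>\<rho> h. \<rho> > 0 \<and> ball z \<rho> \<subseteq> V \<and> cholomorphic_on h (ball z \<rho>) \<and>
    (\<forall>w\<in>ball z \<rho>. \<exists>c. c \<noteq> 0 \<and> F w = c *s h w)"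
proof -
  obtain W h where W: "z \<in> W" "cholomorphic_on h W" "\<forall>w\<in>W \<inter> V. h w \<noteq> 0 \<and> proj_eq (F w) (h w)"
    using F z unfolding proj_holomorphic_def by blast
  have "open (W \<inter> V)" using W(2) proj_open_coneD[OF V] unfolding cholomorphic_on_def by blast
  moreover have "z \<in> W \<inter> V" using W(1) z by blast
  ultimately obtain \<rho> where \<rho>: "\<rho> > 0" "ball z \<rho> \<subseteq> W \<inter> V" using openE by blast
  have "cholomorphic_on h (ball z \<rho>)" by (rule cholomorphic_on_subset[OF W(2)]) (use \<rho> in auto)
  moreover have "\<forall>w\<in>ball z \<rho>. \<exists>c. c \<noteq> 0 \<and> F w = c *s h w"
    using W(3) \<rho>(2) unfolding proj_eq_def by blast
  ultimately show ?thesis using \<rho> by (intro exI[of _ \<rho>] exI[of _ h]) auto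
qed

text \<open>\<open>F\<close> is determined only up to scalars. Homogeneity of \<open>P\<close> makes
  its vanishing independent of the representative, so holomorphic representatives on balls carry it
  through the connected cone.\<close>

lemma identity_on_cone:
  fixes F :: "complex ^ 'n \<Rightarrow> complex ^ 'm" and P :: "complex ^ 'n \<Rightarrow> complex ^ 'm \<Rightarrow> complex"
  assumes V: "proj_open_cone V" and conn: "connected V" and F: "proj_holomorphic F V"
    and scale: "\<And>z c y. P z (c *s y) = c * P z y"
    and hol: "\<And>f W z u. line_holomorphic_on f W \<Longrightarrow>
      (\<lambda>t. P (z + t *s u) (f (z + t *s u))) holomorphic_on {t. z + t *s u \<in> W}"
    and U: "open U" "U \<noteq> {}" "U \<subseteq> V" and zero: "\<And>z. z \<in> U \<Longrightarrow> P z (F z) = 0" and z: "z \<in> V"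
  shows "P z (F z) = 0"
proof -
  \<comment> \<open>Vanishing on a neighbourhood, not just at a point, is what spreads across a
    ball.\<close>
  define Q where "Q = (\<lambda>x. \<exists>T. open T \<and> x \<in> T \<and> (\<forall>w\<in>T. w \<in> V \<longrightarrow> P w (F w) = 0))"
  obtain u where u: "u \<in> U" using U by blast
  have "Q z"
  proof (rule connected_induction_simple[OF conn])
    show "u \<in> V" using u U by blast
    show "z \<in> V" by fact
    show "Q u" unfolding Q_def using u U zero by (intro exI[of _ U]) auto
    fix a assume a: "a \<in> V"
    obtain \<rho> h where h: "\<rho> > 0" "ball a \<rho> \<subseteq> V" "cholomorphic_on h (ball a \<rho>)"
      "\<forall>w\<in>ball a \<rho>. \<exists>c. c \<noteq> 0 \<and> F w = c *s h w"
      using local_representative[OF V F a] by (elim exE conjE)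
    have PFh: "P w (F w) = 0 \<longleftrightarrow> P w (h w) = 0" if w: "w \<in> ball a \<rho>" for w
    proof -
      obtain c where "c \<noteq> 0" "F w = c *s h w" using h(4) w by blast
      then show ?thesis using scale by simp
    qed
    have line: "line_holomorphic_on h (ball a \<rho>)" by (rule cholomorphic_imp_line_holomorphic[OF h(3)])
    have "Q y" if x: "x \<in> ball a \<rho>" and y: "y \<in> ball a \<rho>" and Qx: "Q x" for x y
    proof -
      obtain T where T: "open T" "x \<in> T" "\<forall>w\<in>T. w \<in> V \<longrightarrow> P w (F w) = 0" using Qx unfolding Q_def by blast
      have T0: "P w (h w) = 0" if wT: "w \<in> T" and wB: "w \<in> ball a \<rho>" for w
      proof -
        have "w \<in> V" using h(2) wB by blast
        then have "P w (F w) = 0" using T(3) wT by blast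
        then show ?thesis using PFh[OF wB] by simp
      qed
      have "P w (F w) = 0" if wB: "w \<in> ball a \<rho>" for w
      proof -
        have "P w (h w) = 0"
          by (rule identity_theorem_convex[OF open_ball convex_ball hol[OF line] x T(1,2) T0 wB])
        then show ?thesis using PFh[OF wB] by simp
      qed
      then show ?thesis unfolding Q_def using y by (intro exI[of _ "ball a \<rho>"]) auto
    qed
    moreover have "openin (top_of_set V) (ball a \<rho>)" using h(2) by (simp add: open_subset)
    ultimately show "\<exists>T. openin (top_of_set V) T \<and> a \<in> T \<and> (\<forall>x\<in>T. \<forall>y\<in>T. Q x \<longrightarrow> Q y)"
      using centre_in_ball[of a \<rho>] h(1) by blast
  qed
  then obtain T where "z \<in> T" "\<forall>w\<in>T. w \<in> V \<longrightarrow> P w (F w) = 0" unfolding Q_def by blast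
  then show ?thesis using z by simp
qed

text \<open>Continuation acts on the first argument only; Hermitian symmetry then exchanges the
  roles.\<close>

lemma hform_identity_on_cone:
  fixes F :: "complex ^ 'n \<Rightarrow> complex ^ 'm"
  assumes V: "proj_open_cone V" and conn: "connected V" and F: "proj_holomorphic F V"
    and U: "open U" "U \<noteq> {}" "U \<subseteq> V" and zero: "\<And>z w. z \<in> U \<Longrightarrow> w \<in> U \<Longrightarrow> hform k (A *v F z) (A *v F w) = 0"
    and z: "z \<in> V" and w: "w \<in> V"
  shows "hform k (A *v F z) (A *v F w) = 0"
proof -
  have id: "hform k (A *v F z) y = 0"
    if y: "\<And>z. z \<in> U \<Longrightarrow> hform k (A *v F z) y = 0" and zV: "z \<in> V" for z y
  proof (rule identity_on_cone[where P = "\<lambda>z x. hform k (A *v x) y", OF V conn F _ _ U y zV])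
    show "hform k (A *v (c *s x)) y = c * hform k (A *v x) y" for c x
      by (simp add: vector_scalar_commute hform_scale_left)
    show "(\<lambda>t. hform k (A *v f (z + t *s u)) y) holomorphic_on {t. z + t *s u \<in> W}"
      if f: "line_holomorphic_on f W" for f W z u
      unfolding hform_def matrix_vector_mult_def
      by (simp, intro holomorphic_intros line_holomorphic_onD[OF f]) auto
  qed
  have 1: "hform k (A *v F z) (A *v F w) = 0" if "z \<in> V" "w \<in> U" for z w
    by (rule id[OF _ that(1)]) (use zero that in blast)
  have "hform k (A *v F w) (A *v F z) = 0"
    by (rule id[OF _ w]) (use 1[OF z] hform_commute_eq_0 in blast)
  then show ?thesis using hform_commute_eq_0 by blast
qed

text \<open>Parallelism is the vanishing of the minors of \<open>z\<close> and
  \<open>R *v F z\<close>, which are homogeneous in \<open>F z\<close>.\<close>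

lemma proportional_identity_on_cone:
  fixes F :: "complex ^ 'n \<Rightarrow> complex ^ 'm" and R :: "complex ^ 'm ^ 'n"
  assumes V: "proj_open_cone V" and conn: "connected V" and F: "proj_holomorphic F V"
    and U: "open U" "U \<noteq> {}" "U \<subseteq> V" and par: "\<And>z. z \<in> U \<Longrightarrow> \<exists>c. R *v F z = c *s z"
    and z: "z \<in> V"
  shows "\<exists>c. R *v F z = c *s z"
proof -
  have eq: "z $ i * (R *v F z) $ j - z $ j * (R *v F z) $ i = 0" for i j
  proof (rule identity_on_cone[where P = "\<lambda>z x. z $ i * (R *v x) $ j - z $ j * (R *v x) $ i",
        OF V conn F _ _ U _ z])
    show "z $ i * (R *v (c *s y)) $ j - z $ j * (R *v (c *s y)) $ i =
       c * (z $ i * (R *v y) $ j - z $ j * (R *v y) $ i)" for z c y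
      by (simp add: vector_scalar_commute algebra_simps)
    show "(\<lambda>t. (z + t *s u) $ i * (R *v f (z + t *s u)) $ j - (z + t *s u) $ j * (R *v f (z + t *s u)) $ i)
        holomorphic_on {t. z + t *s u \<in> W}" if f: "line_holomorphic_on f W" for f W z u
      unfolding matrix_vector_mult_def
      by (simp, intro holomorphic_intros line_holomorphic_onD[OF f]) auto
    show "z $ i * (R *v F z) $ j - z $ j * (R *v F z) $ i = 0" if "z \<in> U" for z
      using par[OF that] by auto
  qed
  have "z \<noteq> 0" using z proj_open_coneD(2)[OF V] by blast
  then obtain i where i: "z $ i \<noteq> 0" by (auto simp: vec_eq_iff)
  have "R *v F z = ((R *v F z) $ i / z $ i) *s z"
    using eq[of i] i by (auto simp: vec_eq_iff field_simps)
  then show ?thesis by blast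
qed

section \<open>Null spaces, adjoints and the linear model\<close>

lemma csubspace_span: "csubspace (vec.span S)"
  unfolding csubspace_def by (auto intro: vec.span_zero vec.span_add vec.span_scale)

lemma span_subset_csubspace:
  assumes "csubspace T" "S \<subseteq> T" shows "vec.span S \<subseteq> T"
  using assms by (intro vec.span_minimal) (auto simp: csubspace_def vec.subspace_def)

lemma null_space_span:
  assumes "\<And>x y. x \<in> S \<Longrightarrow> y \<in> S \<Longrightarrow> hform k x y = 0"
  shows "null_space k (vec.span S)"
proof -
  have 1: "hform k x y = 0" if "x \<in> vec.span S" "y \<in> S" for x y
  proof -
    have "vec.span S \<subseteq> {x. hform k x y = 0}"
      using assms that(2) by (intro span_subset_csubspace) (auto simp: csubspace_def hform_simps)
    then show ?thesis using that by blast
  qed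
  have "hform k x y = 0" if x: "x \<in> vec.span S" and y: "y \<in> vec.span S" for x y
  proof -
    have "vec.span S \<subseteq> {y. hform k x y = 0}"
      using 1[OF x] by (intro span_subset_csubspace) (auto simp: csubspace_def hform_simps)
    then show ?thesis using y by blast
  qed
  then show ?thesis unfolding null_space_def using csubspace_span by blast
qed

text \<open>The adjoint of \<open>L\<close> for the two forms: the conjugate transpose between the
  diagonal matrices of \<open>g\<close> and \<open>g'\<close>, the former being its own inverse when
  \<open>g i * g i = 1\<close>.\<close>

definition adjoint_matrix :: "('n::finite \<Rightarrow> real) \<Rightarrow> ('m::finite \<Rightarrow> real) \<Rightarrow> complex ^ 'n ^ 'm \<Rightarrow> complex ^ 'm ^ 'n"
  where "adjoint_matrix g g' L = (\<chi> j b. complex_of_real (g j) * complex_of_real (g' b) * cnj (L $ b $ j))"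

lemma hform_adjoint_matrix:
  assumes "\<And>i. g i * g i = 1"
  shows "hform g (adjoint_matrix g g' L *v y) x = hform g' y (L *v x)"
proof -
  have gg: "complex_of_real (g i) * (complex_of_real (g i) * z) = z" for i z
    using assms[of i] by (metis mult.assoc mult_1 of_real_1 of_real_mult)
  have "hform g (adjoint_matrix g g' L *v y) x =
    (\<Sum>i\<in>UNIV. \<Sum>b\<in>UNIV. complex_of_real (g' b) * y $ b * cnj (L $ b $ i) * cnj (x $ i))"
    unfolding hform_def adjoint_matrix_def matrix_vector_mult_def
    by (simp add: sum_distrib_left sum_distrib_right mult_ac gg)
  also have "\<dots> = (\<Sum>b\<in>UNIV. \<Sum>i\<in>UNIV. complex_of_real (g' b) * y $ b * cnj (L $ b $ i) * cnj (x $ i))"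
    by (rule sum.swap)
  also have "\<dots> = hform g' y (L *v x)"
    unfolding hform_def matrix_vector_mult_def by (simp add: sum_distrib_left mult_ac)
  finally show ?thesis .
qed

text \<open>The columns of \<open>L\<close> are difference quotients of \<open>f\<close> along the coordinate axes, so that no basis
  has to be found inside \<open>U\<close>.\<close>
lemma linear_map_from_form:
  fixes f :: "complex ^ 'n \<Rightarrow> complex ^ 'm"
  assumes U: "open U" "U \<noteq> {}"
    and form: "\<And>z w. z \<in> U \<Longrightarrow> w \<in> U \<Longrightarrow> hform g' (f z) (f w) = complex_of_real c * hform g z w"
  obtains L where "\<And>z x. z \<in> U \<Longrightarrow> hform g' (f z) (L *v x) = complex_of_real c * hform g z x"
    "\<And>u v. hform g' (L *v u) (L *v v) = complex_of_real c * hform g u v"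
proof -
  obtain z0 where z0: "z0 \<in> U" using U by blast
  obtain e where e: "e > 0" "ball z0 e \<subseteq> U" using U z0 openE by blast
  define \<epsilon> where "\<epsilon> = complex_of_real (e / 2)"
  have \<epsilon>: "\<epsilon> \<noteq> 0" "cnj \<epsilon> = \<epsilon>" using e by (auto simp: \<epsilon>_def)
  have inU: "z0 + \<epsilon> *s axis i 1 \<in> U" for i
  proof -
    have "dist z0 (z0 + \<epsilon> *s axis i 1) = e / 2"
      using e by (simp add: dist_norm norm_smult_complex \<epsilon>_def)
    then show ?thesis using e by auto
  qed
  define l where "l = (\<lambda>i. (1 / \<epsilon>) *s (f (z0 + \<epsilon> *s axis i 1) - f z0))"
  define L :: "complex ^ 'n ^ 'm" where "L = (\<chi> a i. l i $ a)"
  have L: "L *v x = (\<Sum>i\<in>UNIV. x $ i *s l i)" for x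
    unfolding matrix_mult_sum by (simp add: L_def column_def)
  have x: "x = (\<Sum>i\<in>UNIV. x $ i *s axis i 1)" for x :: "complex ^ 'n"
    by (rule basis_expansion[symmetric])
  have l: "hform g' y (l i) = hform g z (axis i 1) * complex_of_real c"
    if "\<And>w. w \<in> U \<Longrightarrow> hform g' y (f w) = complex_of_real c * hform g z w" for y z i
    using that[OF inU] that[OF z0] \<epsilon>
    by (simp add: l_def hform_scale_right hform_diff_right hform_add_right field_simps)
  \<comment> \<open>Used twice: for \<open>y = f z\<close>, and then for \<open>y = L *v u\<close>,
    which meets the same hypothesis by symmetry.\<close>
  have yL: "hform g' y (L *v x) = complex_of_real c * hform g z x"
    if "\<And>w. w \<in> U \<Longrightarrow> hform g' y (f w) = complex_of_real c * hform g z w" for y z x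
  proof -
    have "hform g' y (L *v x) = (\<Sum>i\<in>UNIV. cnj (x $ i) * (hform g z (axis i 1) * complex_of_real c))"
      unfolding L hform_sum_right hform_scale_right using l[OF that] by simp
    also have "\<dots> = complex_of_real c * hform g z (\<Sum>i\<in>UNIV. x $ i *s axis i 1)"
      unfolding hform_sum_right hform_scale_right by (simp add: sum_distrib_left mult_ac)
    also have "\<dots> = complex_of_real c * hform g z x" using x[of x] by simp
    finally show ?thesis .
  qed
  have 1: "hform g' (f z) (L *v x) = complex_of_real c * hform g z x" if "z \<in> U" for z x
    using form that by (intro yL)
  have "hform g' (L *v u) (f w) = complex_of_real c * hform g u w" if "w \<in> U" for u w
  proof -
    have "hform g' (L *v u) (f w) = cnj (hform g' (f w) (L *v u))" by (simp add: cnj_hform)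
    also have "\<dots> = complex_of_real c * hform g u w" unfolding 1[OF that] by (simp add: cnj_hform)
    finally show ?thesis .
  qed
  then have "hform g' (L *v u) (L *v v) = complex_of_real c * hform g u v" for u v by (rule yL)
  then show ?thesis using that 1 by blast
qed

lemma hform_scaled_form: "hform (\<lambda>i. c * g i) x y = complex_of_real c * hform g x y"
  by (simp add: hform_def sum_distrib_left mult_ac)

text \<open>The adjoint \<open>R\<close> is a left inverse of \<open>L\<close>, and
  \<open>P = L ** R\<close> is the orthogonal projection onto the image of \<open>L\<close>. On
  \<open>U\<close> the remainders \<open>f z - L *v z\<close> are mutually orthogonal and
  \<open>R *v f z = z\<close>; in projective form both facts spread to \<open>V\<close>.\<close>

lemma quasi_linear_of_form:
  fixes F :: "complex ^ 'n \<Rightarrow> complex ^ 'm" and c :: real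
  assumes V: "proj_open_cone V" and conn: "connected V" and F: "proj_holomorphic F V"
    and g: "\<And>i. g i * g i = 1" and c: "c = 1 \<or> c = - 1"
    and U: "open U" "U \<noteq> {}" "U \<subseteq> V"
    and fF: "\<And>z. z \<in> U \<Longrightarrow> \<exists>k. k \<noteq> 0 \<and> F z = k *s f z"
    and form: "\<And>z w. z \<in> U \<Longrightarrow> w \<in> U \<Longrightarrow> hform g' (f z) (f w) = complex_of_real c * hform g z w"
  shows "quasi_linear g' F V \<and> (c = 1 \<longrightarrow> quasi_standard g g' F V) \<and>
    (\<forall>z\<in>V. \<exists>r\<ge>0. hform g' (F z) (F z) = complex_of_real (c * r) * hform g z z)"
proof -
  obtain L where fL0: "\<And>z x. z \<in> U \<Longrightarrow> hform g' (f z) (L *v x) = complex_of_real c * hform g z x"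
    and LL0: "\<And>u v. hform g' (L *v u) (L *v v) = complex_of_real c * hform g u v"
    using linear_map_from_form[OF U(1,2) form] by blast
  \<comment> \<open>Absorbs the sign: \<open>L\<close> is isometric from \<open>G\<close> to
    \<open>g'\<close> for either value of \<open>c\<close>.\<close>
  define G where "G = (\<lambda>i. c * g i)"
  have GG: "G i * G i = 1" for i using g[of i] c by (auto simp: G_def)
  have G0: "G i \<noteq> 0" for i using GG[of i] by auto
  have G: "hform G x y = complex_of_real c * hform g x y" for x y
    unfolding G_def by (rule hform_scaled_form)
  have fL: "hform g' (f z) (L *v x) = hform G z x" if "z \<in> U" for z x using fL0[OF that] G by simp
  have LL: "hform g' (L *v u) (L *v v) = hform G u v" for u v using LL0 G by simp
  define R where "R = adjoint_matrix G g' L"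
  have R: "hform G (R *v y) x = hform g' y (L *v x)" for x y
    unfolding R_def by (rule hform_adjoint_matrix[OF GG])
  have inj: "u = v" if "\<And>x. hform G u x = hform G v x" for u v
    using hform_nondegenerate[of G "u - v"] G0 that by (simp add: hform_diff_left)
  have RL: "R *v (L *v u) = u" for u by (rule inj) (simp add: R LL)
  have Rf: "R *v f z = z" if "z \<in> U" for z by (rule inj) (simp add: R fL[OF that])
  have Lf: "hform g' (L *v x) (f z) = hform G x z" if "z \<in> U" for z x
    using fL[OF that, of x] cnj_hform[of g' "f z" "L *v x"] cnj_hform[of G z x] by simp
  define P where "P = L ** R"
  have P: "P *v y = L *v (R *v y)" for y by (simp add: P_def matrix_vector_mul_assoc)
  have Q: "(mat 1 - P) *v y = y - L *v (R *v y)" for y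
    by (simp add: matrix_vector_mult_diff_rdistrib P)
  have PL: "P *v (L *v u) = L *v u" for u by (simp add: P RL)
  obtain z0 where z0: "z0 \<in> U" using U by blast
  have z0V: "z0 \<in> V" and z00: "z0 \<noteq> 0" using z0 U proj_open_coneD(2)[OF V] by auto
  have Lz: "L *v z \<noteq> 0" if "z \<noteq> 0" for z
  proof
    assume "L *v z = 0"
    then have "z = R *v 0" using RL[of z] by simp
    then show False using that by simp
  qed
  have "P ** P = P" unfolding matrix_eq matrix_vector_mul_assoc[symmetric] P RL by simp
  moreover have "P \<noteq> 0" using PL[of z0] Lz[OF z00] by auto
  moreover have PQ: "hform g' (P *v x) ((mat 1 - P) *v y) = 0" for x y
  proof -
    have "hform g' (L *v (R *v x)) y = cnj (hform g' y (L *v (R *v x)))" by (simp add: cnj_hform)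
    also have "\<dots> = hform G (R *v x) (R *v y)" unfolding R[symmetric] by (simp add: cnj_hform)
    finally show ?thesis unfolding P Q hform_diff_right LL by simp
  qed
  ultimately have decomp: "P \<noteq> mat 1 \<Longrightarrow> orth_decomp g' P" unfolding orth_decomp_def by blast
  have QQU: "hform g' ((mat 1 - P) *v F z) ((mat 1 - P) *v F w) = 0" if zw: "z \<in> U" "w \<in> U" for z w
  proof -
    have "hform g' ((mat 1 - P) *v f z) ((mat 1 - P) *v f w) = 0"
      unfolding Q Rf[OF zw(1)] Rf[OF zw(2)] hform_diff_left hform_diff_right fL[OF zw(1)] Lf[OF zw(2)] LL
      using form[OF zw] G by simp
    moreover obtain k l where "F z = k *s f z" "F w = l *s f w" using fF zw by blast
    ultimately show ?thesis by (simp add: vector_scalar_commute hform_scale_left hform_scale_right)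
  qed
  have QQ: "hform g' ((mat 1 - P) *v F z) ((mat 1 - P) *v F w) = 0" if "z \<in> V" "w \<in> V" for z w
    by (rule hform_identity_on_cone[OF V conn F U QQU that])
  have "\<exists>k. R *v F z = k *s z" if z: "z \<in> U" for z
  proof -
    obtain k where "F z = k *s f z" using fF z by blast
    then have "R *v F z = k *s z" by (simp add: vector_scalar_commute Rf[OF z])
    then show ?thesis by blast
  qed
  then have RF: "\<exists>k. R *v F z = k *s z" if "z \<in> V" for z
    using proportional_identity_on_cone[OF V conn F U _ that] by blast
  have PF: "\<exists>k. P *v F z = k *s (L *v z)" if "z \<in> V" for z
    using RF[OF that] unfolding P by (auto simp: vector_scalar_commute)
  have PFz0: "P *v F z0 \<noteq> 0"
  proof -
    obtain k where "k \<noteq> 0" "F z0 = k *s f z0" using fF z0 by blast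
    then show ?thesis using Lz[OF z00] by (simp add: P vector_scalar_commute Rf[OF z0])
  qed
  have ind: "induced_by (\<lambda>z. P *v F z) V L"
    unfolding induced_by_def
  proof (intro conjI bexI[of _ z0] ballI impI)
    fix z assume z: "z \<in> V" "P *v F z \<noteq> 0 \<and> L *v z \<noteq> 0"
    then obtain k where "P *v F z = k *s (L *v z)" using PF by blast
    with z show "proj_eq (P *v F z) (L *v z)" unfolding proj_eq_def by auto
  qed (use PFz0 Lz[OF z00] z0V in auto)
  \<comment> \<open>The values need not form a subspace, but their span is still null.\<close>
  define H where "H = vec.span ((\<lambda>z. (mat 1 - P) *v F z) ` V)"
  have Hnull: "null_space g' H" unfolding H_def by (rule null_space_span) (use QQ in auto)
  have "H \<subseteq> {y. P *v y = 0}" unfolding H_def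
    by (rule span_subset_csubspace)
       (auto simp: csubspace_def matrix_vector_right_distrib vector_scalar_commute P Q
          matrix_vector_mult_diff_distrib RL)
  then have Hrange: "H \<subseteq> range (\<lambda>y. (mat 1 - P) *v y)"
  proof (intro subsetI)
    fix y assume "y \<in> H"
    then have "y = (mat 1 - P) *v y"
      using \<open>H \<subseteq> {y. P *v y = 0}\<close> by (auto simp: matrix_vector_mult_diff_rdistrib)
    then show "y \<in> range (\<lambda>y. (mat 1 - P) *v y)" by (rule range_eqI)
  qed
  have HF: "\<forall>z\<in>V. (mat 1 - P) *v F z \<in> H" unfolding H_def by (auto intro: vec.span_base)
  have PLu: "\<forall>u. P *v (L *v u) = L *v u" using PL by blast
  \<comment> \<open>A decomposition needs a nonzero second summand; without one, \<open>F\<close>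
    itself is induced by \<open>L\<close>.\<close>
  have P1: "induced_by F V L" if "P = mat 1" using ind unfolding that by simp
  have iso: "isometry g g' L" if "c = 1" unfolding isometry_def using LL0 that by simp
  have "quasi_linear g' F V"
  proof (cases "P = mat 1")
    case True
    then show ?thesis using P1 unfolding quasi_linear_def linear_map_def by blast
  next
    case False
    then show ?thesis
      unfolding quasi_linear_def using decomp PLu ind Hnull Hrange HF by blast
  qed
  moreover have "quasi_standard g g' F V" if c1: "c = 1"
  proof (cases "P = mat 1")
    case True
    then show ?thesis using P1 iso[OF c1] unfolding quasi_standard_def standard_map_def by blast
  next
    case False
    then show ?thesis
      unfolding quasi_standard_def using decomp PLu ind iso[OF c1] Hnull Hrange HF by blast
  qed
  moreover have "\<exists>r\<ge>0. hform g' (F z) (F z) = complex_of_real (c * r) * hform g z z" if z: "z \<in> V" for z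
  proof -
    \<comment> \<open>The two components of \<open>F z\<close> are orthogonal and the second is
      null, so only \<open>P *v F z\<close> contributes; \<open>r\<close> is the squared modulus of
      \<open>k\<close>.\<close>
    obtain k where k: "P *v F z = k *s (L *v z)" using PF[OF z] by blast
    have split: "F z = P *v F z + (mat 1 - P) *v F z" by (simp add: P Q)
    have PQ': "hform g' ((mat 1 - P) *v F z) (P *v F z) = 0"
      using PQ hform_commute_eq_0 by blast
    have "hform g' (F z) (F z) = hform g' (P *v F z + (mat 1 - P) *v F z) (P *v F z + (mat 1 - P) *v F z)"
      using split by simp
    also have "\<dots> = hform g' (P *v F z) (P *v F z)"
      unfolding hform_add_left hform_add_right using PQ PQ' QQ[OF z z] by simp
    also have "\<dots> = (k * cnj k) * hform G z z"
      unfolding k hform_scale_left hform_scale_right LL by simp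
    also have "\<dots> = complex_of_real (c * (cmod k)\<^sup>2) * hform g z z"
      unfolding G complex_norm_square[symmetric] by simp
    finally show ?thesis by (intro exI[of _ "(cmod k)\<^sup>2"]) simp
  qed
  ultimately show ?thesis by blast
qed

section \<open>Signatures and the final assembly\<close>

lemma is_signature_nondegenerate:
  fixes g :: "'n::finite \<Rightarrow> real"
  assumes "is_signature g r s 0"
  shows "g i * g i = 1" "CARD('n) = r + s"
proof -
  have *: "g i \<in> {1, -1, 0}" for i using assms unfolding is_signature_def by blast
  have "{i. g i = 0} = {}" using assms by (simp add: is_signature_def)
  then have "g i \<noteq> 0" for i by blast
  then have pm: "g i = 1 \<or> g i = -1" for i using *[of i] by simp
  then show "g i * g i = 1" by (metis mult_1 mult_minus_left mult_minus_right minus_minus)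
  have "(UNIV :: 'n set) = {i. g i = 1} \<union> {i. g i = -1}" using pm by auto
  moreover have "card ({i. g i = 1} \<union> {i. g i = -1}) = r + s"
    using assms by (subst card_Un_disjoint) (auto simp: is_signature_def)
  ultimately show "CARD('n) = r + s" by simp
qed

lemma is_signature_rank:
  fixes g :: "'m::finite \<Rightarrow> real"
  assumes "is_signature g r s t"
  shows "card {i. g i \<noteq> 0} = r + s"
proof -
  have *: "g i \<in> {1, -1, 0}" for i using assms unfolding is_signature_def by blast
  have "{i. g i \<noteq> 0} = {i. g i = 1} \<union> {i. g i = -1}" using * by force
  moreover have "card ({i. g i = 1} \<union> {i. g i = -1}) = r + s"
    using assms by (subst card_Un_disjoint) (auto simp: is_signature_def)
  ultimately show ?thesis by simp
qed

theorem mainTheorem11: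
  fixes sg :: "'n::finite \<Rightarrow> real" and sg' :: "'m::finite \<Rightarrow> real"
    and r s r' s' t' :: nat
    and F :: "complex ^ 'n \<Rightarrow> complex ^ 'm" and V :: "(complex ^ 'n) set"
  assumes "is_signature sg r s 0"
    and "is_signature sg' r' s' t'"
    and "local_orthogonal sg sg' F V"
    and "r' + s' + 3 \<le> 2 * (r + s)"
  shows "(null_map sg' F V \<or> quasi_linear sg' F V) \<and>
         ((\<exists>z\<in>V. Re (hform sg z z) > 0 \<and> Re (hform sg' (F z) (F z)) > 0) \<or>
          (\<exists>z\<in>V. Re (hform sg z z) < 0 \<and> Re (hform sg' (F z) (F z)) < 0)
          \<longrightarrow> quasi_standard sg sg' F V)"
proof -
  note sg = is_signature_nondegenerate[OF assms(1)]
  have sg0: "sg i \<noteq> 0" for i using sg(1)[of i] by auto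
  have rank: "card {j. sg' j \<noteq> 0} + 3 \<le> 2 * CARD('n)"
    using assms(4) is_signature_rank[OF assms(2)] sg(2) by simp
  have V: "proj_open_cone V" and conn: "connected V" and F: "proj_holomorphic F V"
    and orthF: "\<And>p q. p \<in> V \<Longrightarrow> q \<in> V \<Longrightarrow> hform sg p q = 0 \<Longrightarrow> hform sg' (F p) (F q) = 0"
    using assms(3) unfolding local_orthogonal_def by blast+
  obtain zn where zn: "zn \<in> V" "hform sg zn zn = 0"
    using assms(3) unfolding local_orthogonal_def by blast
  obtain \<rho> h where \<rho>: "\<rho> > 0" "ball zn \<rho> \<subseteq> V" and h: "cholomorphic_on h (ball zn \<rho>)"
    and hF: "\<forall>w\<in>ball zn \<rho>. \<exists>c. c \<noteq> 0 \<and> F w = c *s h w"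
    using local_representative[OF V F zn(1)] by (elim exE conjE)
  define B where "B = ball zn \<rho>"
  have znB: "zn \<in> B" using \<rho> by (simp add: B_def)
  have FhB: "hform sg' (F z) (F w) = 0 \<longleftrightarrow> hform sg' (h z) (h w) = 0" if zw: "z \<in> B" "w \<in> B" for z w
  proof -
    obtain a b where "a \<noteq> 0" "F z = a *s h z" "b \<noteq> 0" "F w = b *s h w"
      using hF zw unfolding B_def by blast
    then show ?thesis by (simp add: hform_scale_left hform_scale_right)
  qed
  have deriv: "\<exists>D. (h has_derivative D) (at z) \<and> (\<forall>c v. D (c *s v) = c *s D v)" if "z \<in> B" for z
    using h that unfolding cholomorphic_on_def B_def by blast
  interpret local_orthogonal_diff sg sg' h B
  proof
    show "sg i \<noteq> 0" for i by (rule sg0)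
    show "open B" "convex B" by (simp_all add: B_def)
    show "0 \<notin> B" unfolding B_def using \<rho>(2) proj_open_coneD(2)[OF V] by blast
    show "line_holomorphic_on h B" unfolding B_def by (rule cholomorphic_imp_line_holomorphic[OF h])
    show "hform sg' (h z) (h w) = 0" if zw: "z \<in> B" "w \<in> B" "hform sg z w = 0" for z w
    proof -
      have "z \<in> V" "w \<in> V" using zw \<rho> unfolding B_def by blast+
      then show ?thesis using orthF zw FhB by blast
    qed
    show "card {j. sg' j \<noteq> 0} + 3 \<le> 2 * CARD('n)" by (rule rank)
    fix z :: "complex ^ 'n" assume "z \<in> B"
    then obtain D where D: "(h has_derivative D) (at z)" "\<And>c v. D (c *s v) = c *s D v"
      using deriv[of z] by auto
    have eq: "dirderiv h v z = D v" for v by (rule cholomorphic_dirderiv[OF D])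
    show "dirderiv h (u + v) z = dirderiv h u z + dirderiv h v z" for u v
      unfolding eq using D(1) by (intro linear_add has_derivative_linear)
    show "dirderiv h (c *s v) z = c *s dirderiv h v z" for c v unfolding eq by (rule D(2))
  qed
  show ?thesis
  proof (cases "\<exists>zz\<in>B. \<exists>ww\<in>B. hform sg' (h zz) (h ww) \<noteq> 0")
    case False
    have BV: "open B" "B \<noteq> {}" "B \<subseteq> V" using znB \<rho> by (auto simp: B_def)
    have "hform sg' (mat 1 *v F z) (mat 1 *v F w) = 0" if "z \<in> V" "w \<in> V" for z w
      by (rule hform_identity_on_cone[OF V conn F BV _ that]) (use False FhB in simp)
    then have null: "hform sg' (F z) (F w) = 0" if "z \<in> V" "w \<in> V" for z w
      using that by simp
    have "null_map sg' F V" unfolding null_map_def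
      by (intro exI[of _ "vec.span (F ` V)"] conjI null_space_span ballI vec.span_base) (use null in auto)
    \<comment> \<open>Nullity gives \<open>hform sg' (F z) (F z) = 0\<close>, so the premise of the
      second claim fails.\<close>
    then show ?thesis using null by auto
  next
    case True
    then obtain zz ww where "zz \<in> B" "ww \<in> B" "hform sg' (h zz) (h ww) \<noteq> 0" by blast
    from local_form[OF this znB zn(2)] obtain U \<psi> c where
      U: "open U" "U \<noteq> {}" "U \<subseteq> B" and c: "c = 1 \<or> c = - 1" and \<psi>: "\<forall>z\<in>U. \<psi> z \<noteq> 0"
      and form: "\<forall>z\<in>U. \<forall>w\<in>U. hform sg' (h z) (h w) = complex_of_real c * \<psi> z * cnj (\<psi> w) * hform sg z w"
      by (elim exE conjE)
    \<comment> \<open>Dividing by \<open>\<psi>\<close> leaves \<open>c\<close> times the source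
      form and does not change projective classes.\<close>
    define f where "f = (\<lambda>z. (1 / \<psi> z) *s h z)"
    have UV: "U \<subseteq> V" using U \<rho> by (auto simp: B_def)
    have fF: "\<exists>k. k \<noteq> 0 \<and> F z = k *s f z" if z: "z \<in> U" for z
    proof -
      obtain a where "a \<noteq> 0" "F z = a *s h z" using hF z U(3) unfolding B_def by blast
      then show ?thesis using \<psi> z by (intro exI[of _ "a * \<psi> z"]) (simp add: f_def)
    qed
    have ff: "hform sg' (f z) (f w) = complex_of_real c * hform sg z w" if "z \<in> U" "w \<in> U" for z w
      unfolding f_def hform_scale_left hform_scale_right
      using form[rule_format, OF that] \<psi> that by (simp add: field_simps)
    from quasi_linear_of_form[OF V conn F sg(1) c U(1,2) UV fF ff]
    have ql: "quasi_linear sg' F V" and qs: "c = 1 \<longrightarrow> quasi_standard sg sg' F V"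
      and sign: "\<forall>z\<in>V. \<exists>r\<ge>0. hform sg' (F z) (F z) = complex_of_real (c * r) * hform sg z z"
      by blast+
    \<comment> \<open>For \<open>c = - 1\<close> a nonzero value at \<open>F z\<close> would have
      the sign opposite to that at \<open>z\<close>.\<close>
    have "c = 1" if z: "z \<in> V" "Re (hform sg z z) > 0 \<and> Re (hform sg' (F z) (F z)) > 0 \<or>
        Re (hform sg z z) < 0 \<and> Re (hform sg' (F z) (F z)) < 0" for z
    proof (rule ccontr)
      assume "c \<noteq> 1"
      then have c1: "c = - 1" using c by blast
      obtain r where r: "r \<ge> 0" "hform sg' (F z) (F z) = complex_of_real (c * r) * hform sg z z"
        using sign z(1) by blast
      have "Re (hform sg' (F z) (F z)) = - (r * Re (hform sg z z))" unfolding r(2) c1 by simp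
      then show False using z(2) r(1) by (smt (verit) mult_nonneg_nonneg mult_nonneg_nonpos)
    qed
    then show ?thesis using ql qs by blast
  qed
qed

end
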